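(* Assume the standing assumptions below and let $\alpha_1,\alpha_2\in\mathbb C$ with $\operatorname{Re}\alpha_1<0$ and $\operatorname{Re}\alpha_2<0$. Then there exist constants $\kappa_{2,0},\kappa_{1,1},\kappa_{0,2}$ such that for all integers $\ell,r\ge0$, as $n\to\infty$, \[ \frac{\mathbb E\bigl[F_{\alpha_1}(\mathcal T_n)^{\ell}F_{\alpha_2}(\mathcal T_n)^{r}\bigr]}{n^{(\ell+r)/2}}\ \to\ \sum_{\substack{0\le j\le\min(\ell,r)\\ j\equiv\ell\ (\mathrm{mod}\ 2)}}\binom{\ell}{j}\binom{r}{j}\,j!\,(\ell-j-1)!!\,(r-j-1)!!\;\kappa_{1,1}^{\,j}\kappa_{2,0}^{(\ell-j)/2}\kappa_{0,2}^{(r-j)/2} \] if $\ell+r$ is even, and the left-hand side tends to $0$ if $\ell+r$ is odd.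
   Context: Let $\xi$ be a random variable with values in $\{0,1,2,\dots\}$, $\mathbb E\xi=1$, $\sigma^2:=\operatorname{Var}\xi\in(0,\infty)$, span $1$, and $\mathbb E\xi^{2+\delta}<\infty$ for some $\delta>0$. Let $\mathcal T$ be a Galton–Watson tree with offspring distribution $\xi$ and $\mathcal T_n$ be $\mathcal T$ conditioned on having $n$ vertices. For $\operatorname{Re}\alpha<1/2$, $\mu(\alpha):=\mathbb E|\mathcal T|^\alpha$. For a rooted tree $T$, $F_\alpha(T):=\sum_{v\in T}\bigl(|T_v|^\alpha-\mu(\alpha)\bigr)$, with $T_v$ the fringe subtree rooted at $v$; thus $F_\alpha(\mathcal T_n)=\sum_{v\in\mathcal T_n}|\mathcal T_{n,v}|^\alpha-n\mu(\alpha)$. Double factorials of odd integers: $m!!=1\cdot3\cdots m$, with $(-1)!!=1$. *)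

theory Defs
  imports "HOL-Probability.Probability" "HOL-Complex_Analysis.Complex_Analysis"
begin

datatype ptree = Node "ptree list"

fun tsize :: "ptree \<Rightarrow> nat" where
  "tsize (Node ts) = 1 + sum_list (map tsize ts)"

fun gw_weight :: "nat pmf \<Rightarrow> ptree \<Rightarrow> real" where
  "gw_weight p (Node ts) = pmf p (length ts) * prod_list (map (gw_weight p) ts)"

definition trees_of_size :: "nat \<Rightarrow> ptree set" where
  "trees_of_size n = {t. tsize t = n}"

definition gw_size_prob :: "nat pmf \<Rightarrow> nat \<Rightarrow> real" where
  "gw_size_prob p n = (\<Sum>t\<in>trees_of_size n. gw_weight p t)"

definition cond_expect :: "nat pmf \<Rightarrow> nat \<Rightarrow> (ptree \<Rightarrow> complex) \<Rightarrow> complex" where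
  "cond_expect p n f =
     (\<Sum>t\<in>trees_of_size n. complex_of_real (gw_weight p t) * f t) / complex_of_real (gw_size_prob p n)"

definition gw_mu :: "nat pmf \<Rightarrow> complex \<Rightarrow> complex" where
  "gw_mu p \<alpha> = (\<Sum>n. complex_of_real (gw_size_prob p n) * (of_nat n :: complex) powr \<alpha>)"

fun fringe_pow_sum :: "complex \<Rightarrow> ptree \<Rightarrow> complex" where
  "fringe_pow_sum \<alpha> (Node ts) =
     (of_nat (tsize (Node ts)) :: complex) powr \<alpha> + sum_list (map (fringe_pow_sum \<alpha>) ts)"

definition F_alpha :: "nat pmf \<Rightarrow> complex \<Rightarrow> ptree \<Rightarrow> complex" where
  "F_alpha p \<alpha> t = fringe_pow_sum \<alpha> t - of_nat (tsize t) * gw_mu p \<alpha>"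

text \<open>Double factorial of odd numbers; dfact 0 = 1 also encodes (-1)!! = 1
  (nat subtraction 0 - 1 = 0).\<close>
fun dfact :: "nat \<Rightarrow> nat" where
  "dfact 0 = 1"
| "dfact (Suc 0) = 1"
| "dfact (Suc (Suc n)) = Suc (Suc n) * dfact n"

end

theory Submission
  imports Defs
begin

text \<open>
  By linearity it suffices to treat one toll \<open>f n = g n - \<mu>\<close> with \<open>g n = O(n powr (-\<epsilon>))\<close>: applying
  the result to \<open>F \<alpha>1 + u * F \<alpha>2\<close> for every complex \<open>u\<close> and comparing coefficients in \<open>u\<close>
  yields the joint moments, and the limiting second moment is a quadratic form in \<open>u\<close>.

  For one toll the moment generating series \<open>G k\<close>, with coefficients \<open>P(|T| = n) E[F(T_n)^k] / k!\<close>,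
  satisfy \<open>G k = V * S k\<close>, where \<open>V = 1 / (1 - X \<Phi>'(y))\<close> and \<open>S k\<close> only involves \<open>G j\<close> for
  \<open>j < k\<close>. Singularity analysis is replaced by a calculus of coefficient sequences: two
  series are identified when their coefficients differ by a polynomially smaller term, and
  products of such classes are controlled directly. By Lagrange inversion the coefficients of \<open>V\<close>
  are the return probabilities of the random walk with steps \<open>\<xi> - 1\<close>, so a local limit theorem
  with polynomial rate shows that \<open>V\<close> behaves like a multiple of \<open>(1 - X) powr (-1/2)\<close>. The
  contributions of \<open>G 1\<close> to \<open>S k\<close> and of the centring \<open>-\<mu>\<close> cancel, so \<open>G k\<close> behaves like
  \<open>d k * (1 - X) powr (-(k-1)/2)\<close> with \<open>d\<close> obeying the convolution recursion of the coefficients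
  of a square root, which are those of the Gaussian moments.
\<close>

text \<open>With only \<open>2 + \<delta>\<close> moments the size series \<open>y\<close> need not
  continue beyond the unit disc, and \<open>\<Phi>\<close> may lack a finite third derivative at 1.
  Everything is therefore done with coefficient bounds, and two facts make these close up. A
  summable series multiplies a slowly varying one like its value at 1 (\<open>mass\<close>), up to a
  polynomially smaller error. And although derivatives of \<open>\<Phi>\<close> of order 3 and more
  may diverge at 1, their composites with \<open>y\<close> grow slowly enough to be negligible; only
  \<open>\<Phi>''(y)\<close> survives to leading order. The limiting recursion is therefore
  quadratic, which is why a square root solves it.

  The exponent -1 is the dangerous one: there power sums become logarithmic. The first moment series
  would land exactly on it; centring the toll moves it below, so that \<open>G 1\<close> has
  summable coefficients. For its contributions to cancel, the value at 1 of
  \<open>X * \<Phi>''(y) * G 1\<close> must be known exactly; it is read off from differential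
  identities for \<open>y\<close> and \<open>V\<close>.\<close>

unbundle no vec_syntax

section \<open>Coefficient sequences of polynomial order\<close>

lemma powr_Suc_diff_ge:
  fixes s :: real
  assumes "-1 < s" "s \<le> 0"
  shows "(s + 1) * real (Suc n) powr s \<le> real (Suc n) powr (s + 1) - real n powr (s + 1)"
proof (cases "n = 0")
  case True
  then show ?thesis using assms by simp
next
  case False
  have "\<exists>z>real n. z < real (Suc n) \<and>
      real (Suc n) powr (s+1) - real n powr (s+1) = (real (Suc n) - real n) * ((s + 1) * z powr s)"
    using False by (intro MVT2) (auto intro!: derivative_eq_intros)
  then obtain z where z: "z > real n" "z < real (Suc n)"
    "real (Suc n) powr (s+1) - real n powr (s+1) = (s + 1) * z powr s" by auto
  have "real (Suc n) powr s \<le> z powr s"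
    using z assms by (intro powr_mono2') auto
  with z assms show ?thesis by (simp add: mult_left_mono)
qed

lemma powr_Suc_diff_le:
  fixes s :: real
  assumes "s < -1" "n > 0"
  shows "(- s - 1) * real (Suc n) powr s \<le> real n powr (s + 1) - real (Suc n) powr (s + 1)"
proof -
  have "\<exists>z>real n. z < real (Suc n) \<and>
      real (Suc n) powr (s+1) - real n powr (s+1) = (real (Suc n) - real n) * ((s + 1) * z powr s)"
    using assms by (intro MVT2) (auto intro!: derivative_eq_intros)
  then obtain z where z: "z > real n" "z < real (Suc n)"
    "real (Suc n) powr (s+1) - real n powr (s+1) = (s + 1) * z powr s" by auto
  have "real (Suc n) powr s \<le> z powr s"
    using z assms by (intro powr_mono2') auto
  then have "(- s - 1) * real (Suc n) powr s \<le> (- s - 1) * z powr s"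
    using assms by (intro mult_left_mono) auto
  with z show ?thesis by (simp add: algebra_simps)
qed

lemma sum_powr_le_large:
  fixes s :: real
  assumes "-1 < s"
  shows "\<exists>K>0. \<forall>n. (\<Sum>i<n. real (Suc i) powr s) \<le> K * real n powr (s + 1)"
proof (cases "s \<le> 0")
  case True
  have "(s + 1) * (\<Sum>i<n. real (Suc i) powr s) \<le> real n powr (s + 1)" for n
  proof -
    have "(s + 1) * (\<Sum>i<n. real (Suc i) powr s)
        \<le> (\<Sum>i<n. real (Suc i) powr (s + 1) - real i powr (s + 1))"
      unfolding sum_distrib_left using assms True by (intro sum_mono powr_Suc_diff_ge) auto
    also have "\<dots> = real n powr (s + 1)"
      by (subst sum_lessThan_telescope) simp
    finally show ?thesis .
  qed
  then show ?thesis using assms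
    by (intro exI[of _ "1 / (s + 1)"]) (auto simp: field_simps)
next
  case False
  have "(\<Sum>i<n. real (Suc i) powr s) \<le> 1 * real n powr (s + 1)" for n
  proof -
    have "(\<Sum>i<n. real (Suc i) powr s) \<le> (\<Sum>i<n. real n powr s)"
      using False by (intro sum_mono powr_mono2) auto
    also have "\<dots> = real n powr (s + 1)"
      by (cases "n = 0") (auto simp: powr_add)
    finally show ?thesis by simp
  qed
  then show ?thesis by (intro exI[of _ 1]) auto
qed

lemma sum_powr_le_small:
  fixes s :: real
  assumes "s < -1"
  shows "(\<Sum>i=Suc n..<m. real (Suc i) powr s) \<le> 1 / (- s - 1) * real (Suc n) powr (s + 1)"
proof (cases "Suc n \<le> m")
  case True
  have "(- s - 1) * (\<Sum>i=Suc n..<m. real (Suc i) powr s)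
      \<le> (\<Sum>i=Suc n..<m. real i powr (s + 1) - real (Suc i) powr (s + 1))"
    unfolding sum_distrib_left using assms by (intro sum_mono powr_Suc_diff_le) auto
  also have "\<dots> = real (Suc n) powr (s + 1) - real m powr (s + 1)"
    using sum_Suc_diff'[OF True, of "\<lambda>i. - (real i powr (s + 1))"] by (simp add: algebra_simps)
  also have "\<dots> \<le> real (Suc n) powr (s + 1)" by simp
  finally show ?thesis using assms by (simp add: field_simps)
qed (use assms in \<open>auto simp: divide_nonneg_pos\<close>)

lemma summable_powr_Suc:
  assumes "s < -1"
  shows "summable (\<lambda>n. real (Suc n) powr s)"
proof -
  have "summable (\<lambda>n. real n powr s)"
    using assms by (simp add: summable_real_powr_iff)
  then show ?thesis by (simp add: summable_Suc_iff[of "\<lambda>n. real n powr s"] del: of_nat_Suc)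
qed

text \<open>One bound for two regimes: the sums converge for \<open>s < -1\<close> and grow like
  \<open>n powr (s + 1)\<close> for \<open>s > -1\<close>. At \<open>s = -1\<close> a logarithm
  appears; this is the origin of the conditions \<open>\<noteq> -1\<close> in the product rules
  below.\<close>

lemma sum_powr_le:
  fixes s t :: real
  assumes "s \<noteq> -1" "t \<ge> 0" "t \<ge> s + 1"
  shows "\<exists>K>0. \<forall>n. (\<Sum>i<n. real (Suc i) powr s) \<le> K * real (Suc n) powr t"
proof (cases "s < -1")
  case True
  note S = summable_powr_Suc[OF True]
  have "(\<Sum>i<n. real (Suc i) powr s) \<le> (1 + suminf (\<lambda>n. real (Suc n) powr s)) * real (Suc n) powr t" for n
  proof -
    have "(\<Sum>i<n. real (Suc i) powr s) \<le> suminf (\<lambda>n. real (Suc n) powr s)"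
      by (intro sum_le_suminf S) auto
    also have "\<dots> \<le> (1 + suminf (\<lambda>n. real (Suc n) powr s)) * 1" by simp
    also have "\<dots> \<le> (1 + suminf (\<lambda>n. real (Suc n) powr s)) * real (Suc n) powr t"
      using assms by (intro mult_left_mono ge_one_powr_ge_zero add_nonneg_nonneg suminf_nonneg S) auto
    finally show ?thesis .
  qed
  moreover have "suminf (\<lambda>n. real (Suc n) powr s) \<ge> 0" by (intro suminf_nonneg S) auto
  ultimately show ?thesis
    by (intro exI[of _ "1 + suminf (\<lambda>n. real (Suc n) powr s)"]) (auto simp del: of_nat_Suc)
next
  case False
  then obtain K where K: "K > 0" "\<And>n. (\<Sum>i<n. real (Suc i) powr s) \<le> K * real n powr (s + 1)"
    using sum_powr_le_large[of s] assms by auto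
  have "real n powr (s + 1) \<le> real (Suc n) powr t" for n
  proof -
    have "real n powr (s + 1) \<le> real (Suc n) powr (s + 1)"
      using False assms by (intro powr_mono2) auto
    also have "\<dots> \<le> real (Suc n) powr t" using assms by (intro powr_mono) auto
    finally show ?thesis .
  qed
  with K show ?thesis
    by (intro exI[of _ K] conjI allI)
      (auto intro!: order_trans[OF K(2)] mult_left_mono simp del: of_nat_Suc)
qed

text \<open>Indices within a factor of two have comparable powers whatever the sign of the exponent,
  which is what splitting a convolution at its middle index requires.\<close>

lemma powr_half_compare:
  fixes t :: real
  assumes "2 * m \<ge> n" "m \<le> n" "n > 0"
  shows "real m powr t \<le> 2 powr \<bar>t\<bar> * real n powr t"
proof (cases "t \<ge> 0")
  case True
  have "real m powr t \<le> real n powr t" using assms True by (intro powr_mono2) auto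
  also have "\<dots> \<le> 2 powr \<bar>t\<bar> * real n powr t"
    by (intro mult_le_cancel_right1[THEN iffD2]) (auto simp: ge_one_powr_ge_zero)
  finally show ?thesis .
next
  case False
  have "real m powr t \<le> (real n / 2) powr t" using assms False by (intro powr_mono2') auto
  also have "\<dots> = 2 powr \<bar>t\<bar> * real n powr t"
    using False by (simp add: powr_divide powr_minus field_simps)
  finally show ?thesis .
qed

lemma powr_Suc_le:
  assumes "n > 0"
  shows "real (Suc n) powr t \<le> 2 powr \<bar>t\<bar> * real n powr t"
proof (cases "t \<ge> 0")
  case True
  have "real (Suc n) powr t \<le> (2 * real n) powr t" using assms True by (intro powr_mono2) auto
  then show ?thesis using True by (simp add: powr_mult)
next
  case False
  have "real (Suc n) powr t \<le> real n powr t" using assms False by (intro powr_mono2') auto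
  also have "\<dots> \<le> 2 powr \<bar>t\<bar> * real n powr t"
    using ge_one_powr_ge_zero[of 2 "\<bar>t\<bar>"] by (intro mult_le_cancel_right1[THEN iffD2]) auto
  finally show ?thesis .
qed

lemma powr_le_Suc_powr:
  assumes "n > 0"
  shows "real n powr t \<le> 2 powr \<bar>t\<bar> * real (Suc n) powr t"
  using powr_half_compare[of "Suc n" n t] assms by simp

text \<open>The base is \<open>Suc n\<close> because \<open>0 powr \<theta>\<close> is 0: with base
  \<open>n\<close> the bound would force the constant coefficient to vanish.\<close>

definition decay :: "real \<Rightarrow> complex fps set" where
  "decay \<theta> = {a. \<exists>C. \<forall>n. cmod (a $ n) \<le> C * real (Suc n) powr \<theta>}"

lemma decayI:
  "(\<And>n. cmod (a $ n) \<le> C * real (Suc n) powr \<theta>) \<Longrightarrow> a \<in> decay \<theta>"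
  unfolding decay_def by blast

lemma decayE:
  assumes "a \<in> decay \<theta>"
  obtains C where "C > 0" "\<And>n. cmod (a $ n) \<le> C * real (Suc n) powr \<theta>"
proof -
  obtain C where C: "\<And>n. cmod (a $ n) \<le> C * real (Suc n) powr \<theta>"
    using assms unfolding decay_def by blast
  have "cmod (a $ n) \<le> (\<bar>C\<bar> + 1) * real (Suc n) powr \<theta>" for n
    by (rule order_trans[OF C]) (intro mult_right_mono, auto)
  then show ?thesis using that[of "\<bar>C\<bar> + 1"] by auto
qed

lemma decay_mono: "a \<in> decay \<theta> \<Longrightarrow> \<theta> \<le> \<theta>' \<Longrightarrow> a \<in> decay \<theta>'"
proof -
  assume a: "a \<in> decay \<theta>" and le: "\<theta> \<le> \<theta>'"
  obtain C where C: "C > 0" "\<And>n. cmod (a $ n) \<le> C * real (Suc n) powr \<theta>"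
    using a by (rule decayE) blast
  show ?thesis
    by (rule decayI[of _ C], rule order_trans[OF C(2)], intro mult_left_mono powr_mono) (use le C in auto)
qed

lemma decay_0 [simp]: "0 \<in> decay \<theta>"
  by (rule decayI[of _ 0]) simp

lemma decay_add: "a \<in> decay \<theta> \<Longrightarrow> b \<in> decay \<theta> \<Longrightarrow> a + b \<in> decay \<theta>"
proof (elim decayE)
  fix C D assume "\<And>n. cmod (a $ n) \<le> C * real (Suc n) powr \<theta>" "\<And>n. cmod (b $ n) \<le> D * real (Suc n) powr \<theta>"
  then show ?thesis
    by (intro decayI[of _ "C + D"])
      (auto simp del: of_nat_Suc simp: distrib_right intro!: order_trans[OF norm_triangle_ineq] add_mono)
qed

lemma decay_const_mult: "a \<in> decay \<theta> \<Longrightarrow> fps_const c * a \<in> decay \<theta>"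
  by (erule decayE, rule decayI[of _ "cmod c * _"])
    (auto simp: norm_mult mult.assoc intro!: mult_left_mono simp del: of_nat_Suc)

lemma decay_uminus: "a \<in> decay \<theta> \<Longrightarrow> - a \<in> decay \<theta>"
  using decay_const_mult[of a \<theta> "-1"] by (simp add: fps_const_neg[symmetric] del: fps_const_neg)

lemma decay_diff: "a \<in> decay \<theta> \<Longrightarrow> b \<in> decay \<theta> \<Longrightarrow> a - b \<in> decay \<theta>"
  using decay_add[of a \<theta> "- b"] decay_uminus by simp

lemma decay_sum: "(\<And>i. i \<in> I \<Longrightarrow> f i \<in> decay \<theta>) \<Longrightarrow> sum f I \<in> decay \<theta>"
  by (induction I rule: infinite_finite_induct) (auto intro: decay_add)

text \<open>Finitely many coefficients are absorbed into the constant, so estimates may start at any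
  convenient index.\<close>

lemma decay_finite:
  assumes "\<And>n. n \<ge> N \<Longrightarrow> cmod (a $ n) \<le> C * real (Suc n) powr \<theta>"
  shows "a \<in> decay \<theta>"
proof (rule decayI)
  fix n
  let ?D = "\<Sum>i<N. cmod (a $ i) / real (Suc i) powr \<theta>"
  have D: "?D \<ge> 0" by (intro sum_nonneg) auto
  show "cmod (a $ n) \<le> (\<bar>C\<bar> + ?D) * real (Suc n) powr \<theta>"
  proof (cases "n < N")
    case True
    then have "cmod (a $ n) / real (Suc n) powr \<theta> \<le> ?D"
      by (intro member_le_sum) auto
    then have "cmod (a $ n) \<le> ?D * real (Suc n) powr \<theta>"
      by (simp add: divide_le_eq)
    also have "\<dots> \<le> (\<bar>C\<bar> + ?D) * real (Suc n) powr \<theta>"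
      by (intro mult_right_mono) auto
    finally show ?thesis .
  next
    case False
    then have "cmod (a $ n) \<le> C * real (Suc n) powr \<theta>" using assms by auto
    also have "\<dots> \<le> (\<bar>C\<bar> + ?D) * real (Suc n) powr \<theta>"
      using D by (intro mult_right_mono) auto
    finally show ?thesis .
  qed
qed

lemma decay_const [simp]: "fps_const c \<in> decay \<theta>"
  by (rule decay_finite[of 1 _ 0]) auto

lemma decay_1 [simp]: "1 \<in> decay \<theta>"
  using decay_const[of 1 \<theta>] by simp

lemma decay_X_mult:
  assumes "a \<in> decay \<theta>"
  shows "fps_X * a \<in> decay \<theta>"
proof -
  obtain C where C: "C > 0" "\<And>n. cmod (a $ n) \<le> C * real (Suc n) powr \<theta>"
    using assms by (rule decayE) blast
  have "cmod ((fps_X * a) $ n) \<le> C * 2 powr \<bar>\<theta>\<bar> * real (Suc n) powr \<theta>" for n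
  proof (cases n)
    case 0 then show ?thesis using C by simp
  next
    case (Suc m)
    have "cmod ((fps_X * a) $ n) \<le> C * real (Suc m) powr \<theta>" using C Suc by simp
    also have "\<dots> \<le> C * (2 powr \<bar>\<theta>\<bar> * real (Suc (Suc m)) powr \<theta>)"
      using C by (intro mult_left_mono powr_half_compare) auto
    finally show ?thesis by (simp add: Suc mult.assoc)
  qed
  then show ?thesis by (rule decayI)
qed

lemma decay_hadamard:
  assumes "a \<in> decay \<theta>" "\<And>n. cmod (f n) \<le> C * real (Suc n) powr \<eta>"
  shows "Abs_fps (\<lambda>n. f n * a $ n) \<in> decay (\<theta> + \<eta>)"
proof -
  obtain D where D: "D > 0" "\<And>n. cmod (a $ n) \<le> D * real (Suc n) powr \<theta>"
    using assms by (auto elim: decayE)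
  have "C * real (Suc 0) powr \<eta> \<ge> 0" using assms(2)[of 0] norm_ge_zero order_trans by blast
  then have C: "C \<ge> 0" by simp
  show ?thesis
  proof (rule decayI)
    fix n
    have "cmod (Abs_fps (\<lambda>n. f n * a $ n) $ n) \<le> (C * real (Suc n) powr \<eta>) * (D * real (Suc n) powr \<theta>)"
      unfolding fps_nth_Abs_fps norm_mult using assms D C by (intro mult_mono) auto
    then show "cmod (Abs_fps (\<lambda>n. f n * a $ n) $ n) \<le> (C * D) * real (Suc n) powr (\<theta> + \<eta>)"
      by (simp add: powr_add mult_ac)
  qed
qed

text \<open>Of two indices adding up to \<open>n\<close> one is at least about \<open>n / 2\<close>,
  and its coefficient can be replaced by the bound at \<open>n\<close>; the other factor leaves a
  power sum. The conditions \<open>u \<ge> s\<close> and \<open>u \<ge> t\<close> serve when that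
  sum converges, \<open>u \<ge> s + t + 1\<close> when it grows.\<close>

lemma decay_mult:
  assumes a: "a \<in> decay s" and b: "b \<in> decay t" and "s \<noteq> -1" "t \<noteq> -1"
    and u: "u \<ge> s" "u \<ge> t" "u \<ge> s + t + 1"
  shows "a * b \<in> decay u"
proof -
  obtain C where C: "C > 0" "\<And>n. cmod (a $ n) \<le> C * real (Suc n) powr s"
    using a by (rule decayE) blast
  obtain D where D: "D > 0" "\<And>n. cmod (b $ n) \<le> D * real (Suc n) powr t"
    using b by (rule decayE) blast
  obtain K where K: "K > 0" "\<And>n. (\<Sum>i<n. real (Suc i) powr s) \<le> K * real (Suc n) powr (u - t)"
    using sum_powr_le[of s "u - t"] assms by auto
  obtain L where L: "L > 0" "\<And>n. (\<Sum>i<n. real (Suc i) powr t) \<le> L * real (Suc n) powr (u - s)"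
    using sum_powr_le[of t "u - s"] assms by auto
  define M where "M = 2 powr \<bar>s\<bar> + 2 powr \<bar>t\<bar>"
  have M: "M > 0" by (simp add: M_def add_pos_pos)
  show ?thesis
  proof (rule decay_finite[of 1])
    fix n :: nat assume "n \<ge> 1"
    let ?N = "real (Suc n)"
    have bd: "cmod (a $ i * b $ (n - i)) \<le> C * D * M * (?N powr t * real (Suc i) powr s + ?N powr s * real (Suc (n - i)) powr t)"
      if "i \<le> n" for i
    proof -
      have "real (Suc i) powr s * real (Suc (n - i)) powr t
         \<le> M * (?N powr t * real (Suc i) powr s + ?N powr s * real (Suc (n - i)) powr t)"
      proof (cases "2 * Suc i \<ge> Suc n")
        case True
        then have "real (Suc i) powr s \<le> 2 powr \<bar>s\<bar> * ?N powr s"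
          using that by (intro powr_half_compare) auto
        also have "\<dots> \<le> M * ?N powr s" by (intro mult_right_mono) (auto simp: M_def)
        finally have "real (Suc i) powr s * real (Suc (n - i)) powr t \<le> M * ?N powr s * real (Suc (n - i)) powr t"
          by (intro mult_right_mono) auto
        then show ?thesis using M by (simp add: distrib_left mult.assoc add_increasing del: of_nat_Suc)
      next
        case False
        then have "real (Suc (n - i)) powr t \<le> 2 powr \<bar>t\<bar> * ?N powr t"
          using that by (intro powr_half_compare) auto
        also have "\<dots> \<le> M * ?N powr t" by (intro mult_right_mono) (auto simp: M_def)
        finally have "real (Suc i) powr s * real (Suc (n - i)) powr t \<le> real (Suc i) powr s * (M * ?N powr t)"
          by (intro mult_left_mono) auto
        also have "\<dots> = M * (?N powr t * real (Suc i) powr s)" by (simp add: mult_ac)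
        finally show ?thesis using M by (simp add: distrib_left mult.assoc add_increasing2 del: of_nat_Suc)
      qed
      moreover have "cmod (a $ i * b $ (n - i)) \<le> C * real (Suc i) powr s * (D * real (Suc (n - i)) powr t)"
        unfolding norm_mult using C D by (intro mult_mono) auto
      moreover have "C * real (Suc i) powr s * (D * real (Suc (n - i)) powr t) = C * D * (real (Suc i) powr s * real (Suc (n - i)) powr t)"
        by (simp only: mult_ac)
      ultimately show ?thesis using C D
        by (smt (verit) mult.assoc mult_left_mono mult_pos_pos)
    qed
    have "cmod ((a * b) $ n) \<le> (\<Sum>i\<le>n. C * D * M * (?N powr t * real (Suc i) powr s + ?N powr s * real (Suc (n - i)) powr t))"
      unfolding fps_mult_nth atMost_atLeast0[symmetric] by (intro sum_norm_le bd) auto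
    also have "\<dots> = C * D * M * (?N powr t * (\<Sum>i\<le>n. real (Suc i) powr s) + ?N powr s * (\<Sum>i\<le>n. real (Suc (n - i)) powr t))"
      by (simp add: sum_distrib_left sum.distrib distrib_left del: of_nat_Suc)
    also have "(\<Sum>i\<le>n. real (Suc (n - i)) powr t) = (\<Sum>i\<le>n. real (Suc i) powr t)"
      by (rule sum.reindex_bij_witness[of _ "\<lambda>i. n - i" "\<lambda>i. n - i"]) auto
    also have "C * D * M * (?N powr t * (\<Sum>i\<le>n. real (Suc i) powr s) + ?N powr s * (\<Sum>i\<le>n. real (Suc i) powr t))
       \<le> C * D * M * (?N powr t * (K * real (Suc (Suc n)) powr (u - t)) + ?N powr s * (L * real (Suc (Suc n)) powr (u - s)))"
      using K(2)[of "Suc n"] L(2)[of "Suc n"] C D M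
      by (intro mult_left_mono add_mono) (auto simp: lessThan_Suc_atMost)
    also have "\<dots> \<le> C * D * M * (?N powr t * (K * (2 powr (u - t) * ?N powr (u - t))) + ?N powr s * (L * (2 powr (u - s) * ?N powr (u - s))))"
    proof -
      have *: "real (Suc (Suc n)) powr w \<le> 2 powr w * ?N powr w" if "w \<ge> 0" for w
        unfolding powr_mult[symmetric] using that by (intro powr_mono2) auto
      show ?thesis using C D M K L u
        by (intro mult_left_mono add_mono * ) auto
    qed
    also have "\<dots> = C * D * M * (K * 2 powr (u - t) + L * 2 powr (u - s)) * ?N powr u"
    proof -
      have "?N powr t * ?N powr (u - t) = ?N powr u" "?N powr s * ?N powr (u - s) = ?N powr u"
        by (simp_all flip: powr_add)
      then have "C * D * M * (K * 2 powr (u - t) + L * 2 powr (u - s)) * ?N powr u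
        = C * D * M * (K * 2 powr (u - t) * (?N powr t * ?N powr (u - t)) + L * 2 powr (u - s) * (?N powr s * ?N powr (u - s)))"
        by (simp only: distrib_left distrib_right mult.assoc)
      then show ?thesis by (simp only: mult_ac)
    qed
    finally show "cmod ((a * b) $ n) \<le> C * D * M * (K * 2 powr (u - t) + L * 2 powr (u - s)) * ?N powr u" .
  qed
qed

text \<open>The value of the series at 1, taken below for series in some
  \<open>decay \<theta>\<close> with \<open>\<theta> < -1\<close>, where it converges
  absolutely.\<close>

definition mass :: "complex fps \<Rightarrow> complex" where
  "mass a = (\<Sum>n. a $ n)"

lemma decay_summable_norm:
  assumes "a \<in> decay \<theta>" "\<theta> < -1"
  shows "summable (\<lambda>n. cmod (a $ n))"
proof -
  obtain C where C: "C > 0" "\<And>n. cmod (a $ n) \<le> C * real (Suc n) powr \<theta>"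
    using assms by (auto elim: decayE)
  show ?thesis
    by (rule summable_comparison_test'[OF summable_mult[OF summable_powr_Suc[OF assms(2)], of C]])
      (use C in auto)
qed

lemma decay_summable:
  assumes "a \<in> decay \<theta>" "\<theta> < -1"
  shows "summable (\<lambda>n. a $ n)"
  using decay_summable_norm[OF assms] by (rule summable_norm_cancel)

lemma mass_mult:
  assumes "a \<in> decay s" "b \<in> decay t" "s < -1" "t < -1"
  shows "mass (a * b) = mass a * mass b"
  using Cauchy_product[OF decay_summable_norm[OF assms(1,3)] decay_summable_norm[OF assms(2,4)]]
  by (simp add: mass_def fps_mult_nth atMost_atLeast0)

lemma mass_add:
  assumes "a \<in> decay s" "b \<in> decay s" "s < -1"
  shows "mass (a + b) = mass a + mass b"
  using suminf_add[OF decay_summable[OF assms(1,3)] decay_summable[OF assms(2,3)]]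
  by (simp add: mass_def)

lemma mass_const_mult:
  assumes "a \<in> decay s" "s < -1"
  shows "mass (fps_const c * a) = c * mass a"
  using suminf_mult[OF decay_summable[OF assms], of c] by (simp add: mass_def)

lemma decay_tail:
  assumes a: "a \<in> decay (-1 - \<eta>)" and \<eta>: "\<eta> > 0"
  shows "\<exists>K>0. \<forall>n. cmod (mass a - (\<Sum>i\<le>n. a $ i)) \<le> K * real (Suc n) powr (- \<eta>)"
proof -
  obtain C where C: "C > 0" "\<And>n. cmod (a $ n) \<le> C * real (Suc n) powr (-1 - \<eta>)"
    using a by (auto elim: decayE)
  have S: "summable (\<lambda>n. a $ n)" using a \<eta> by (intro decay_summable) auto
  have "cmod (mass a - (\<Sum>i\<le>n. a $ i)) \<le> C / \<eta> * real (Suc n) powr (- \<eta>)" for n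
  proof -
    have "(\<lambda>m. cmod ((\<Sum>i<m. a $ i) - (\<Sum>i\<le>n. a $ i))) \<longlonglongrightarrow> cmod (mass a - (\<Sum>i\<le>n. a $ i))"
      unfolding mass_def by (intro tendsto_intros summable_LIMSEQ S)
    moreover have "\<forall>\<^sub>F m in sequentially. cmod ((\<Sum>i<m. a $ i) - (\<Sum>i\<le>n. a $ i)) \<le> C / \<eta> * real (Suc n) powr (- \<eta>)"
      using eventually_ge_at_top[of "Suc n"]
    proof eventually_elim
      case (elim m)
      have "(\<Sum>i<m. a $ i) - (\<Sum>i\<le>n. a $ i) = (\<Sum>i=Suc n..<m. a $ i)"
        using sum.atLeastLessThan_concat[of 0 "Suc n" m "\<lambda>i. a $ i"] elim
        by (simp add: atLeast0LessThan lessThan_Suc_atMost algebra_simps)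
      also have "cmod \<dots> \<le> (\<Sum>i=Suc n..<m. C * real (Suc i) powr (-1 - \<eta>))"
        by (intro sum_norm_le C)
      also have "\<dots> \<le> C * (1 / \<eta> * real (Suc n) powr (- \<eta>))"
        unfolding sum_distrib_left[symmetric] using sum_powr_le_small[of "-1 - \<eta>" n m] C \<eta>
        by (intro mult_left_mono) auto
      finally show ?case by simp
    qed
    ultimately show ?thesis using tendsto_upperbound by fastforce
  qed
  with C \<eta> show ?thesis by (intro exI[of _ "C / \<eta>"]) auto
qed

lemma factor_three:
  fixes A :: real
  assumes "p * p' = r" "q * q' = r" "s * s' = r"
  shows "A * p * (A' * p') + B * q * (B' * q') + T * s * (D * s') = (A * A' + B * B' + T * D) * r"
proof -
  have "A * p * (A' * p') = A * A' * r" "B * q * (B' * q') = B * B' * r" "T * s * (D * s') = T * D * r"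
    using assms by simp_all
  then show ?thesis by (simp only: distrib_right)
qed

text \<open>A slowly varying \<open>b\<close> sees a summable \<open>a\<close> only through its
  value at 1. The condition on \<open>(1 - fps_X) * b\<close> says that consecutive coefficients of
  \<open>b\<close> differ by one order less than their size, so \<open>b $ (n - i)\<close> may be
  replaced by \<open>b $ n\<close> for small \<open>i\<close>; for large \<open>i\<close> the
  smallness of \<open>a $ i\<close> is used instead. With \<open>\<eta> < 1\<close> the accumulated
  error \<open>i powr (- \<eta>)\<close> sums to order \<open>n powr (1 - \<eta>)\<close>.\<close>

lemma decay_mult_mass:
  assumes a: "a \<in> decay (-1 - \<eta>)" and \<eta>: "0 < \<eta>" "\<eta> < 1"
    and b: "b \<in> decay \<theta>" and db: "(1 - fps_X) * b \<in> decay (\<theta> - 1)" and \<theta>: "\<theta> > -1"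
  shows "a * b - fps_const (mass a) * b \<in> decay (\<theta> - \<eta>)"
proof -
  obtain C where C: "C > 0" "\<And>n. cmod (a $ n) \<le> C * real (Suc n) powr (-1 - \<eta>)"
    using a by (auto elim: decayE)
  obtain D where D: "D > 0" "\<And>n. cmod (b $ n) \<le> D * real (Suc n) powr \<theta>"
    using b by (auto elim: decayE)
  obtain E where E: "E > 0" "\<And>n. cmod (((1 - fps_X) * b) $ n) \<le> E * real (Suc n) powr (\<theta> - 1)"
    using db by (auto elim: decayE)
  obtain T where T: "T > 0" "\<And>n. cmod (mass a - (\<Sum>i\<le>n. a $ i)) \<le> T * real (Suc n) powr (- \<eta>)"
    using decay_tail[OF a \<eta>(1)] by auto
  obtain K where K: "K > 0" "\<And>n. (\<Sum>i<n. real (Suc i) powr (-\<eta>)) \<le> K * real (Suc n) powr (1 - \<eta>)"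
    using sum_powr_le[of "-\<eta>" "1 - \<eta>"] \<eta> by auto
  obtain L where L: "L > 0" "\<And>n. (\<Sum>i<n. real (Suc i) powr \<theta>) \<le> L * real (Suc n) powr (\<theta> + 1)"
    using sum_powr_le[of \<theta> "\<theta> + 1"] \<theta> by auto
  define M where "M = 2 powr \<bar>\<theta> - 1\<bar>"
  define M' where "M' = 2 powr \<bar>-1-\<eta>\<bar>"
  have M: "M > 0" "M' > 0" by (auto simp: M_def M'_def)
  have diff: "b $ n - b $ m = (\<Sum>j=Suc m..n. ((1 - fps_X) * b) $ j)" if "m \<le> n" for m n
  proof -
    have "(\<Sum>j=Suc m..n. ((1 - fps_X) * b) $ j) = (\<Sum>j\<in>{m..<n}. b $ Suc j - b $ j)"
      by (rule sum.reindex_bij_witness[of _ Suc "\<lambda>j. j - 1"]) (auto simp: algebra_simps)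
    also have "\<dots> = b $ n - b $ m" using that by (rule sum_Suc_diff')
    finally show ?thesis by simp
  qed
  show ?thesis
  proof (rule decay_finite[of 1])
    fix n :: nat assume n: "n \<ge> 1"
    let ?N = "real (Suc n)"
    have N2: "real (Suc (Suc n)) powr w \<le> 2 powr w * ?N powr w" if "w \<ge> 0" for w
      unfolding powr_mult[symmetric] using that by (intro powr_mono2) auto
    have bd: "cmod (a $ i * (b $ (n - i) - b $ n))
        \<le> C * E * M * ?N powr (\<theta> - 1) * real (Suc i) powr (- \<eta>)
          + C * D * M' * ?N powr (-1-\<eta>) * (real (Suc (n - i)) powr \<theta> + ?N powr \<theta>)" (is "_ \<le> ?A + ?B")
      if "i \<le> n" for i
    proof (cases "2 * Suc i \<ge> Suc n")
      case True
      have "cmod (a $ i) \<le> C * (M' * ?N powr (-1-\<eta>))"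
        unfolding M'_def using True that C
        by (intro order_trans[OF C(2)] mult_left_mono powr_half_compare) auto
      moreover have "cmod (b $ (n - i) - b $ n) \<le> D * (real (Suc (n - i)) powr \<theta> + ?N powr \<theta>)"
        unfolding distrib_left by (intro order_trans[OF norm_triangle_ineq4] add_mono D)
      ultimately have "cmod (a $ i * (b $ (n - i) - b $ n)) \<le> C * (M' * ?N powr (-1-\<eta>)) * (D * (real (Suc (n - i)) powr \<theta> + ?N powr \<theta>))"
        unfolding norm_mult using C M by (intro mult_mono) auto
      also have "\<dots> = ?B" by (simp only: mult_ac)
      finally show ?thesis using C E M by (simp add: add_increasing)
    next
      case False
      \<comment> \<open>The difference telescopes into \<open>i\<close> increments, all at indices
        comparable with \<open>n\<close>.\<close>
      have "cmod (b $ (n - i) - b $ n) = cmod (\<Sum>j=Suc (n - i)..n. ((1 - fps_X) * b) $ j)"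
        by (subst diff[symmetric]) (auto simp: norm_minus_commute)
      also have "\<dots> \<le> (\<Sum>j=Suc (n - i)..n. E * (M * ?N powr (\<theta> - 1)))"
        unfolding M_def using False E
        by (intro sum_norm_le order_trans[OF E(2)] mult_left_mono powr_half_compare) auto
      also have "\<dots> = real i * (E * (M * ?N powr (\<theta> - 1)))" using that by simp
      also have "\<dots> \<le> real (Suc i) * (E * (M * ?N powr (\<theta> - 1)))"
        using E M by (intro mult_right_mono) auto
      finally have "cmod (b $ (n - i) - b $ n) \<le> real (Suc i) * (E * (M * ?N powr (\<theta> - 1)))" .
      then have "cmod (a $ i * (b $ (n - i) - b $ n)) \<le> C * real (Suc i) powr (-1 - \<eta>) * (real (Suc i) * (E * (M * ?N powr (\<theta> - 1))))"
        unfolding norm_mult using C by (intro mult_mono) auto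
      also have "\<dots> = C * E * M * ?N powr (\<theta> - 1) * (real (Suc i) powr (-1 - \<eta>) * real (Suc i) powr 1)"
        by (simp only: powr_one of_nat_0_le_iff mult_ac)
      also have "real (Suc i) powr (-1 - \<eta>) * real (Suc i) powr 1 = real (Suc i) powr (- \<eta>)"
        by (subst powr_add[symmetric]) simp
      finally show ?thesis using C D M by (simp add: add_increasing2)
    qed
    have s1: "(\<Sum>i\<le>n. real (Suc i) powr (-\<eta>)) \<le> K * 2 powr (1 - \<eta>) * ?N powr (1 - \<eta>)"
    proof -
      have "(\<Sum>i\<le>n. real (Suc i) powr (-\<eta>)) \<le> K * real (Suc (Suc n)) powr (1 - \<eta>)"
        using K(2)[of "Suc n"] by (simp add: lessThan_Suc_atMost)
      also have "\<dots> \<le> K * (2 powr (1 - \<eta>) * ?N powr (1 - \<eta>))" using \<eta> K by (intro mult_left_mono N2) auto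
      finally show ?thesis by (simp add: mult_ac)
    qed
    have s2: "(\<Sum>i\<le>n. real (Suc (n - i)) powr \<theta> + ?N powr \<theta>) \<le> (L * 2 powr (\<theta> + 1) + 1) * ?N powr (\<theta> + 1)"
    proof -
      have "(\<Sum>i\<le>n. real (Suc (n - i)) powr \<theta>) = (\<Sum>i\<le>n. real (Suc i) powr \<theta>)"
        by (rule sum.reindex_bij_witness[of _ "\<lambda>i. n - i" "\<lambda>i. n - i"]) auto
      also have "\<dots> \<le> L * real (Suc (Suc n)) powr (\<theta> + 1)"
        using L(2)[of "Suc n"] by (simp add: lessThan_Suc_atMost)
      also have "\<dots> \<le> L * (2 powr (\<theta> + 1) * ?N powr (\<theta> + 1))" using \<theta> L by (intro mult_left_mono N2) auto
      finally have "(\<Sum>i\<le>n. real (Suc (n - i)) powr \<theta>) \<le> L * 2 powr (\<theta> + 1) * ?N powr (\<theta> + 1)" by (simp add: mult_ac)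
      moreover have "(\<Sum>i\<le>n. ?N powr \<theta>) = ?N powr (\<theta> + 1)" by (simp add: powr_add)
      ultimately show ?thesis by (simp add: sum.distrib distrib_right del: of_nat_Suc sum_constant)
    qed
    \<comment> \<open>Replacing \<open>b $ (n - i)\<close> by \<open>b $ n\<close> in the
      convolution leaves a partial sum of \<open>a\<close>, whose distance from
      \<open>mass a\<close> is a tail.\<close>
    have eq: "(a * b - fps_const (mass a) * b) $ n
        = (\<Sum>i\<le>n. a $ i * (b $ (n - i) - b $ n)) - (mass a - (\<Sum>i\<le>n. a $ i)) * b $ n"
      unfolding right_diff_distrib left_diff_distrib sum_subtractf sum_distrib_right[symmetric]
      by (simp add: fps_mult_nth[of a b] atMost_atLeast0)
    have "cmod ((a * b - fps_const (mass a) * b) $ n) \<le> (\<Sum>i\<le>n. C * E * M * ?N powr (\<theta> - 1) * real (Suc i) powr (- \<eta>)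
          + C * D * M' * ?N powr (-1-\<eta>) * (real (Suc (n - i)) powr \<theta> + ?N powr \<theta>))
          + (T * ?N powr (-\<eta>)) * (D * ?N powr \<theta>)"
      unfolding eq
    proof (intro order_trans[OF norm_triangle_ineq4] add_mono sum_norm_le)
      show "cmod ((mass a - (\<Sum>i\<le>n. a $ i)) * b $ n) \<le> (T * ?N powr (-\<eta>)) * (D * ?N powr \<theta>)"
        unfolding norm_mult using T(1) by (intro mult_mono T(2) D(2)) auto
    qed (rule bd, simp)
    also have "\<dots> \<le> C * E * M * ?N powr (\<theta> - 1) * (K * 2 powr (1 - \<eta>) * ?N powr (1 - \<eta>))
        + C * D * M' * ?N powr (-1-\<eta>) * ((L * 2 powr (\<theta> + 1) + 1) * ?N powr (\<theta> + 1))
        + (T * ?N powr (-\<eta>)) * (D * ?N powr \<theta>)"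
    proof (rule add_right_mono)
      define P where "P = C * E * M * ?N powr (\<theta> - 1)"
      define Q where "Q = C * D * M' * ?N powr (-1-\<eta>)"
      have PQ: "P \<ge> 0" "Q \<ge> 0" unfolding P_def Q_def
        by (intro mult_nonneg_nonneg less_imp_le[OF C(1)] less_imp_le[OF D(1)] less_imp_le[OF E(1)]
            less_imp_le[OF M(1)] less_imp_le[OF M(2)] powr_ge_zero)+
      have "(\<Sum>i\<le>n. P * real (Suc i) powr (- \<eta>) + Q * (real (Suc (n - i)) powr \<theta> + ?N powr \<theta>))
         = P * (\<Sum>i\<le>n. real (Suc i) powr (- \<eta>)) + Q * (\<Sum>i\<le>n. real (Suc (n - i)) powr \<theta> + ?N powr \<theta>)"
        by (subst sum.distrib) (simp only: sum_distrib_left)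
      also have "\<dots> \<le> P * (K * 2 powr (1 - \<eta>) * ?N powr (1 - \<eta>)) + Q * ((L * 2 powr (\<theta> + 1) + 1) * ?N powr (\<theta> + 1))"
        by (rule add_mono[OF mult_left_mono[OF s1 PQ(1)] mult_left_mono[OF s2 PQ(2)]])
      finally show "(\<Sum>i\<le>n. C * E * M * ?N powr (\<theta> - 1) * real (Suc i) powr (- \<eta>)
          + C * D * M' * ?N powr (-1-\<eta>) * (real (Suc (n - i)) powr \<theta> + ?N powr \<theta>))
        \<le> C * E * M * ?N powr (\<theta> - 1) * (K * 2 powr (1 - \<eta>) * ?N powr (1 - \<eta>))
          + C * D * M' * ?N powr (-1-\<eta>) * ((L * 2 powr (\<theta> + 1) + 1) * ?N powr (\<theta> + 1))"
        unfolding P_def Q_def .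
    qed
    also have "\<dots> = (C * E * M * (K * 2 powr (1 - \<eta>)) + C * D * M' * (L * 2 powr (\<theta> + 1) + 1) + T * D) * ?N powr (\<theta> - \<eta>)"
    proof -
      have "?N powr (\<theta> - 1) * ?N powr (1 - \<eta>) = ?N powr (\<theta> - \<eta>)"
        "?N powr (-1-\<eta>) * ?N powr (\<theta> + 1) = ?N powr (\<theta> - \<eta>)"
        "?N powr (-\<eta>) * ?N powr \<theta> = ?N powr (\<theta> - \<eta>)"
        by (simp_all flip: powr_add)
      then show ?thesis
        by (intro factor_three)
    qed
    finally show "cmod ((a * b - fps_const (mass a) * b) $ n)
      \<le> (C * E * M * (K * 2 powr (1 - \<eta>)) + C * D * M' * (L * 2 powr (\<theta> + 1) + 1) + T * D) * ?N powr (\<theta> - \<eta>)" .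
  qed
qed

section \<open>Powers of \<open>1 / (1 - X)\<close>\<close>

text \<open>By the binomial series this is \<open>(1 - X) powr (- \<beta>)\<close>.\<close>

definition inv_pow :: "real \<Rightarrow> complex fps" where
  "inv_pow \<beta> = Abs_fps (\<lambda>n. of_real (pochhammer \<beta> n / fact n))"

lemma inv_pow_nth: "inv_pow \<beta> $ n = of_real (pochhammer \<beta> n / fact n)"
  by (simp add: inv_pow_def)

text \<open>Exponents add because of the Vandermonde identity for rising factorials.\<close>

lemma inv_pow_add: "inv_pow (a + b) = inv_pow a * inv_pow b"
proof (rule fps_ext)
  fix n
  have "pochhammer (a + b) n / fact n = (\<Sum>i\<le>n. (pochhammer a i / fact i) * (pochhammer b (n - i) / fact (n - i)))"
    by (simp add: pochhammer_binomial_sum sum_divide_distrib binomial_fact field_simps)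
  then show "inv_pow (a + b) $ n = (inv_pow a * inv_pow b) $ n"
    by (simp add: inv_pow_nth fps_mult_nth atMost_atLeast0 flip: of_real_mult of_real_sum of_real_divide)
qed

lemma inv_pow_0: "inv_pow 0 = 1"
  by (rule fps_ext) (simp add: inv_pow_nth pochhammer_0_left)

lemma inv_pow_1_nth: "inv_pow 1 $ n = 1"
  by (simp add: inv_pow_nth flip: pochhammer_fact)

lemma inv_pow_neg1: "inv_pow (-1) = 1 - fps_X"
proof (rule fps_ext)
  fix n show "inv_pow (-1) $ n = (1 - fps_X) $ n"
  proof (cases "n < 2")
    case True
    then have "n = 0 \<or> n = 1" by auto
    then show ?thesis by (auto simp: inv_pow_nth pochhammer_Suc)
  next
    case False
    then have "pochhammer (-1 :: real) n = 0" using pochhammer_of_nat_eq_0_lemma[of 1 n] by simp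
    then show ?thesis using False by (simp add: inv_pow_nth)
  qed
qed

lemma one_minus_X_inv_pow: "(1 - fps_X) * inv_pow \<beta> = inv_pow (\<beta> - 1)"
  using inv_pow_add[of "-1" \<beta>] by (simp add: inv_pow_neg1)

lemma pochhammer_shift:
  fixes \<beta> :: real
  assumes "\<beta> \<noteq> 0"
  shows "pochhammer (\<beta> + 1) n = pochhammer \<beta> n * (\<beta> + real n) / \<beta>"
  using assms pochhammer_rec[of \<beta> n] pochhammer_Suc[of \<beta> n] by (simp add: field_simps)

lemma inv_pow_deriv: "fps_X * fps_deriv (inv_pow \<beta>) = fps_const (of_real \<beta>) * (fps_X * inv_pow (\<beta> + 1))"
proof (rule fps_ext)
  fix n show "(fps_X * fps_deriv (inv_pow \<beta>)) $ n = (fps_const (of_real \<beta>) * (fps_X * inv_pow (\<beta> + 1))) $ n"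
  proof (cases n)
    case (Suc m)
    have "real (Suc m) * (pochhammer \<beta> (Suc m) / fact (Suc m)) = \<beta> * (pochhammer (\<beta> + 1) m / fact m)"
      by (simp add: pochhammer_rec del: of_nat_Suc)
    then have "of_real (real (Suc m)) * complex_of_real (pochhammer \<beta> (Suc m) / fact (Suc m))
        = of_real \<beta> * of_real (pochhammer (\<beta> + 1) m / fact m)"
      by (simp only: flip: of_real_mult)
    then show ?thesis using Suc
      by (simp only: fps_X_mult_nth fps_mult_left_const_nth inv_pow_nth fps_deriv_nth nat.simps if_False
          diff_Suc_1 Suc_eq_plus1[symmetric] of_real_of_nat_eq)
  qed simp
qed

section \<open>Coefficients of half-integer powers\<close>

abbreviation "half_binom n \<equiv> pochhammer (1/2::real) n / fact n"

lemma half_binom_Suc: "half_binom (Suc n) = half_binom n * ((2 * real n + 1) / (2 * real n + 2))"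
  by (simp add: pochhammer_Suc field_simps)

lemma half_binom_pos: "half_binom n > 0"
  by (simp add: pochhammer_pos)

lemma powr_minus_half_diff:
  assumes "n > 0"
  shows "real n powr (-1/2) - (real n + 1/2) powr (-1/2) \<le> real n powr (-3/2)"
proof -
  have "\<exists>z>real n. z < real n + 1/2 \<and>
      (real n + 1/2) powr (-1/2) - real n powr (-1/2) = (real n + 1/2 - real n) * ((-1/2) * z powr (-3/2))"
    using assms by (intro MVT2) (auto intro!: derivative_eq_intros)
  then obtain z where z: "z > real n"
    "(real n + 1/2) powr (-1/2) - real n powr (-1/2) = (real n + 1/2 - real n) * ((-1/2) * z powr (-3/2))"
    by blast
  have "z powr (-3/2) \<le> real n powr (-3/2)" using z assms by (intro powr_mono2') auto
  then have "1/4 * z powr (-3/2) \<le> real n powr (-3/2)"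
    using powr_ge_zero[of "real n" "-3/2"] by linarith
  with z(2) show ?thesis by simp
qed

text \<open>With \<open>b\<close> the coefficients of \<open>(1 - X) powr (-1/2)\<close>, the sequence \<open>n * b\<^sup>2\<close> increases and
  \<open>(n + 1/2) * b\<^sup>2\<close> decreases, to a common limit.\<close>
lemma half_binom_asymp:
  "\<exists>L>0. \<forall>n>0. \<bar>half_binom n - L * real n powr (-1/2)\<bar> \<le> L * real n powr (-3/2)"
proof -
  define u where "u n = real n * (half_binom n)\<^sup>2" for n
  define w where "w n = (real n + 1/2) * (half_binom n)\<^sup>2" for n
  have "u n \<le> u (Suc n)" for n
  proof -
    have "real n \<le> (2 * real n + 1)\<^sup>2 / (4 * (real n + 1))"
      by (simp add: field_simps power2_eq_square)
    then have "u n \<le> (2 * real n + 1)\<^sup>2 / (4 * (real n + 1)) * (half_binom n)\<^sup>2"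
      unfolding u_def by (intro mult_right_mono) auto
    also have "\<dots> = u (Suc n)"
    proof -
      have "x * (a / (2 * x))\<^sup>2 = a\<^sup>2 / (4 * x)" if "x > 0" for x a :: real
        using that by (simp add: power2_eq_square field_simps)
      from this[of "real n + 1" "2 * real n + 1"]
      have e: "real (Suc n) * ((2 * real n + 1) / (2 * real n + 2))\<^sup>2 = (2 * real n + 1)\<^sup>2 / (4 * (real n + 1))"
        by (simp add: add.commute)
      show ?thesis
        unfolding u_def half_binom_Suc power_mult_distrib e[symmetric] by (simp only: mult_ac)
    qed
    finally show ?thesis .
  qed
  then have inc: "incseq u" by (rule incseq_SucI)
  have "w (Suc n) \<le> w n" for n
  proof -
    have "(real n + 3/2) * ((2 * real n + 1) / (2 * real n + 2))\<^sup>2 \<le> real n + 1/2"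
    proof -
      have "(real n + 1/2) * (2 * real n + 2)\<^sup>2 - (real n + 3/2) * (2 * real n + 1)\<^sup>2 = (2 * real n + 1) / 2"
        by (simp add: power2_eq_square algebra_simps add_divide_distrib)
      moreover have "(2 * real n + 1) / 2 \<ge> 0" by simp
      ultimately have "(real n + 3/2) * (2 * real n + 1)\<^sup>2 \<le> (real n + 1/2) * (2 * real n + 2)\<^sup>2"
        by (metis diff_ge_0_iff_ge)
      then show ?thesis by (simp only: power_divide times_divide_eq_right) (rule pos_divide_le_eq[THEN iffD2], auto)
    qed
    then have "(real n + 3/2) * ((2 * real n + 1) / (2 * real n + 2))\<^sup>2 * (half_binom n)\<^sup>2 \<le> w n"
      unfolding w_def by (intro mult_right_mono) auto
    moreover have "w (Suc n) = (real n + 3/2) * ((2 * real n + 1) / (2 * real n + 2))\<^sup>2 * (half_binom n)\<^sup>2"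
      unfolding w_def half_binom_Suc power_mult_distrib by simp
    ultimately show ?thesis by simp
  qed
  then have dec: "decseq w" by (rule decseq_SucI)
  have uw: "u n \<le> w n" for n unfolding u_def w_def by (intro mult_right_mono) auto
  have ub: "u n \<le> w 0" for n using uw[of n] decseqD[OF dec, of 0 n] by simp
  obtain l where l: "u \<longlonglongrightarrow> l" "\<And>n. u n \<le> l"
    using incseq_convergent[OF inc] ub by blast
  have lw: "l \<le> w n" for n
  proof (rule LIMSEQ_le_const2[OF l(1)], intro exI allI impI)
    fix m assume "n \<le> m"
    then show "u m \<le> w n" using uw[of m] decseqD[OF dec, of n m] by simp
  qed
  \<comment> \<open>The limit of the increasing sequence is at least \<open>u 1\<close>, which is
    \<open>1/4\<close>.\<close>
  have l0: "l > 0" using l(2)[of 1] by (simp add: u_def power2_eq_square)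
  define L where "L = sqrt l"
  have L: "L > 0" "l = L\<^sup>2" using l0 by (auto simp: L_def)
  have "\<bar>half_binom n - L * real n powr (-1/2)\<bar> \<le> L * real n powr (-3/2)" if n: "n > 0" for n
  proof -
    have s: "(L * x powr (-1/2))\<^sup>2 = l / x" if "x > 0" for x :: real
    proof -
      have "(x powr (-1/2))\<^sup>2 = x powr (-1)"
        unfolding power2_eq_square by (subst powr_add[symmetric]) simp
      moreover have "x powr (-1) = 1 / x" using that by (simp add: powr_minus_divide)
      ultimately show ?thesis unfolding power_mult_distrib L(2) by simp
    qed
    have "(half_binom n)\<^sup>2 \<le> l / real n"
      using l(2)[of n] n unfolding u_def by (subst pos_le_divide_eq) (auto simp: mult.commute)
    then have "(half_binom n)\<^sup>2 \<le> (L * real n powr (-1/2))\<^sup>2"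
      using s[of "real n"] n by (simp only: of_nat_0_less_iff)
    then have 1: "half_binom n \<le> L * real n powr (-1/2)"
      by (rule power2_le_imp_le) (use L(1) in simp)
    have "l / (real n + 1/2) \<le> (half_binom n)\<^sup>2"
      using lw[of n] n unfolding w_def by (subst pos_divide_le_eq) (auto simp: mult.commute)
    moreover have "(L * (real n + 1/2) powr (-1/2))\<^sup>2 = l / (real n + 1/2)" by (rule s) simp
    ultimately have "(L * (real n + 1/2) powr (-1/2))\<^sup>2 \<le> (half_binom n)\<^sup>2" by (simp only:)
    then have 2: "L * (real n + 1/2) powr (-1/2) \<le> half_binom n"
      by (rule power2_le_imp_le) (use half_binom_pos[of n] in linarith)
    have "L * (real n powr (-1/2) - (real n + 1/2) powr (-1/2)) \<le> L * real n powr (-3/2)"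
      using L powr_minus_half_diff[OF n] by (intro mult_left_mono) auto
    with 1 2 show ?thesis by (simp add: algebra_simps)
  qed
  with L(1) show ?thesis by blast
qed

lemma inv_pow_half_decay: "inv_pow (1/2) \<in> decay (-1/2)"
proof -
  obtain L where L: "L > 0" "\<And>n. n > 0 \<Longrightarrow> \<bar>half_binom n - L * real n powr (-1/2)\<bar> \<le> L * real n powr (-3/2)"
    using half_binom_asymp by blast
  show ?thesis
  proof (rule decay_finite[of 1])
    fix n :: nat assume n: "n \<ge> 1"
    have "half_binom n \<le> L * real n powr (-1/2) + L * real n powr (-3/2)" using L(2)[of n] n by linarith
    also have "\<dots> \<le> L * real n powr (-1/2) + L * real n powr (-1/2)"
      using n L by (intro add_mono mult_left_mono powr_mono) auto
    also have "\<dots> = 2 * L * real n powr (-1/2)" by simp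
    also have "\<dots> \<le> 2 * L * (2 powr \<bar>-1/2\<bar> * real (Suc n) powr (-1/2))"
      using n L by (intro mult_left_mono powr_le_Suc_powr) auto
    finally show "cmod (inv_pow (1/2) $ n) \<le> 2 * L * 2 powr \<bar>-1/2\<bar> * real (Suc n) powr (-1/2)"
      using half_binom_pos[of n] by (simp add: inv_pow_nth norm_divide pochhammer_nonneg mult_ac del: of_nat_Suc)
  qed
qed

text \<open>Raising \<open>\<beta>\<close> by one multiplies the coefficient of index
  \<open>n\<close> by \<open>(\<beta> + n) / \<beta>\<close>, hence gains one power of
  \<open>n\<close>; this carries the case \<open>1/2\<close> to the other positive
  half-integers.\<close>

lemma inv_pow_decay_up:
  assumes "inv_pow \<beta> \<in> decay (\<beta> - 1)" "\<beta> \<noteq> 0"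
  shows "inv_pow (\<beta> + 1) \<in> decay \<beta>"
proof -
  obtain C where C: "C > 0" "\<And>n. cmod (inv_pow \<beta> $ n) \<le> C * real (Suc n) powr (\<beta> - 1)"
    using assms by (auto elim: decayE)
  show ?thesis
  proof (rule decayI)
    fix n
    have "inv_pow (\<beta> + 1) $ n = inv_pow \<beta> $ n * of_real ((\<beta> + real n) / \<beta>)"
    proof -
      have "pochhammer (\<beta> + 1) n / fact n = pochhammer \<beta> n / fact n * ((\<beta> + real n) / \<beta>)"
        using assms pochhammer_shift[of \<beta> n] by simp
      then show ?thesis by (simp only: inv_pow_nth of_real_mult)
    qed
    then have "cmod (inv_pow (\<beta> + 1) $ n) = cmod (inv_pow \<beta> $ n) * \<bar>(\<beta> + real n) / \<beta>\<bar>"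
      by (simp only: norm_mult norm_of_real)
    also have "\<dots> \<le> (C * real (Suc n) powr (\<beta> - 1)) * ((\<bar>\<beta>\<bar> + 1) / \<bar>\<beta>\<bar> * real (Suc n))"
    proof (intro mult_mono C)
      have "\<bar>\<beta> + real n\<bar> \<le> (\<bar>\<beta>\<bar> + 1) * (real n + 1)"
      proof -
        have "\<bar>\<beta> + real n\<bar> \<le> \<bar>\<beta>\<bar> + real n" by linarith
        moreover have "0 \<le> \<bar>\<beta>\<bar> * real n" by simp
        moreover have "(\<bar>\<beta>\<bar> + 1) * (real n + 1) = \<bar>\<beta>\<bar> * real n + \<bar>\<beta>\<bar> + real n + 1" by (simp add: distrib_left distrib_right)
        ultimately show ?thesis by linarith
      qed
      then show "\<bar>(\<beta> + real n) / \<beta>\<bar> \<le> (\<bar>\<beta>\<bar> + 1) / \<bar>\<beta>\<bar> * real (Suc n)"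
        by (simp add: abs_divide divide_right_mono add.commute)
    qed (use C in auto)
    also have "\<dots> = C * ((\<bar>\<beta>\<bar> + 1) / \<bar>\<beta>\<bar>) * (real (Suc n) powr (\<beta> - 1) * real (Suc n))"
      by (simp only: mult_ac)
    also have "real (Suc n) powr (\<beta> - 1) * real (Suc n) = real (Suc n) powr \<beta>"
      using powr_add[of "real (Suc n)" "\<beta> - 1" 1] by simp
    finally show "cmod (inv_pow (\<beta> + 1) $ n) \<le> C * ((\<bar>\<beta>\<bar> + 1) / \<bar>\<beta>\<bar>) * real (Suc n) powr \<beta>" .
  qed
qed

text \<open>Needed for the increments of \<open>inv_pow (1/2)\<close>, since multiplication by
  \<open>1 - X\<close> lowers the exponent by one.\<close>

lemma inv_pow_neg_half_decay: "inv_pow (-1/2) \<in> decay (-3/2)"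
proof -
  obtain C where C: "C > 0" "\<And>n. cmod (inv_pow (1/2) $ n) \<le> C * real (Suc n) powr (-1/2)"
    using inv_pow_half_decay by (auto elim: decayE)
  show ?thesis
  proof (rule decay_finite[of 1])
    fix n :: nat assume n: "n \<ge> 1"
    have "pochhammer (1/2::real) n = pochhammer (-1/2) n * (-1/2 + real n) / (-1/2)"
      using pochhammer_shift[of "-1/2" n] by simp
    then have "pochhammer (-1/2::real) n = pochhammer (1/2) n * (-1 / (2 * real n - 1))"
      using n by (simp add: field_simps)
    then have "inv_pow (-1/2) $ n = inv_pow (1/2) $ n * of_real (-1 / (2 * real n - 1))"
      by (simp add: inv_pow_nth)
    then have "cmod (inv_pow (-1/2) $ n) = cmod (inv_pow (1/2) $ n) * \<bar>-1 / (2 * real n - 1)\<bar>"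
      by (simp only: norm_mult norm_of_real)
    also have "\<dots> \<le> (C * real (Suc n) powr (-1/2)) * (2 * (1 / real (Suc n)))"
      using n C by (intro mult_mono C) (auto simp: abs_divide field_simps)
    also have "1 / real (Suc n) = real (Suc n) powr (-1)" by (simp add: powr_minus_divide)
    also have "(C * real (Suc n) powr (-1/2)) * (2 * real (Suc n) powr (-1)) = 2 * C * (real (Suc n) powr (-1/2) * real (Suc n) powr (-1))"
      by (simp only: mult_ac)
    also have "real (Suc n) powr (-1/2) * real (Suc n) powr (-1) = real (Suc n) powr (-3/2)"
      by (subst powr_add[symmetric]) simp
    finally show "cmod (inv_pow (-1/2) $ n) \<le> 2 * C * real (Suc n) powr (-3/2)" .
  qed
qed

lemma inv_pow_decay: "inv_pow (real k / 2) \<in> decay (real k / 2 - 1)"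
proof (induction k rule: induct_nat_012)
  case 0
  then show ?case by (simp add: inv_pow_0)
next
  case 1
  then show ?case using inv_pow_half_decay by simp
next
  case (ge2 k)
  show ?case
  proof (cases "k = 0")
    case True
    \<comment> \<open>The shift formula divides by \<open>\<beta>\<close> and cannot start from
      exponent 0; here the series is the geometric one.\<close>
    have "inv_pow 1 \<in> decay 0" by (rule decayI[of _ 1]) (simp add: inv_pow_1_nth)
    then show ?thesis using True by simp
  next
    case False
    have e: "real (Suc (Suc k)) / 2 = real k / 2 + 1" by simp
    have "inv_pow (real k / 2 + 1) \<in> decay (real k / 2)"
      using False by (intro inv_pow_decay_up[OF ge2.IH(1)]) simp
    then show ?thesis unfolding e by simp
  qed
qed

lemma inv_pow_diff_decay:
  assumes "k \<ge> 1"
  shows "(1 - fps_X) * inv_pow (real k / 2) \<in> decay (real k / 2 - 1 - 1)"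
proof (cases "k = 1")
  case True
  have "real k / 2 - 1 = -1/2" "real k / 2 - 1 - 1 = -3/2" using True by simp_all
  then show ?thesis using inv_pow_neg_half_decay by (simp only: one_minus_X_inv_pow)
next
  case False
  then obtain m where m: "k = m + 2" using assms
    by (intro that[of "k - 2"]) simp
  have "real k / 2 - 1 = real m / 2" unfolding m of_nat_add by (simp add: add_divide_distrib)
  then show ?thesis using inv_pow_decay[of m] by (simp only: one_minus_X_inv_pow)
qed

text \<open>The comparison is with \<open>half_binom n\<close> and not with a power of
  \<open>n\<close>: the constant in \<open>half_binom_asymp\<close> stays unidentified and cancels
  later against the tree size probabilities.\<close>

lemma inv_pow_ratio_tendsto:
  "(\<lambda>n. pochhammer (1/2 + real m) n / fact n / (half_binom n * real n ^ m)) \<longlonglongrightarrow> 1 / pochhammer (1/2) m"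
proof (induction m)
  case 0
  have "pochhammer (1/2 + real 0) n / fact n / (half_binom n * real n ^ 0) = 1" for n
  proof -
    have "half_binom n \<noteq> 0" using half_binom_pos[of n] by linarith
    then show ?thesis unfolding of_nat_0 add_0_right power_0 mult_1_right by (rule divide_self)
  qed
  then show ?case by simp
next
  case (Suc m)
  let ?\<beta> = "1/2 + real m"
  have nz: "?\<beta> \<noteq> 0" by (simp add: add_eq_0_iff2)
  have "(\<lambda>n. 1 / real n + 1 / ?\<beta>) \<longlonglongrightarrow> 0 + 1 / ?\<beta>"
    by (intro tendsto_add lim_1_over_n tendsto_const)
  moreover have "\<forall>\<^sub>F n in sequentially. 1 / real n + 1 / ?\<beta> = (?\<beta> + real n) / (?\<beta> * real n)"
    using eventually_gt_at_top[of 0]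
  proof eventually_elim
    case (elim n)
    have "1 / x + 1 / b = (b + x) / (b * x)" if "x \<noteq> 0" "b \<noteq> 0" for x b :: real
      using that by (simp add: field_simps)
    from this[of "real n" ?\<beta>] show ?case using elim nz by simp
  qed
  ultimately have "(\<lambda>n. (?\<beta> + real n) / (?\<beta> * real n)) \<longlonglongrightarrow> 1 / ?\<beta>"
    unfolding add_0_left using tendsto_cong by fast
  note tendsto_mult[OF Suc this]
  then
  have "(\<lambda>n. pochhammer ?\<beta> n / fact n / (half_binom n * real n ^ m) * ((?\<beta> + real n) / (?\<beta> * real n)))
    \<longlonglongrightarrow> 1 / pochhammer (1/2) m * (1 / ?\<beta>)" .
  moreover have "pochhammer ?\<beta> n / fact n / (half_binom n * real n ^ m) * ((?\<beta> + real n) / (?\<beta> * real n))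
     = pochhammer (1/2 + real (Suc m)) n / fact n / (half_binom n * real n ^ Suc m)" for n
  proof -
    have e: "1/2 + real (Suc m) = ?\<beta> + 1" by simp
    have nz: "?\<beta> \<noteq> 0" by (simp add: add_eq_0_iff2)
    have g: "a / f / (h * x) * (b / (c * z)) = a * b / c / f / (h * (z * x))" for a f h x b c z :: real
      by (simp add: divide_inverse mult_ac)
    show ?thesis unfolding e pochhammer_shift[OF nz] power_Suc by (rule g)
  qed
  moreover have "1 / pochhammer (1/2) m * (1 / ?\<beta>) = 1 / pochhammer (1/2) (Suc m)"
    by (simp only: pochhammer_Suc times_divide_times_eq mult_1_right)
  ultimately show ?case by (simp only:)
qed

section \<open>Fourier inversion\<close>

text \<open>Boundary values on the unit circle; for a probability law, its characteristic
  function.\<close>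

definition cfun :: "complex fps \<Rightarrow> real \<Rightarrow> complex" where
  "cfun a t = (\<Sum>k. a $ k * cis (real k * t))"

abbreviation "abs_summable a \<equiv> summable (\<lambda>k. cmod (a $ k))"

lemma cfun_summable_norm: "abs_summable a \<Longrightarrow> summable (\<lambda>k. cmod (a $ k * cis (real k * t)))"
  by (simp add: norm_mult)

lemma abs_summable_mult:
  assumes "abs_summable a" "abs_summable b"
  shows "abs_summable (a * b)"
proof (rule summable_comparison_test'[of _ 0])
  show "summable (\<lambda>k. \<Sum>i\<le>k. cmod (a $ i) * cmod (b $ (k - i)))"
    using assms by (intro summable_Cauchy_product) auto
  fix n
  have "cmod ((a * b) $ n) \<le> (\<Sum>i\<le>n. cmod (a $ i * b $ (n - i)))"
    unfolding fps_mult_nth atMost_atLeast0[symmetric] by (rule norm_sum)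
  then show "norm (cmod ((a * b) $ n)) \<le> (\<Sum>i\<le>n. cmod (a $ i) * cmod (b $ (n - i)))"
    by (simp add: norm_mult)
qed

lemma cfun_mult:
  assumes "abs_summable a" "abs_summable b"
  shows "cfun (a * b) t = cfun a t * cfun b t"
proof -
  have "(\<Sum>i\<le>k. (a $ i * cis (real i * t)) * (b $ (k - i) * cis (real (k - i) * t))) = (a * b) $ k * cis (real k * t)" for k
  proof -
    have "(a $ i * cis (real i * t)) * (b $ (k - i) * cis (real (k - i) * t)) = a $ i * b $ (k - i) * cis (real k * t)"
      if "i \<le> k" for i
    proof -
      have "cis (real i * t) * cis (real (k - i) * t) = cis (real k * t)"
        using that by (simp add: cis_mult of_nat_diff flip: distrib_right)
      then have "a $ i * b $ (k - i) * cis (real k * t) = a $ i * b $ (k - i) * (cis (real i * t) * cis (real (k - i) * t))"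
        by (simp only:)
      then show ?thesis by (simp only: mult_ac)
    qed
    then show ?thesis unfolding fps_mult_nth sum_distrib_right atMost_atLeast0[symmetric]
      by (intro sum.cong refl) simp
  qed
  then show ?thesis unfolding cfun_def
    by (subst Cauchy_product[OF cfun_summable_norm[OF assms(1)] cfun_summable_norm[OF assms(2)]]) simp
qed

lemma abs_summable_power: "abs_summable a \<Longrightarrow> abs_summable (a ^ n)"
proof (induction n)
  case 0
  have "summable (\<lambda>k. cmod ((1::complex fps) $ k))" by (rule summable_finite[of "{0}"]) auto
  then show ?case by simp
next
  case (Suc n)
  then show ?case by (simp only: power_Suc abs_summable_mult)
qed

lemma cfun_power: "abs_summable a \<Longrightarrow> cfun (a ^ n) t = cfun a t ^ n"
proof (induction n)
  case 0
  have "cfun 1 t = (\<Sum>k\<in>{0}. (1::complex fps) $ k * cis (real k * t))"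
    unfolding cfun_def by (rule suminf_finite) auto
  then show ?case by simp
next
  case (Suc n)
  then show ?case using cfun_mult[OF Suc.prems abs_summable_power[OF Suc.prems, of n], of t] by simp
qed

lemma integral_cis:
  "(LINT t:{-pi..pi}|lborel. cis (real_of_int k * t)) = (if k = 0 then 2 * of_real pi else 0)"
proof (cases "k = 0")
  case True
  then show ?thesis by (simp add: set_integral_const scaleR_conv_of_real)
next
  case False
  let ?F = "\<lambda>t. Complex (sin (real_of_int k * t) / k) (- cos (real_of_int k * t) / k)"
  have "((\<lambda>t. cis (real_of_int k * t)) has_integral ?F pi - ?F (- pi)) {-pi..pi}"
  proof (intro fundamental_theorem_of_calculus)
    fix t
    have "((\<lambda>t. sin (real_of_int k * t) / k) has_real_derivative cos (real_of_int k * t)) (at t within {-pi..pi})"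
      "((\<lambda>t. - cos (real_of_int k * t) / k) has_real_derivative sin (real_of_int k * t)) (at t within {-pi..pi})"
      using False by (auto intro!: derivative_eq_intros)
    then show "(?F has_vector_derivative cis (real_of_int k * t)) (at t within {-pi..pi})"
      by (simp add: has_vector_derivative_complex_iff has_real_derivative_iff_has_vector_derivative)
  qed auto
  moreover have "?F pi - ?F (- pi) = 0"
    using sin_npi_int[of k] by (simp add: mult.commute[of pi])
  ultimately have "((\<lambda>t. cis (real_of_int k * t)) has_integral 0) {-pi..pi}" by (simp only:)
  moreover have "set_integrable lborel {-pi..pi} (\<lambda>t. cis (real_of_int k * t))"
    unfolding set_integrable_def by (rule borel_integrable_compact) (auto intro!: continuous_intros)
  ultimately show ?thesis using False
    by (simp add: set_borel_integral_eq_integral integral_unique)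
qed

lemma fourier_inversion:
  assumes "abs_summable a"
  shows "(LINT t:{-pi..pi}|lborel. cfun a t * cis (- (real m * t))) = 2 * of_real pi * a $ m"
proof -
  let ?f = "\<lambda>k t. indicator {-pi..pi} t *\<^sub>R (a $ k * cis (real_of_int (int k - int m) * t))"
  have e: "a $ k * cis (real k * t) * cis (- (real m * t)) = a $ k * cis (real_of_int (int k - int m) * t)" for k t
    by (simp add: cis_mult left_diff_distrib mult.assoc)
  have int: "integrable lborel (?f k)" for k
    by (rule borel_integrable_compact) (auto intro!: continuous_intros)
  have normf: "norm (?f k t) = indicator {-pi..pi} t * cmod (a $ k)" for k t
    by (simp add: norm_mult indicator_def)
  have i1: "integrable lborel (\<lambda>t. indicator {-pi..pi} t * cmod (a $ k))" for k
    by (intro integrable_mult_left) (auto simp: integrable_indicator_iff)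
  have i2: "(\<integral>t. norm (?f k t) \<partial>lborel) = 2 * pi * cmod (a $ k)" for k
    unfolding normf by simp
  have sumf: "(\<Sum>k. ?f k t) = indicator {-pi..pi} t *\<^sub>R (cfun a t * cis (- (real m * t)))" for t
  proof -
    have "(\<Sum>k. ?f k t) = (\<Sum>k. indicator {-pi..pi} t *\<^sub>R (a $ k * cis (real k * t) * cis (- (real m * t))))"
      by (simp only: e)
    also have "\<dots> = indicator {-pi..pi} t *\<^sub>R (cfun a t * cis (- (real m * t)))"
      unfolding cfun_def using summable_norm_cancel[OF cfun_summable_norm[OF assms, of t]]
      by (subst suminf_scaleR_right[symmetric]) (auto intro: summable_mult2 suminf_mult2[symmetric])
    finally show ?thesis .
  qed
  have "(LINT t:{-pi..pi}|lborel. cfun a t * cis (- (real m * t))) = (\<integral>t. (\<Sum>k. ?f k t) \<partial>lborel)"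
    unfolding set_lebesgue_integral_def sumf ..
  also have "\<dots> = (\<Sum>k. \<integral>t. ?f k t \<partial>lborel)"
  proof (rule integral_suminf[OF int])
    show "AE t in lborel. summable (\<lambda>k. norm (?f k t))"
      unfolding normf using assms by (intro AE_I2 summable_mult)
    show "summable (\<lambda>k. \<integral>t. norm (?f k t) \<partial>lborel)"
      unfolding i2 using assms by (intro summable_mult)
  qed
  also have "(\<lambda>k. \<integral>t. ?f k t \<partial>lborel) = (\<lambda>k. if k = m then 2 * of_real pi * a $ m else 0)"
  proof
    fix k
    have "(\<integral>t. ?f k t \<partial>lborel) = a $ k * (LINT t:{-pi..pi}|lborel. cis (real_of_int (int k - int m) * t))"
      unfolding set_lebesgue_integral_def
      by (subst integral_mult_right_zero[symmetric]) (simp add: scaleR_conv_of_real mult_ac)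
    also have "\<dots> = (if k = m then 2 * of_real pi * a $ m else 0)"
      unfolding integral_cis by auto
    finally show "(\<integral>t. ?f k t \<partial>lborel) = (if k = m then 2 * of_real pi * a $ m else 0)" .
  qed
  also have "(\<Sum>k. if k = m then 2 * of_real pi * a $ m else 0) = 2 * of_real pi * a $ m"
    using suminf_finite[of "{m}" "\<lambda>k. if k = m then 2 * of_real pi * a $ m else 0"] by simp
  finally show ?thesis .
qed

section \<open>Gaussian bounds and integrals\<close>

lemma powr_exp_bound:
  fixes b :: real
  assumes "b \<ge> 0"
  shows "\<exists>C>0. \<forall>x\<ge>0. x powr b \<le> C * exp x"
proof -
  define m where "m = nat \<lceil>b\<rceil>"
  have "x powr b \<le> (1 + fact m) * exp x" if "x \<ge> 0" for x
  proof (cases "x \<le> 1")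
    case True
    then have "x powr b \<le> 1" using that assms by (intro powr_le1) auto
    also have "\<dots> \<le> exp x" using that by simp
    also have "\<dots> \<le> (1 + fact m) * exp x" by (simp add: distrib_right)
    finally show ?thesis .
  next
    case False
    have "x powr b \<le> x powr real m" using False by (intro powr_mono) (auto simp: m_def le_nat_iff of_nat_ceiling)
    also have "\<dots> = x ^ m" using False by (simp add: powr_realpow)
    also have "\<dots> = fact m * (x ^ m / fact m)" by simp
    also have "\<dots> \<le> fact m * exp x"
    proof (intro mult_left_mono)
      have "(\<Sum>n\<in>{m}. x ^ n /\<^sub>R fact n) \<le> (\<Sum>n. x ^ n /\<^sub>R fact n)"
        using that by (intro sum_le_suminf summable_exp_generic) auto
      then show "x ^ m / fact m \<le> exp x" by (simp add: exp_def field_simps)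
    qed simp
    also have "\<dots> \<le> (1 + fact m) * exp x" by (simp add: distrib_right)
    finally show ?thesis .
  qed
  then show ?thesis by (intro exI[of _ "1 + fact m"]) (auto simp: add_pos_pos)
qed

text \<open>Half of the Gaussian exponent is spent to turn a power of \<open>t\<close> into a power
  of \<open>N\<close>. This explains the exponents \<open>2 * c\<close> in the hypotheses and
  \<open>c\<close> in the conclusions of the estimates below.\<close>

lemma abs_powr_gauss_bound:
  fixes b c :: real
  assumes "b \<ge> 0" "c > 0"
  shows "\<exists>C>0. \<forall>N>0. \<forall>t. \<bar>t\<bar> powr b * exp (- (2 * c * N * t\<^sup>2)) \<le> C * N powr (- b / 2) * exp (- (c * N * t\<^sup>2))"
proof -
  obtain C where C: "C > 0" "\<And>x. x \<ge> 0 \<Longrightarrow> x powr (b / 2) \<le> C * exp x"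
    using powr_exp_bound[of "b / 2"] assms by auto
  have "\<bar>t\<bar> powr b * exp (- (2 * c * N * t\<^sup>2)) \<le> C * c powr (- b / 2) * N powr (- b / 2) * exp (- (c * N * t\<^sup>2))"
    if N: "N > 0" for N t
  proof -
    have "\<bar>t\<bar> powr b = (t\<^sup>2) powr (b / 2)"
    proof -
      have "t\<^sup>2 = \<bar>t\<bar> powr 2" by (cases "t = 0") simp_all
      then show ?thesis by (simp only: powr_powr) simp
    qed
    also have "t\<^sup>2 = (c * N * t\<^sup>2) * (1 / (c * N))" using N assms by simp
    also have "\<dots> powr (b / 2) = (c * N * t\<^sup>2) powr (b / 2) * (1 / (c * N)) powr (b / 2)"
      using N assms by (intro powr_mult)
    also have "(1 / (c * N)) powr (b / 2) = c powr (- b / 2) * N powr (- b / 2)"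
      using N assms by (simp add: powr_divide powr_mult powr_minus_divide)
    finally have "\<bar>t\<bar> powr b \<le> C * exp (c * N * t\<^sup>2) * (c powr (- b / 2) * N powr (- b / 2))"
      using C(2)[of "c * N * t\<^sup>2"] N assms by (auto intro: mult_right_mono)
    then have "\<bar>t\<bar> powr b * exp (- (2 * c * N * t\<^sup>2))
        \<le> C * exp (c * N * t\<^sup>2) * (c powr (- b / 2) * N powr (- b / 2)) * exp (- (2 * c * N * t\<^sup>2))"
      by (intro mult_right_mono) auto
    also have "\<dots> = C * c powr (- b / 2) * N powr (- b / 2) * (exp (c * N * t\<^sup>2) * exp (- (2 * c * N * t\<^sup>2)))"
      by (simp only: mult_ac)
    also have "exp (c * N * t\<^sup>2) * exp (- (2 * c * N * t\<^sup>2)) = exp (- (c * N * t\<^sup>2))"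
      by (simp flip: exp_add)
    finally show ?thesis .
  qed
  then show ?thesis using C assms by (intro exI[of _ "C * c powr (- b / 2)"]) auto
qed

lemma gauss_integral:
  assumes "a > 0"
  shows "integrable lborel (\<lambda>t::real. exp (- (a * t\<^sup>2)))"
    and "(\<integral>t. exp (- (a * t\<^sup>2)) \<partial>lborel) = sqrt (pi / a)"
proof -
  define s where "s = sqrt (1 / (2 * a))"
  have s: "s > 0" "s\<^sup>2 = 1 / (2 * a)" using assms by (auto simp: s_def)
  have e: "exp (- (a * t\<^sup>2)) = sqrt (pi / a) * normal_density 0 s t" for t
    using assms by (simp add: normal_density_def s)
  show "integrable lborel (\<lambda>t::real. exp (- (a * t\<^sup>2)))"
    unfolding e using s by (intro integrable_mult_right integrable_normal_density)
  show "(\<integral>t. exp (- (a * t\<^sup>2)) \<partial>lborel) = sqrt (pi / a)"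
    unfolding e using integral_normal_density[OF s(1), of 0] by simp
qed

lemma set_integral_gauss_bound:
  fixes f :: "real \<Rightarrow> complex"
  assumes "c > 0" "N > 0" "A \<in> sets borel" "\<And>t. t \<in> A \<Longrightarrow> cmod (f t) \<le> K * exp (- (c * N * t\<^sup>2))"
    and "K \<ge> 0"
  shows "cmod (LINT t:A|lborel. f t) \<le> K * sqrt (pi / c) * N powr (-1/2)"
proof (cases "set_integrable lborel A f")
  case True
  have i: "integrable lborel (\<lambda>t::real. K * exp (- (c * N * t\<^sup>2)))"
    using gauss_integral(1)[of "c * N"] assms by (intro integrable_mult_right) auto
  have "cmod (LINT t:A|lborel. f t) \<le> (\<integral>t. norm (indicator A t *\<^sub>R f t) \<partial>lborel)"
    unfolding set_lebesgue_integral_def by (rule integral_norm_bound)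
  also have "\<dots> \<le> (\<integral>t. K * exp (- (c * N * t\<^sup>2)) \<partial>lborel)"
  proof (rule integral_mono[OF _ i])
    show "integrable lborel (\<lambda>t. norm (indicator A t *\<^sub>R f t))"
      using True unfolding set_integrable_def by (rule integrable_norm)
    show "norm (indicator A t *\<^sub>R f t) \<le> K * exp (- (c * N * t\<^sup>2))" for t
      using assms(4)[of t] assms(5) by (auto simp: indicator_def)
  qed
  also have "\<dots> = K * sqrt (pi / (c * N))"
    using gauss_integral(2)[of "c * N"] assms by simp
  also have "sqrt (pi / (c * N)) = sqrt (pi / c) * N powr (-1/2)"
    using assms by (simp add: real_sqrt_divide real_sqrt_mult powr_minus_divide powr_half_sqrt)
  finally show ?thesis by simp
next
  case False
  \<comment> \<open>The integral of a non-integrable function is 0 by convention, and then the bound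
    only says that its right-hand side is nonnegative.\<close>
  then have "(LINT t:A|lborel. f t) = 0"
    unfolding set_integrable_def set_lebesgue_integral_def by (rule not_integrable_integral_eq)
  then show ?thesis using assms by simp
qed

section \<open>A local limit theorem with rate\<close>

lemma pmf_expectation_sums:
  fixes f :: "nat \<Rightarrow> 'a :: {banach, second_countable_topology}"
  assumes "integrable (measure_pmf p) f"
  shows "(\<lambda>k. pmf p k *\<^sub>R f k) sums (\<integral>k. f k \<partial>measure_pmf p)"
proof -
  have "integrable (count_space UNIV) (\<lambda>k. pmf p k *\<^sub>R f k)"
    using assms unfolding measure_pmf_eq_density by (subst (asm) integrable_density) auto
  moreover have "(\<integral>k. f k \<partial>measure_pmf p) = (\<integral>k. pmf p k *\<^sub>R f k \<partial>count_space UNIV)"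
    unfolding measure_pmf_eq_density by (subst integral_density) auto
  ultimately show ?thesis using sums_integral_count_space_nat by metis
qed

text \<open>Reduced to the unit disc by scaling. The factor \<open>r ^ (n - 1)\<close> preserves the
  Gaussian decay when powers of the characteristic function are compared with powers of its Gaussian
  approximation.\<close>

lemma norm_power_diff_le:
  fixes z w :: complex
  assumes "cmod z \<le> r" "cmod w \<le> r" "r > 0"
  shows "cmod (z ^ n - w ^ n) \<le> real n * r ^ (n - 1) * cmod (z - w)"
proof (cases n)
  case (Suc m)
  have "cmod ((z / r) ^ n - (w / r) ^ n) \<le> real n * cmod (z / r - w / r)"
    using assms by (intro norm_power_diff) (auto simp: norm_divide)
  also have "(z / r) ^ n - (w / r) ^ n = (z ^ n - w ^ n) / of_real (r ^ n)"
    by (simp add: power_divide diff_divide_distrib)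
  also have "z / r - w / r = (z - w) / of_real r" by (simp add: diff_divide_distrib)
  finally have "cmod (z ^ n - w ^ n) / r ^ n \<le> real n * (cmod (z - w) / r)"
    using assms by (simp add: norm_divide norm_power)
  then have "cmod (z ^ n - w ^ n) \<le> real n * (cmod (z - w) / r) * r ^ n"
    using assms by (simp add: pos_divide_le_eq)
  also have "\<dots> = real n * r ^ (n - 1) * cmod (z - w)" using assms Suc by simp
  finally show ?thesis .
qed simp

lemma exp_minus_bounds:
  fixes x :: real
  assumes "x \<ge> 0"
  shows "\<bar>exp (- x) - (1 - x)\<bar> \<le> x\<^sup>2"
proof -
  have "exp (- x) = 1 / exp x" by (simp add: exp_minus field_simps)
  also have "\<dots> \<le> 1 / (1 + x)"
    using assms exp_ge_add_one_self[of x] by (intro divide_left_mono) auto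
  also have "\<dots> \<le> 1 - x + x\<^sup>2"
  proof -
    have "(1 - x + x\<^sup>2) * (1 + x) = 1 + x ^ 3"
      by (simp add: power2_eq_square power3_eq_cube algebra_simps)
    moreover have "x ^ 3 \<ge> 0" using assms by simp
    ultimately have "1 \<le> (1 - x + x\<^sup>2) * (1 + x)" by linarith
    then show ?thesis using assms by (subst pos_divide_le_eq) auto
  qed
  finally have "exp (- x) \<le> 1 - x + x\<^sup>2" .
  moreover have "1 - x \<le> exp (- x)" using exp_ge_add_one_self[of "-x"] by simp
  ultimately show ?thesis using zero_le_power2[of x] by (intro abs_leI) linarith+
qed

text \<open>For \<open>\<bar>x\<bar> \<le> 1\<close> the cubic Taylor bound is used and beyond that
  the quadratic one; with \<open>0 < \<delta> \<le> 1\<close> both are dominated by the power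
  \<open>2 + \<delta>\<close>.\<close>

lemma iexp_second_order:
  assumes "0 < \<delta>" "\<delta> \<le> 1"
  shows "cmod (exp (\<i> * of_real x) - (1 + \<i> * of_real x - of_real (x\<^sup>2 / 2))) \<le> \<bar>x\<bar> powr (2 + \<delta>)"
proof -
  have e: "(\<Sum>k\<le>2. (\<i> * of_real x) ^ k / fact k) = 1 + \<i> * of_real x - of_real (x\<^sup>2 / 2)"
    by (simp add: eval_nat_numeral field_simps)
  show ?thesis
  proof (cases "\<bar>x\<bar> \<le> 1")
    case True
    have "cmod (exp (\<i> * of_real x) - (1 + \<i> * of_real x - of_real (x\<^sup>2 / 2))) \<le> \<bar>x\<bar> ^ 3 / 6"
      using iexp_approx1[of x 2] unfolding e by (simp add: eval_nat_numeral)
    also have "\<dots> \<le> \<bar>x\<bar> ^ 3" by simp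
    also have "\<dots> \<le> \<bar>x\<bar> powr (2 + \<delta>)"
    proof (cases "x = 0")
      case False
      have "\<bar>x\<bar> ^ 3 = \<bar>x\<bar> powr 3" using False by simp
      also have "\<dots> \<le> \<bar>x\<bar> powr (2 + \<delta>)" using True False assms by (intro powr_mono') auto
      finally show ?thesis .
    qed simp
    finally show ?thesis .
  next
    case False
    have "cmod (exp (\<i> * of_real x) - (1 + \<i> * of_real x - of_real (x\<^sup>2 / 2))) \<le> \<bar>x\<bar> ^ 2"
      using iexp_approx2[of x 2] unfolding e by (simp add: eval_nat_numeral)
    also have "\<dots> = \<bar>x\<bar> powr 2" using False by simp
    also have "\<dots> \<le> \<bar>x\<bar> powr (2 + \<delta>)" using False assms by (intro powr_mono) auto
    finally show ?thesis .
  qed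
qed

lemma set_integrable_cont:
  fixes f :: "real \<Rightarrow> complex"
  assumes "continuous_on {-pi..pi} f"
  shows "set_integrable lborel {-pi..pi} f"
  unfolding set_integrable_def using assms by (intro borel_integrable_compact) auto

section \<open>The characteristic function of the offspring law\<close>

locale offspring =
  fixes p :: "nat pmf" and \<delta> :: real
  assumes mean: "measure_pmf.expectation p real = 1"
    and var_pos: "measure_pmf.variance p real > 0"
    and span: "Gcd {k. pmf p k > 0} = 1"
    and delta: "0 < \<delta>" "\<delta> \<le> 1"
    and mom: "integrable (measure_pmf p) (\<lambda>k. real k powr (2 + \<delta>))"
begin

definition \<Phi> :: "complex fps" where "\<Phi> = Abs_fps (\<lambda>k. of_real (pmf p k))"

definition half_var :: real where "half_var = measure_pmf.variance p real / 2"

lemma half_var_pos: "half_var > 0" using var_pos by (simp add: half_var_def)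

lemma \<Phi>_nth: "\<Phi> $ k = of_real (pmf p k)" by (simp add: \<Phi>_def)

text \<open>A non-integrable function has integral 0 by convention, so a mean equal to 1 already
  forces integrability. The positive variance does the same for the square.\<close>

lemma integrable_id: "integrable (measure_pmf p) real"
  using mean not_integrable_integral_eq[of p real] by fastforce

lemma integrable_sq: "integrable (measure_pmf p) (\<lambda>k. (real k - 1)\<^sup>2)"
  using var_pos mean not_integrable_integral_eq[of p "\<lambda>k. (real k - 1)\<^sup>2"] by fastforce

lemma expectation_sq: "(\<integral>k. (real k - 1)\<^sup>2 \<partial>measure_pmf p) = 2 * half_var"
  by (simp add: half_var_def mean)

lemma integrable_centered: "integrable (measure_pmf p) (\<lambda>k. real k - 1)"
  using integrable_id by (intro Bochner_Integration.integrable_diff) auto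

lemma expectation_centered: "(\<integral>k. (real k - 1) \<partial>measure_pmf p) = 0"
  using mean integrable_id by (subst Bochner_Integration.integral_diff) auto

text \<open>Otherwise \<open>\<xi> - 1\<close> is nonnegative with mean 0, hence 0 almost surely,
  against the positive variance.\<close>

lemma pmf_0_pos: "pmf p 0 > 0"
proof (rule ccontr)
  assume "\<not> pmf p 0 > 0"
  then have "pmf p 0 = 0" using pmf_nonneg[of p 0] by linarith
  then have "0 \<notin> set_pmf p" by (simp add: set_pmf_iff)
  then have ge: "AE k in measure_pmf p. 0 \<le> real k - 1"
    by (auto simp: AE_measure_pmf_iff) (metis Suc_leI not_gr_zero of_nat_1 of_nat_mono One_nat_def)
  have "AE k in measure_pmf p. real k - 1 = 0"
    using integral_nonneg_eq_0_iff_AE[OF integrable_centered ge] expectation_centered by simp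
  then have "AE k in measure_pmf p. (real k - 1)\<^sup>2 = 0" by eventually_elim simp
  then have "(\<integral>k. (real k - 1)\<^sup>2 \<partial>measure_pmf p) = 0"
    by (rule integral_eq_zero_AE)
  then show False using expectation_sq half_var_pos by simp
qed

lemma pmf_sums_1: "pmf p sums 1"
  using pmf_expectation_sums[of p "\<lambda>_. 1::real"] by simp

lemma abs_summable_\<Phi>: "abs_summable \<Phi>"
  using sums_summable[OF pmf_sums_1] by (simp add: \<Phi>_nth)

lemma cfun_\<Phi>: "cfun \<Phi> t = (\<integral>k. cis (real k * t) \<partial>measure_pmf p)"
proof -
  have "integrable (measure_pmf p) (\<lambda>k. cis (real k * t))"
    by (rule measure_pmf.integrable_const_bound[where B = 1]) auto
  from sums_unique[OF pmf_expectation_sums[OF this]] show ?thesis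
    by (simp add: cfun_def \<Phi>_nth scaleR_conv_of_real)
qed

lemma isCont_cfun_\<Phi>: "isCont (cfun \<Phi>) t"
  unfolding continuous_at_sequentially
proof safe
  fix X assume X: "X \<longlonglongrightarrow> t"
  show "(cfun \<Phi> \<circ> X) \<longlonglongrightarrow> cfun \<Phi> t"
    unfolding comp_def cfun_\<Phi>
    by (rule integral_dominated_convergence[where w="\<lambda>_. 1"]) (auto intro!: tendsto_intros X)
qed

text \<open>The characteristic function of the centred step \<open>\<xi> - 1\<close>.\<close>

definition \<chi> :: "real \<Rightarrow> complex" where "\<chi> t = cfun \<Phi> t * cis (- t)"

lemma continuous_\<chi>: "continuous_on A \<chi>"
proof -
  have "continuous_on A (cfun \<Phi>)"
    by (rule continuous_at_imp_continuous_on) (simp add: isCont_cfun_\<Phi>)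
  moreover have "continuous_on A (\<lambda>t. cis (- t))" by (intro continuous_intros)
  ultimately show ?thesis unfolding \<chi>_def by (rule continuous_on_mult)
qed

lemma \<chi>_expectation: "\<chi> t = (\<integral>k. exp (\<i> * of_real (t * (real k - 1))) \<partial>measure_pmf p)"
proof -
  have "\<chi> t = (\<integral>k. cis (real k * t) * cis (- t) \<partial>measure_pmf p)"
    unfolding \<chi>_def cfun_\<Phi> by simp
  also have "(\<lambda>k. cis (real k * t) * cis (- t)) = (\<lambda>k. exp (\<i> * of_real (t * (real k - 1))))"
  proof
    fix k
    have "real k * t + - t = t * (real k - 1)" by (simp add: algebra_simps)
    have "cis (real k * t) * cis (- t) = cis (real k * t + - t)" by (rule cis_mult)
    also have "\<dots> = cis (t * (real k - 1))" by (simp only: \<open>real k * t + - t = t * (real k - 1)\<close>)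
    also have "\<dots> = exp (\<i> * of_real (t * (real k - 1)))" by (rule cis_conv_exp)
    finally show "cis (real k * t) * cis (- t) = exp (\<i> * of_real (t * (real k - 1)))" .
  qed
  finally show ?thesis .
qed

lemma integrable_abs_powr: "integrable (measure_pmf p) (\<lambda>k. \<bar>real k - 1\<bar> powr (2 + \<delta>))"
proof (rule Bochner_Integration.integrable_bound)
  show "integrable (measure_pmf p) (\<lambda>k. 1 + real k powr (2 + \<delta>))" using mom by simp
  have "\<bar>real k - 1\<bar> powr (2 + \<delta>) \<le> 1 + real k powr (2 + \<delta>)" for k
  proof (cases "k = 0")
    case False
    then have "\<bar>real k - 1\<bar> powr (2 + \<delta>) \<le> real k powr (2 + \<delta>)" using delta by (intro powr_mono2) auto
    then show ?thesis by simp
  qed simp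
  then show "AE k in measure_pmf p. norm (\<bar>real k - 1\<bar> powr (2 + \<delta>)) \<le> norm (1 + real k powr (2 + \<delta>))"
    by (intro AE_I2) (simp add: add_nonneg_nonneg)
qed simp

text \<open>The pointwise bound \<open>iexp_second_order\<close> is integrated against the law; the
  linear term disappears because the step is centred.\<close>

lemma \<chi>_expansion: "\<exists>C>0. \<forall>t. cmod (\<chi> t - of_real (1 - half_var * t\<^sup>2)) \<le> C * \<bar>t\<bar> powr (2 + \<delta>)"
proof -
  define C where "C = (\<integral>k. \<bar>real k - 1\<bar> powr (2 + \<delta>) \<partial>measure_pmf p)"
  have C0: "C \<ge> 0" unfolding C_def by (intro integral_nonneg_AE AE_I2) auto
  have "cmod (\<chi> t - of_real (1 - half_var * t\<^sup>2)) \<le> (C + 1) * \<bar>t\<bar> powr (2 + \<delta>)" for t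
  proof -
    let ?x = "\<lambda>k. t * (real k - 1)"
    let ?q = "\<lambda>k. 1 + \<i> * of_real (?x k) - of_real ((?x k)\<^sup>2 / 2)"
    have i1: "integrable (measure_pmf p) (\<lambda>k. exp (\<i> * of_real (?x k)))"
      by (rule measure_pmf.integrable_const_bound[where B = 1]) auto
    have ia: "integrable (measure_pmf p) (\<lambda>k. complex_of_real (?x k))"
      using integrable_centered by (intro integrable_of_real integrable_mult_right)
    have ib: "integrable (measure_pmf p) (\<lambda>k. complex_of_real ((?x k)\<^sup>2 / 2))"
      unfolding power_mult_distrib using integrable_sq
      by (intro integrable_of_real integrable_mult_right Bochner_Integration.integrable_divide)
    have i2: "integrable (measure_pmf p) ?q"
      using ia ib by (intro Bochner_Integration.integrable_diff Bochner_Integration.integrable_add integrable_mult_right) auto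
    have "(\<integral>k. ?q k \<partial>measure_pmf p)
        = (\<integral>k. 1 + \<i> * complex_of_real (?x k) \<partial>measure_pmf p) - (\<integral>k. complex_of_real ((?x k)\<^sup>2 / 2) \<partial>measure_pmf p)"
      using ia ib by (intro Bochner_Integration.integral_diff Bochner_Integration.integrable_add integrable_mult_right) auto
    also have "(\<integral>k. 1 + \<i> * complex_of_real (?x k) \<partial>measure_pmf p)
        = (\<integral>k. 1 \<partial>measure_pmf p) + (\<integral>k. \<i> * complex_of_real (?x k) \<partial>measure_pmf p)"
      using ia by (intro Bochner_Integration.integral_add integrable_mult_right) auto
    also have "(\<integral>k. \<i> * complex_of_real (?x k) \<partial>measure_pmf p) = \<i> * of_real (\<integral>k. ?x k \<partial>measure_pmf p)"
      by (simp only: integral_mult_right_zero integral_complex_of_real)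
    also have "(\<integral>k. complex_of_real ((?x k)\<^sup>2 / 2) \<partial>measure_pmf p) = of_real (\<integral>k. (?x k)\<^sup>2 / 2 \<partial>measure_pmf p)"
      by (simp only: integral_complex_of_real)
    also have "(\<integral>k. ?x k \<partial>measure_pmf p) = 0" using expectation_centered by simp
    also have "(\<integral>k. (?x k)\<^sup>2 / 2 \<partial>measure_pmf p) = half_var * t\<^sup>2"
      unfolding power_mult_distrib using expectation_sq by simp
    finally have q: "(\<integral>k. ?q k \<partial>measure_pmf p) = of_real (1 - half_var * t\<^sup>2)" by simp
    define g where "g k = exp (\<i> * of_real (?x k)) - ?q k" for k
    have g: "integrable (measure_pmf p) g"
      unfolding g_def by (rule Bochner_Integration.integrable_diff[OF i1 i2])
    have gle: "cmod (g k) \<le> \<bar>t\<bar> powr (2 + \<delta>) * \<bar>real k - 1\<bar> powr (2 + \<delta>)" for k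
    proof -
      have "\<bar>?x k\<bar> powr (2 + \<delta>) = \<bar>t\<bar> powr (2 + \<delta>) * \<bar>real k - 1\<bar> powr (2 + \<delta>)"
        unfolding abs_mult by (rule powr_mult)
      then show ?thesis using iexp_second_order[OF delta, of "?x k"] unfolding g_def by (simp only:)
    qed
    have "\<chi> t - of_real (1 - half_var * t\<^sup>2) = (\<integral>k. g k \<partial>measure_pmf p)"
      unfolding q[symmetric] \<chi>_expectation g_def by (rule Bochner_Integration.integral_diff[OF i1 i2, symmetric])
    then have "cmod (\<chi> t - of_real (1 - half_var * t\<^sup>2)) = cmod (\<integral>k. g k \<partial>measure_pmf p)" by (rule arg_cong)
    also have "\<dots> \<le> (\<integral>k. cmod (g k) \<partial>measure_pmf p)" by (rule integral_norm_bound)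
    also have "\<dots> \<le> (\<integral>k. \<bar>t\<bar> powr (2 + \<delta>) * \<bar>real k - 1\<bar> powr (2 + \<delta>) \<partial>measure_pmf p)"
      using gle by (intro integral_mono integrable_norm g integrable_mult_right integrable_abs_powr)
    also have "\<dots> = C * \<bar>t\<bar> powr (2 + \<delta>)" by (simp add: C_def)
    also have "\<dots> \<le> (C + 1) * \<bar>t\<bar> powr (2 + \<delta>)" by (intro mult_right_mono) auto
    finally show ?thesis .
  qed
  then show ?thesis using C0 by (intro exI[of _ "C + 1"]) auto
qed

lemma cmod_cfun_le_1: "cmod (cfun \<Phi> t) \<le> 1"
proof -
  have "cmod (cfun \<Phi> t) \<le> (\<integral>k. cmod (cis (real k * t)) \<partial>measure_pmf p)"
    unfolding cfun_\<Phi> by (rule integral_norm_bound)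
  then show ?thesis by simp
qed

text \<open>The indices \<open>k\<close> with \<open>cis (k * t) = 1\<close> are the multiples of
  the least positive one; it divides the whole support, hence the greatest common divisor 1.\<close>

lemma period_trivial:
  assumes "\<And>k. pmf p k > 0 \<Longrightarrow> cis (real k * t) = 1"
  shows "cis t = 1"
proof -
  have "\<exists>k0>0. pmf p k0 > 0"
  proof (rule ccontr)
    assume no: "\<not> (\<exists>k0>0. pmf p k0 > 0)"
    have k0: "k = 0" if "pmf p k > 0" for k
    proof (rule ccontr)
      assume "k \<noteq> 0"
      then have "k > 0 \<and> pmf p k > 0" using that by simp
      then have "\<exists>k0>0. pmf p k0 > 0" by (rule exI)
      with no show False by (rule notE)
    qed
    have "Gcd {k. pmf p k > 0} = 0"
      unfolding Gcd_0_iff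
    proof
      fix k assume "k \<in> {k. pmf p k > 0}"
      then have "pmf p k > 0" by (rule CollectD)
      then have "k = 0" by (rule k0)
      then show "k \<in> {0}" by simp
    qed
    with span show False by simp
  qed
  then obtain k0 where k0: "k0 > 0" "pmf p k0 > 0" by (elim exE conjE)
  define d where "d = (LEAST d. d > 0 \<and> cis (real d * t) = 1)"
  have d: "d > 0" "cis (real d * t) = 1"
    using LeastI[of "\<lambda>d. d > 0 \<and> cis (real d * t) = 1" k0] k0 assms unfolding d_def by auto
  have "d dvd k" if "pmf p k > 0" for k
  proof -
    have "real k * t = real (k mod d) * t + real (k div d) * (real d * t)"
    proof -
      have "k = k mod d + (k div d) * d" by simp
      then have "real k = real (k mod d) + real (k div d) * real d" by (simp only: flip: of_nat_add of_nat_mult)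
      then show ?thesis by (simp only: distrib_right mult.assoc)
    qed
    then have "cis (real k * t) = cis (real (k mod d) * t) * cis (real d * t) ^ (k div d)"
      by (simp only: cis_mult[symmetric] Complex.DeMoivre[symmetric])
    then have "cis (real (k mod d) * t) = 1" using assms[OF that] d by simp
    then have "\<not> k mod d > 0"
      using not_less_Least[of "k mod d" "\<lambda>d. d > 0 \<and> cis (real d * t) = 1"] d(1) by (auto simp flip: d_def)
    then show ?thesis by auto
  qed
  then have "d dvd Gcd {k. pmf p k > 0}" by (intro Gcd_greatest) auto
  then have "d = 1" using span by simp
  then show ?thesis using d by simp
qed

text \<open>Equality in the triangle inequality would make all the numbers
  \<open>cis (k * t)\<close> with \<open>k\<close> in the support coincide. As 0 is in the support,
  their common value is 1, and the span condition gives \<open>cis t = 1\<close>.\<close>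

lemma cmod_cfun_less_1:
  assumes "t \<noteq> 0" "\<bar>t\<bar> \<le> pi"
  shows "cmod (cfun \<Phi> t) < 1"
proof (rule ccontr)
  assume "\<not> ?thesis"
  then have w: "cmod (cfun \<Phi> t) = 1" using cmod_cfun_le_1[of t] by linarith
  define w where "w = cnj (cfun \<Phi> t)"
  have ww: "cfun \<Phi> t * w = 1" "cmod w = 1" using w by (simp_all add: w_def complex_norm_square[symmetric])
  have cs: "(\<lambda>k. pmf p k *\<^sub>R cis (real k * t)) sums cfun \<Phi> t"
    unfolding cfun_\<Phi> by (rule pmf_expectation_sums, rule measure_pmf.integrable_const_bound[where B = 1]) auto
  have "(\<lambda>k. Re (pmf p k *\<^sub>R cis (real k * t) * w)) sums Re (cfun \<Phi> t * w)"
    by (intro sums_Re sums_mult2 cs)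
  then have "(\<lambda>k. pmf p k * Re (cis (real k * t) * w)) sums 1"
    unfolding ww by (simp only: scaleR_conv_of_real mult.assoc Re_complex_of_real Re_divide_of_real times_complex.sel
        Im_complex_of_real one_complex.sel mult_zero_left diff_zero)
  from sums_diff[OF pmf_sums_1 this]
  have z: "(\<lambda>k. pmf p k * (1 - Re (cis (real k * t) * w))) sums 0"
    by (simp add: right_diff_distrib)
  have le: "Re (cis (real k * t) * w) \<le> 1" for k
    using complex_Re_le_cmod[of "cis (real k * t) * w"] ww by (simp add: norm_mult)
  have "pmf p k * (1 - Re (cis (real k * t) * w)) = 0" for k
    using suminf_eq_zero_iff[OF sums_summable[OF z]] sums_unique[OF z] le by auto
  then have R: "Re (cis (real k * t) * w) = 1" if "pmf p k > 0" for k
    using that by (metis diff_eq_eq add_0 less_irrefl mult_eq_0_iff)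
  have one: "cis (real k * t) * w = 1" if "pmf p k > 0" for k
  proof -
    have "cmod (cis (real k * t) * w) = 1" using ww by (simp add: norm_mult)
    then have "(Re (cis (real k * t) * w))\<^sup>2 + (Im (cis (real k * t) * w))\<^sup>2 = 1"
      by (metis cmod_power2 power_one)
    then show ?thesis using R[OF that] by (simp add: complex_eq_iff)
  qed
  have "w = 1" using one[OF pmf_0_pos] by simp
  then have "cis (real k * t) = 1" if "pmf p k > 0" for k using one[OF that] by simp
  then have "cis t = 1" by (rule period_trivial)
  then have "cos t = 1" by (simp add: complex_eq_iff)
  then obtain n :: int where "t = of_int n * 2 * pi" using cos_one_2pi_int by auto
  with assms have "\<bar>of_int n * 2 :: real\<bar> \<le> 1" "n \<noteq> 0" by (auto simp: abs_mult)
  then show False by linarith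
qed

text \<open>Near 0 the expansion yields the bound; away from 0 the modulus stays below 1 uniformly
  by compactness. The factor 2 leaves half of the exponent to be spent later, and
  \<open>2 * c \<le> half_var\<close> lets the same \<open>c\<close> bound the limiting
  Gaussian.\<close>

lemma \<chi>_gauss_bound: "\<exists>c>0. 2 * c \<le> half_var \<and> (\<forall>t. \<bar>t\<bar> \<le> pi \<longrightarrow> cmod (\<chi> t) \<le> exp (- (2 * c * t\<^sup>2)))"
proof -
  obtain C where C: "C > 0" "\<And>t. cmod (\<chi> t - of_real (1 - half_var * t\<^sup>2)) \<le> C * \<bar>t\<bar> powr (2 + \<delta>)"
    using \<chi>_expansion by auto
  \<comment> \<open>The first bound keeps \<open>1 - half_var * t^2\<close> nonnegative, the last
    makes the error term at most half of the quadratic one, and \<open>pi\<close> keeps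
    \<open>t0\<close> inside the range of integration.\<close>
  define t0 where "t0 = min (1 / sqrt half_var) (min pi ((half_var / (2 * C)) powr (1 / \<delta>)))"
  have t0: "t0 > 0" using half_var_pos C by (simp add: t0_def)
  have near: "cmod (\<chi> t) \<le> exp (- (half_var / 2 * t\<^sup>2))" if t: "\<bar>t\<bar> \<le> t0" for t
  proof -
    have "t\<^sup>2 \<le> (1 / sqrt half_var)\<^sup>2"
      using t half_var_pos by (intro abs_le_square_iff[THEN iffD1]) (auto simp: t0_def)
    then have "half_var * t\<^sup>2 \<le> 1" using half_var_pos by (simp add: power_divide field_simps)
    then have "cmod (of_real (1 - half_var * t\<^sup>2)) = 1 - half_var * t\<^sup>2" by (simp only: norm_of_real)
    moreover have "C * \<bar>t\<bar> powr (2 + \<delta>) \<le> half_var / 2 * t\<^sup>2"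
    proof -
      have "\<bar>t\<bar> powr \<delta> \<le> ((half_var / (2 * C)) powr (1 / \<delta>)) powr \<delta>"
        using t delta by (intro powr_mono2) (auto simp: t0_def)
      also have "\<dots> = half_var / (2 * C)" using delta half_var_pos C by (simp add: powr_powr)
      finally have "C * (t\<^sup>2 * \<bar>t\<bar> powr \<delta>) \<le> C * (t\<^sup>2 * (half_var / (2 * C)))"
        using C by (intro mult_left_mono) auto
      also have "\<dots> = half_var / 2 * t\<^sup>2" using C by simp
      also have "t\<^sup>2 * \<bar>t\<bar> powr \<delta> = \<bar>t\<bar> powr (2 + \<delta>)"
        by (cases "t = 0") (auto simp: powr_add)
      finally show ?thesis .
    qed
    ultimately have "cmod (\<chi> t) \<le> 1 - half_var / 2 * t\<^sup>2"
      using C(2)[of t] norm_triangle_sub[of "\<chi> t" "of_real (1 - half_var * t\<^sup>2)"] by simp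
    also have "\<dots> \<le> exp (- (half_var / 2 * t\<^sup>2))" using exp_ge_add_one_self[of "- (half_var / 2 * t\<^sup>2)"] by simp
    finally show ?thesis .
  qed
  have "\<exists>a>0. \<forall>t. t0 \<le> \<bar>t\<bar> \<and> \<bar>t\<bar> \<le> pi \<longrightarrow> cmod (\<chi> t) \<le> exp (- a)"
  proof -
    let ?K = "{-pi..-t0} \<union> {t0..pi}"
    have "compact ?K" by (intro compact_Un) auto
    moreover have "pi \<in> ?K" by (auto simp: t0_def)
    moreover have "continuous_on ?K (\<lambda>t. cmod (\<chi> t))" by (intro continuous_intros continuous_\<chi>)
    ultimately obtain u where u: "u \<in> ?K" "\<And>t. t \<in> ?K \<Longrightarrow> cmod (\<chi> t) \<le> cmod (\<chi> u)"
      using continuous_attains_sup[of ?K "\<lambda>t. cmod (\<chi> t)"] by blast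
    have "cmod (\<chi> u) < 1"
      unfolding \<chi>_def using u(1) t0 cmod_cfun_less_1[of u] by (auto simp: norm_mult)
    \<comment> \<open>The maximum itself could be 0; a slightly larger \<open>r\<close> is positive,
      so its logarithm can be used.\<close>
    then obtain r where r: "cmod (\<chi> u) < r" "r < 1" using dense by blast
    then have "r > 0" by (meson norm_ge_zero le_less_trans)
    show ?thesis
    proof (intro exI[of _ "- ln r"] conjI allI impI)
      show "- ln r > 0" using r \<open>r > 0\<close> by simp
      fix t assume "t0 \<le> \<bar>t\<bar> \<and> \<bar>t\<bar> \<le> pi"
      then have "t \<in> ?K" by auto
      then show "cmod (\<chi> t) \<le> exp (- (- ln r))" using u(2)[of t] r \<open>r > 0\<close> by simp
    qed
  qed
  then obtain a where a: "a > 0" "\<And>t. t0 \<le> \<bar>t\<bar> \<Longrightarrow> \<bar>t\<bar> \<le> pi \<Longrightarrow> cmod (\<chi> t) \<le> exp (- a)" by auto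
  define c where "c = min (half_var / 4) (a / (2 * pi\<^sup>2))"
  have c: "c > 0" "2 * c \<le> half_var / 2" "2 * c * pi\<^sup>2 \<le> a"
    using half_var_pos a by (auto simp: c_def min_def field_simps)
  show ?thesis
  proof (intro exI[of _ c] conjI allI impI)
    show "c > 0" "2 * c \<le> half_var" using c half_var_pos by auto
    fix t :: real assume t: "\<bar>t\<bar> \<le> pi"
    show "cmod (\<chi> t) \<le> exp (- (2 * c * t\<^sup>2))"
    proof (cases "\<bar>t\<bar> \<le> t0")
      case True
      have "2 * c * t\<^sup>2 \<le> half_var / 2 * t\<^sup>2" using c by (intro mult_right_mono) auto
      then show ?thesis by (intro order_trans[OF near[OF True]]) simp
    next
      case False
      have "t\<^sup>2 \<le> pi\<^sup>2" using t by (intro abs_le_square_iff[THEN iffD1]) auto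
      then have "2 * c * t\<^sup>2 \<le> 2 * c * pi\<^sup>2" using c by (intro mult_left_mono) auto
      then have "2 * c * t\<^sup>2 \<le> a" using c by linarith
      then show ?thesis using False t by (intro order_trans[OF a(2)]) auto
    qed
  qed
qed

end

lemma odd_set_integral_zero:
  fixes f :: "real \<Rightarrow> complex"
  assumes "\<And>t. f (- t) = - f t"
  shows "(LINT t:{-a..a}|lborel. f t) = 0"
proof -
  let ?g = "\<lambda>t. indicator {-a..a} t *\<^sub>R f t"
  have "(\<integral>t. ?g t \<partial>lborel) = (\<integral>t. ?g (- t) \<partial>lborel)"
    using lborel_integral_real_affine[of "-1" ?g 0] by simp
  also have "(\<lambda>t. ?g (- t)) = (\<lambda>t. - ?g t)"
    using assms by (auto simp: indicator_def fun_eq_iff)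
  also have "(\<integral>t. - ?g t \<partial>lborel) = - (\<integral>t. ?g t \<partial>lborel)"
    by (rule integral_minus)
  finally have "(\<integral>t. ?g t \<partial>lborel) = - (\<integral>t. ?g t \<partial>lborel)" .
  then show ?thesis unfolding set_lebesgue_integral_def by (simp add: equation_minus_iff)
qed

lemma cis_diff_bounds:
  shows "cmod (1 - cis t) \<le> \<bar>t\<bar>" and "cmod (1 - cis t + \<i> * of_real t) \<le> t\<^sup>2"
proof -
  show "cmod (1 - cis t) \<le> \<bar>t\<bar>"
    using iexp_approx1[of t 0] by (simp add: cis_conv_exp norm_minus_commute)
  have "cmod (1 - cis t + \<i> * of_real t) \<le> t\<^sup>2 / 2"
    using iexp_approx1[of t 1] by (simp add: cis_conv_exp norm_minus_commute algebra_simps power2_eq_square abs_mult_self_eq)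
  then show "cmod (1 - cis t + \<i> * of_real t) \<le> t\<^sup>2" using zero_le_power2[of t] by linarith
qed

section \<open>Local limit estimates\<close>

context offspring
begin

text \<open>\<open>(\<Phi> ^ n) $ m\<close> is the probability that \<open>n\<close> independent
  offspring numbers add up to \<open>m\<close>; the shift by \<open>n\<close> in the phase comes
  from the centring in \<open>\<chi>\<close>.\<close>

lemma power_coeff_integral:
  "2 * of_real pi * (\<Phi> ^ n) $ m = (LINT t:{-pi..pi}|lborel. \<chi> t ^ n * cis ((real n - real m) * t))"
proof -
  have "cfun (\<Phi> ^ n) t * cis (- (real m * t)) = \<chi> t ^ n * cis ((real n - real m) * t)" for t
  proof -
    have "\<chi> t ^ n = cfun \<Phi> t ^ n * cis (- (real n * t))"
      by (simp add: \<chi>_def power_mult_distrib Complex.DeMoivre)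
    then have "\<chi> t ^ n * cis ((real n - real m) * t) = cfun \<Phi> t ^ n * (cis (- (real n * t)) * cis ((real n - real m) * t))"
      by (simp only: mult.assoc)
    also have "cis (- (real n * t)) * cis ((real n - real m) * t) = cis (- (real m * t))"
      by (simp add: cis_mult left_diff_distrib)
    finally show ?thesis by (simp add: cfun_power abs_summable_\<Phi>)
  qed
  then show ?thesis using fourier_inversion[OF abs_summable_power[OF abs_summable_\<Phi>, of n], of m] by simp
qed

text \<open>Written as an \<open>n\<close>-th power so that \<open>norm_power_diff_le\<close> can
  compare it with \<open>\<chi> t ^ n\<close>.\<close>

definition gau :: "nat \<Rightarrow> real \<Rightarrow> complex" where
  "gau n t = of_real (exp (- (half_var * t\<^sup>2))) ^ n"

lemma gau_eq: "gau n t = of_real (exp (- (half_var * real n * t\<^sup>2)))"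
  unfolding gau_def by (simp add: exp_of_nat_mult[symmetric] mult_ac flip: of_real_power)

lemma gau_integral:
  "\<exists>C>0. \<forall>n>0. cmod ((LINT t:{-pi..pi}|lborel. gau n t) - of_real (sqrt (pi / half_var) * real n powr (-1/2))) \<le> C * real n powr (-3/2)"
proof -
  define C where "C = 2 / (half_var * pi\<^sup>2) * sqrt (pi / (half_var / 2))"
  have C: "C > 0" using half_var_pos by (auto simp: C_def intro!: mult_pos_pos)
  have "cmod ((LINT t:{-pi..pi}|lborel. gau n t) - of_real (sqrt (pi / half_var) * real n powr (-1/2))) \<le> C * real n powr (-3/2)"
    if n: "n > 0" for n
  proof -
    let ?A = "{-pi..pi} :: real set"
    have a: "half_var * real n > 0" using half_var_pos n by simp
    have gi: "integrable lborel (gau n)"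
      unfolding gau_eq using gauss_integral(1)[OF a] by (intro integrable_of_real)
    have "(\<integral>t. gau n t \<partial>lborel) = of_real (sqrt (pi / (half_var * real n)))"
      unfolding gau_eq integral_complex_of_real using gauss_integral(2)[OF a] by simp
    also have "sqrt (pi / (half_var * real n)) = sqrt (pi / half_var) * real n powr (-1/2)"
      using n half_var_pos by (simp add: real_sqrt_divide real_sqrt_mult powr_minus_divide powr_half_sqrt)
    finally have tot: "(\<integral>t. gau n t \<partial>lborel) = of_real (sqrt (pi / half_var) * real n powr (-1/2))" .
    have si: "set_integrable lborel B (gau n)" if "B \<in> sets borel" for B
      unfolding set_integrable_def using gi that by (intro integrable_mult_indicator) auto
    have "(LINT t:?A \<union> (-?A)|lborel. gau n t) = (LINT t:?A|lborel. gau n t) + (LINT t:-?A|lborel. gau n t)"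
      by (rule set_integral_Un) (auto intro: si)
    then have "(LINT t:?A|lborel. gau n t) - (\<integral>t. gau n t \<partial>lborel) = - (LINT t:-?A|lborel. gau n t)"
      by (simp add: set_lebesgue_integral_def)
    then have e: "cmod ((LINT t:?A|lborel. gau n t) - of_real (sqrt (pi / half_var) * real n powr (-1/2))) = cmod (LINT t:-?A|lborel. gau n t)"
      unfolding tot by (simp add: norm_minus_commute)
    \<comment> \<open>Outside the interval half of the exponent exceeds a multiple of
      \<open>n\<close> and is traded for a factor \<open>1 / n\<close>; the other half remains to be
      integrated.\<close>
    have "cmod (LINT t:-?A|lborel. gau n t) \<le> (2 / (half_var * pi\<^sup>2) / real n) * sqrt (pi / (half_var / 2)) * real n powr (-1/2)"
    proof (rule set_integral_gauss_bound)
      fix t :: real assume "t \<in> - ?A"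
      then have "\<bar>t\<bar> > pi" by auto
      then have "t\<^sup>2 \<ge> pi\<^sup>2" by (intro abs_le_square_iff[THEN iffD1]) auto
      then have "half_var / 2 * real n * pi\<^sup>2 \<le> half_var / 2 * real n * t\<^sup>2"
        using half_var_pos by (intro mult_left_mono) auto
      then have "exp (- (half_var * real n * t\<^sup>2)) \<le> exp (- (half_var / 2 * real n * pi\<^sup>2) + - (half_var / 2 * real n * t\<^sup>2))" by simp
      also have "\<dots> = exp (- (half_var / 2 * real n * pi\<^sup>2)) * exp (- (half_var / 2 * real n * t\<^sup>2))" by (rule exp_add)
      also have "exp (- (half_var / 2 * real n * pi\<^sup>2)) \<le> 2 / (half_var * pi\<^sup>2) / real n"
      proof -
        let ?x = "half_var / 2 * real n * pi\<^sup>2"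
        have x: "?x > 0" using half_var_pos n by simp
        have "exp (- ?x) = 1 / exp ?x" by (simp add: exp_minus inverse_eq_divide)
        also have "\<dots> \<le> 1 / ?x"
        proof (rule divide_left_mono)
          show "?x \<le> exp ?x" using exp_ge_add_one_self[of ?x] by linarith
        qed (use x in simp_all)
        finally show ?thesis by (simp add: mult_ac)
      qed
      finally show "cmod (gau n t) \<le> 2 / (half_var * pi\<^sup>2) / real n * exp (- (half_var / 2 * real n * t\<^sup>2))"
        unfolding gau_eq by (simp add: mult_right_mono)
    qed (use half_var_pos n in auto)
    also have "\<dots> = C * (real n powr (-1) * real n powr (-1/2))"
      using n by (simp add: C_def powr_minus_divide)
    also have "real n powr (-1) * real n powr (-1/2) = real n powr (-3/2)" by (subst powr_add[symmetric]) simp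
    finally show ?thesis unfolding e .
  qed
  with C show ?thesis by blast
qed

text \<open>One \<open>c\<close> serves all four bounds, so that they can be combined under a single
  Gaussian integral.\<close>

lemma \<chi>_bounds:
  obtains c K where "c > 0" "K > 0"
    "\<And>n t. \<bar>t\<bar> \<le> pi \<Longrightarrow> cmod (\<chi> t ^ n) \<le> exp (- (2 * c * real n * t\<^sup>2))"
    "\<And>t. \<bar>t\<bar> \<le> pi \<Longrightarrow> cmod (\<chi> t - 1) \<le> K * \<bar>t\<bar> powr 2"
    "\<And>n t. \<bar>t\<bar> \<le> pi \<Longrightarrow> cmod (\<chi> t ^ n - gau n t) \<le> K * real n * (\<bar>t\<bar> powr (2 + \<delta>) * exp (- (2 * c * real n * t\<^sup>2)))"
    "\<And>n t. cmod (gau n t) \<le> exp (- (2 * c * real n * t\<^sup>2))"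
proof -
  obtain c where c: "c > 0" "2 * c \<le> half_var" "\<And>t. \<bar>t\<bar> \<le> pi \<Longrightarrow> cmod (\<chi> t) \<le> exp (- (2 * c * t\<^sup>2))"
    using \<chi>_gauss_bound by auto
  obtain C where C: "C > 0" "\<And>t. cmod (\<chi> t - of_real (1 - half_var * t\<^sup>2)) \<le> C * \<bar>t\<bar> powr (2 + \<delta>)"
    using \<chi>_expansion by auto
  have pw: "\<bar>t\<bar> powr (2 + \<delta>) = \<bar>t\<bar> powr \<delta> * \<bar>t\<bar> powr 2" for t :: real
    by (subst powr_add[symmetric]) (simp add: add.commute)
  have sq: "t\<^sup>2 = \<bar>t\<bar> powr 2" for t :: real by (cases "t = 0") simp_all
  have k2: "cmod (\<chi> t - 1) \<le> (half_var + C * pi powr \<delta>) * \<bar>t\<bar> powr 2" if t: "\<bar>t\<bar> \<le> pi" for t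
  proof -
    have "\<bar>t\<bar> powr \<delta> \<le> pi powr \<delta>" using t delta by (intro powr_mono2) auto
    then have "C * \<bar>t\<bar> powr (2 + \<delta>) \<le> C * (pi powr \<delta> * \<bar>t\<bar> powr 2)"
      unfolding pw using C by (intro mult_left_mono mult_right_mono) auto
    moreover have "cmod (\<chi> t - 1) \<le> cmod (\<chi> t - of_real (1 - half_var * t\<^sup>2)) + cmod (of_real (half_var * t\<^sup>2))"
      using norm_triangle_ineq4[of "\<chi> t - of_real (1 - half_var * t\<^sup>2)" "of_real (half_var * t\<^sup>2)"] by simp
    moreover have "cmod (of_real (half_var * t\<^sup>2)) = half_var * \<bar>t\<bar> powr 2"
      unfolding norm_of_real sq using half_var_pos by (simp add: abs_mult)
    ultimately show ?thesis using C(2)[of t] by (simp add: distrib_right mult.assoc)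
  qed
  \<comment> \<open>The second summand pays for passing from \<open>1 - x\<close> to
    \<open>exp (- x)\<close>: an error of fourth order in \<open>t\<close>, which on a bounded
    interval is also of order \<open>2 + \<delta>\<close>.\<close>
  define C' where "C' = C + half_var\<^sup>2 * pi powr (2 - \<delta>)"
  have C': "C' > 0" using C by (simp add: C'_def add_pos_nonneg)
  have d: "cmod (\<chi> t - of_real (exp (- (half_var * t\<^sup>2)))) \<le> C' * \<bar>t\<bar> powr (2 + \<delta>)" if t: "\<bar>t\<bar> \<le> pi" for t
  proof -
    have "cmod (of_real (1 - half_var * t\<^sup>2) - of_real (exp (- (half_var * t\<^sup>2)))) \<le> (half_var * t\<^sup>2)\<^sup>2"
      unfolding of_real_diff[symmetric] norm_of_real
      using exp_minus_bounds[of "half_var * t\<^sup>2"] half_var_pos by (simp add: abs_minus_commute)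
    also have "\<dots> = half_var\<^sup>2 * (\<bar>t\<bar> powr (2 - \<delta>) * \<bar>t\<bar> powr (2 + \<delta>))"
      unfolding power_mult_distrib sq[of "t\<^sup>2"] by (simp flip: powr_add)
    also have "\<dots> \<le> half_var\<^sup>2 * (pi powr (2 - \<delta>) * \<bar>t\<bar> powr (2 + \<delta>))"
      using t delta by (intro mult_left_mono mult_right_mono powr_mono2) auto
    finally have "cmod (of_real (1 - half_var * t\<^sup>2) - of_real (exp (- (half_var * t\<^sup>2)))) \<le> half_var\<^sup>2 * (pi powr (2 - \<delta>) * \<bar>t\<bar> powr (2 + \<delta>))" .
    moreover have "cmod (\<chi> t - of_real (exp (- (half_var * t\<^sup>2)))) \<le> cmod (\<chi> t - of_real (1 - half_var * t\<^sup>2))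
       + cmod (of_real (1 - half_var * t\<^sup>2) - of_real (exp (- (half_var * t\<^sup>2))))"
      using norm_triangle_ineq[of "\<chi> t - of_real (1 - half_var * t\<^sup>2)" "of_real (1 - half_var * t\<^sup>2) - of_real (exp (- (half_var * t\<^sup>2)))"] by simp
    ultimately show ?thesis using C(2)[of t] unfolding C'_def by (simp add: distrib_right mult.assoc)
  qed
  \<comment> \<open>The factor \<open>exp (2 * c * pi^2)\<close> restores the one power missing from
    \<open>n - 1\<close> factors.\<close>
  define K where "K = (half_var + C * pi powr \<delta>) + C' * exp (2 * c * pi\<^sup>2)"
  have K: "K > 0" "half_var + C * pi powr \<delta> \<le> K" "C' * exp (2 * c * pi\<^sup>2) \<le> K"
    using half_var_pos C C' by (auto simp: K_def add_pos_pos)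
  have e: "exp (- (2 * c * t\<^sup>2)) ^ n = exp (- (2 * c * real n * t\<^sup>2))" for n t
    by (simp add: exp_of_nat_mult[symmetric] mult_ac)
  have 1: "cmod (\<chi> t ^ n) \<le> exp (- (2 * c * real n * t\<^sup>2))" if "\<bar>t\<bar> \<le> pi" for n t
    unfolding norm_power e[symmetric] using c(3)[OF that] by (intro power_mono) auto
  have 2: "cmod (\<chi> t - 1) \<le> K * \<bar>t\<bar> powr 2" if "\<bar>t\<bar> \<le> pi" for t
    by (rule order_trans[OF k2[OF that]]) (intro mult_right_mono K, simp)
  have ge: "exp (- (half_var * t\<^sup>2)) \<le> exp (- (2 * c * t\<^sup>2))" for t
    using c by (simp add: mult_right_mono)
  have 4: "cmod (gau n t) \<le> exp (- (2 * c * real n * t\<^sup>2))" for n t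
    unfolding gau_def norm_power e[symmetric] using ge[of t] by (intro power_mono) auto
  have 3: "cmod (\<chi> t ^ n - gau n t) \<le> K * real n * (\<bar>t\<bar> powr (2 + \<delta>) * exp (- (2 * c * real n * t\<^sup>2)))"
    if t: "\<bar>t\<bar> \<le> pi" for n t
  proof (cases "n = 0")
    case False
    have "cmod (\<chi> t ^ n - gau n t) \<le> real n * exp (- (2 * c * t\<^sup>2)) ^ (n - 1) * cmod (\<chi> t - of_real (exp (- (half_var * t\<^sup>2))))"
      unfolding gau_def using c(3)[OF t] ge[of t] by (intro norm_power_diff_le) auto
    also have "\<dots> \<le> real n * (exp (2 * c * pi\<^sup>2) * exp (- (2 * c * real n * t\<^sup>2))) * (C' * \<bar>t\<bar> powr (2 + \<delta>))"
    proof (intro mult_mono d t mult_left_mono)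
      have "t\<^sup>2 \<le> pi\<^sup>2" using t by (intro abs_le_square_iff[THEN iffD1]) auto
      then have "2 * c * t\<^sup>2 \<le> 2 * c * pi\<^sup>2" using c by (intro mult_left_mono) auto
      moreover have "real (n - 1) = real n - 1" using False by (simp add: of_nat_diff)
      ultimately have "- (2 * c * real (n - 1) * t\<^sup>2) \<le> 2 * c * pi\<^sup>2 + - (2 * c * real n * t\<^sup>2)"
        by (simp add: algebra_simps)
      then show "exp (- (2 * c * t\<^sup>2)) ^ (n - 1) \<le> exp (2 * c * pi\<^sup>2) * exp (- (2 * c * real n * t\<^sup>2))"
        unfolding e exp_add[symmetric] by simp
    qed auto
    also have "\<dots> = C' * exp (2 * c * pi\<^sup>2) * (real n * (\<bar>t\<bar> powr (2 + \<delta>) * exp (- (2 * c * real n * t\<^sup>2))))"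
      by (simp only: mult_ac)
    also have "\<dots> \<le> K * (real n * (\<bar>t\<bar> powr (2 + \<delta>) * exp (- (2 * c * real n * t\<^sup>2))))"
      by (intro mult_right_mono K) auto
    finally show ?thesis by (simp only: mult.assoc)
  qed (simp add: gau_def)
  show ?thesis by (rule that[OF c(1) K(1) 1 2 3 4])
qed

lemma cont_gau: "continuous_on A (gau n)"
  unfolding gau_def by (intro continuous_intros)

lemma cont_\<chi>_power: "continuous_on A (\<lambda>t. \<chi> t ^ n)"
  by (intro continuous_on_power continuous_\<chi>)

lemma cont_cis: "continuous_on A (\<lambda>t. cis (a * t))"
  by (intro continuous_intros)

lemma norm_two_pi: "cmod (2 * of_real pi * z) = 2 * pi * cmod z"
  by (simp add: norm_mult)

lemma le_of_two_pi:
  assumes "cmod (2 * of_real pi * z) \<le> B"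
  shows "cmod z \<le> B"
proof -
  have "1 * cmod z \<le> 2 * pi * cmod z" using pi_gt3 by (intro mult_right_mono) auto
  then show ?thesis using assms unfolding norm_two_pi by linarith
qed

text \<open>Uniformity in \<open>m\<close> is what later bounds the coefficients of all powers of
  \<open>y\<close> at once.\<close>

lemma llt_uniform: "\<exists>C>0. \<forall>n>0. \<forall>m. cmod ((\<Phi> ^ n) $ m) \<le> C * real n powr (-1/2)"
proof -
  obtain c K where c: "c > 0" "\<And>n t. \<bar>t\<bar> \<le> pi \<Longrightarrow> cmod (\<chi> t ^ n) \<le> exp (- (2 * c * real n * t\<^sup>2))"
    using \<chi>_bounds by metis
  have "cmod ((\<Phi> ^ n) $ m) \<le> 1 * sqrt (pi / (2 * c)) * real n powr (-1/2)" if n: "n > 0" for n m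
    unfolding power_coeff_integral[of n m]
  proof (rule le_of_two_pi, unfold power_coeff_integral, rule set_integral_gauss_bound)
    show "cmod (\<chi> t ^ n * cis ((real n - real m) * t)) \<le> 1 * exp (- (2 * c * real n * t\<^sup>2))" if "t \<in> {-pi..pi}" for t
    proof -
      have "\<bar>t\<bar> \<le> pi" using that by (simp add: abs_le_iff)
      then show ?thesis using c(2)[of t n] by (simp add: norm_mult)
    qed
  qed (use c n in auto)
  then show ?thesis using c by (intro exI[of _ "1 * sqrt (pi / (2 * c))"]) auto
qed

text \<open>The difference of the \<open>n\<close>-th powers is of order
  \<open>n * \<bar>t\<bar> powr (2 + \<delta>)\<close>. Under a Gaussian of width
  \<open>n powr (-1/2)\<close> this is a relative error
  \<open>n powr (- \<delta> / 2)\<close>.\<close>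

lemma llt_rate:
  "\<exists>c0>0. \<exists>C>0. \<forall>n>0. cmod ((\<Phi> ^ n) $ n - of_real (c0 * real n powr (-1/2))) \<le> C * real n powr (-1/2 - \<delta>/2)"
proof -
  obtain c K where c: "c > 0" "K > 0"
    "\<And>n t. \<bar>t\<bar> \<le> pi \<Longrightarrow> cmod (\<chi> t ^ n - gau n t) \<le> K * real n * (\<bar>t\<bar> powr (2 + \<delta>) * exp (- (2 * c * real n * t\<^sup>2)))"
    using \<chi>_bounds by metis
  obtain D where D: "D > 0" "\<And>N t. N > 0 \<Longrightarrow> \<bar>t\<bar> powr (2 + \<delta>) * exp (- (2 * c * N * t\<^sup>2)) \<le> D * N powr (- (2 + \<delta>) / 2) * exp (- (c * N * t\<^sup>2))"
    using abs_powr_gauss_bound[of "2 + \<delta>" c] c delta by auto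
  obtain G where G: "G > 0" "\<And>n. n > 0 \<Longrightarrow> cmod ((LINT t:{-pi..pi}|lborel. gau n t) - of_real (sqrt (pi / half_var) * real n powr (-1/2))) \<le> G * real n powr (-3/2)"
    using gau_integral by auto
  define c0 where "c0 = sqrt (pi / half_var) / (2 * pi)"
  define C where "C = K * D * sqrt (pi / c) + G"
  have "c0 > 0" "C > 0" using half_var_pos c D G by (auto simp: c0_def C_def intro!: add_nonneg_pos mult_nonneg_nonneg)
  moreover have "cmod ((\<Phi> ^ n) $ n - of_real (c0 * real n powr (-1/2))) \<le> C * real n powr (-1/2 - \<delta>/2)" if n: "n > 0" for n
  proof (rule le_of_two_pi)
    have "(LINT t:{-pi..pi}|lborel. \<chi> t ^ n - gau n t) = (LINT t:{-pi..pi}|lborel. \<chi> t ^ n) - (LINT t:{-pi..pi}|lborel. gau n t)"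
      by (rule set_integral_diff(2)) (intro set_integrable_cont cont_\<chi>_power cont_gau)+
    moreover have "2 * of_real pi * (\<Phi> ^ n) $ n = (LINT t:{-pi..pi}|lborel. \<chi> t ^ n)"
      unfolding power_coeff_integral by simp
    moreover have "2 * of_real pi * of_real (c0 * real n powr (-1/2)) = complex_of_real (sqrt (pi / half_var) * real n powr (-1/2))"
      by (simp add: c0_def)
    ultimately have e: "2 * of_real pi * ((\<Phi> ^ n) $ n - of_real (c0 * real n powr (-1/2)))
      = (LINT t:{-pi..pi}|lborel. \<chi> t ^ n - gau n t) + ((LINT t:{-pi..pi}|lborel. gau n t) - of_real (sqrt (pi / half_var) * real n powr (-1/2)))"
      by (simp only: right_diff_distrib) simp
    have p: "real n * real n powr (- (2 + \<delta>) / 2) = real n powr (- \<delta> / 2)"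
      using powr_add[of "real n" 1 "- (2 + \<delta>) / 2"] n by (simp add: field_simps)
    have "cmod (LINT t:{-pi..pi}|lborel. \<chi> t ^ n - gau n t) \<le> (K * D * real n powr (- \<delta> / 2)) * sqrt (pi / c) * real n powr (-1/2)"
    proof (rule set_integral_gauss_bound)
      fix t assume t: "t \<in> {-pi..pi}"
      have "cmod (\<chi> t ^ n - gau n t) \<le> K * real n * (\<bar>t\<bar> powr (2 + \<delta>) * exp (- (2 * c * real n * t\<^sup>2)))"
        using t by (intro c) auto
      also have "\<dots> \<le> K * real n * (D * real n powr (- (2 + \<delta>) / 2) * exp (- (c * real n * t\<^sup>2)))"
        using c n by (intro mult_left_mono D) auto
      also have "\<dots> = K * D * (real n * real n powr (- (2 + \<delta>) / 2)) * exp (- (c * real n * t\<^sup>2))"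
        by (simp only: mult_ac)
      finally show "cmod (\<chi> t ^ n - gau n t) \<le> K * D * real n powr (- \<delta> / 2) * exp (- (c * real n * t\<^sup>2))"
        unfolding p .
    qed (use c n D in auto)
    also have "\<dots> = K * D * sqrt (pi / c) * (real n powr (- \<delta> / 2) * real n powr (-1/2))"
      by (simp only: mult_ac)
    also have "real n powr (- \<delta> / 2) * real n powr (-1/2) = real n powr (-1/2 - \<delta>/2)"
      by (subst powr_add[symmetric]) (simp add: algebra_simps)
    finally have 1: "cmod (LINT t:{-pi..pi}|lborel. \<chi> t ^ n - gau n t) \<le> K * D * sqrt (pi / c) * real n powr (-1/2 - \<delta>/2)" .
    have "G * real n powr (-3/2) \<le> G * real n powr (-1/2 - \<delta>/2)"
      using n G delta by (intro mult_left_mono powr_mono) auto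
    with G(2)[OF n] have 2: "cmod ((LINT t:{-pi..pi}|lborel. gau n t) - of_real (sqrt (pi / half_var) * real n powr (-1/2))) \<le> G * real n powr (-1/2 - \<delta>/2)"
      by (rule order_trans)
    show "cmod (2 * of_real pi * ((\<Phi> ^ n) $ n - of_real (c0 * real n powr (-1/2)))) \<le> C * real n powr (-1/2 - \<delta>/2)"
      unfolding e C_def distrib_right by (rule order_trans[OF norm_triangle_ineq add_mono[OF 1 2]])
  qed
  ultimately show ?thesis by blast
qed

text \<open>The extra factor \<open>\<chi> t - 1\<close> is quadratic in \<open>t\<close> and so
  gains \<open>1 / n\<close>. This regularity of the diagonal coefficients is the hypothesis on
  increments in \<open>decay_mult_mass\<close>.\<close>

lemma llt_diff:
  "\<exists>C>0. \<forall>n>0. cmod ((\<Phi> ^ Suc n) $ Suc n - (\<Phi> ^ n) $ n) \<le> C * real n powr (-3/2)"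
proof -
  obtain c K where c: "c > 0" "K > 0"
    "\<And>n t. \<bar>t\<bar> \<le> pi \<Longrightarrow> cmod (\<chi> t ^ n) \<le> exp (- (2 * c * real n * t\<^sup>2))"
    "\<And>t. \<bar>t\<bar> \<le> pi \<Longrightarrow> cmod (\<chi> t - 1) \<le> K * \<bar>t\<bar> powr 2"
    using \<chi>_bounds by metis
  obtain D where D: "D > 0" "\<And>N t. N > 0 \<Longrightarrow> \<bar>t\<bar> powr 2 * exp (- (2 * c * N * t\<^sup>2)) \<le> D * N powr (- 2 / 2) * exp (- (c * N * t\<^sup>2))"
    using abs_powr_gauss_bound[of 2 c] c by auto
  have "cmod ((\<Phi> ^ Suc n) $ Suc n - (\<Phi> ^ n) $ n) \<le> K * D * sqrt (pi / c) * real n powr (-3/2)" if n: "n > 0" for n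
  proof (rule le_of_two_pi)
    have "(LINT t:{-pi..pi}|lborel. \<chi> t ^ Suc n - \<chi> t ^ n) = (LINT t:{-pi..pi}|lborel. \<chi> t ^ Suc n) - (LINT t:{-pi..pi}|lborel. \<chi> t ^ n)"
      by (rule set_integral_diff(2)) (intro set_integrable_cont cont_\<chi>_power)+
    then have e: "2 * of_real pi * ((\<Phi> ^ Suc n) $ Suc n - (\<Phi> ^ n) $ n) = (LINT t:{-pi..pi}|lborel. \<chi> t ^ Suc n - \<chi> t ^ n)"
      unfolding right_diff_distrib power_coeff_integral by simp
    have "cmod (LINT t:{-pi..pi}|lborel. \<chi> t ^ Suc n - \<chi> t ^ n) \<le> (K * D * real n powr (-1)) * sqrt (pi / c) * real n powr (-1/2)"
    proof (rule set_integral_gauss_bound)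
      fix t assume t: "t \<in> {-pi..pi}"
      have "\<chi> t ^ Suc n - \<chi> t ^ n = (\<chi> t - 1) * \<chi> t ^ n" by (simp add: algebra_simps)
      then have "cmod (\<chi> t ^ Suc n - \<chi> t ^ n) = cmod (\<chi> t - 1) * cmod (\<chi> t ^ n)" by (simp only: norm_mult)
      also have "\<dots> \<le> (K * \<bar>t\<bar> powr 2) * exp (- (2 * c * real n * t\<^sup>2))"
        using t c by (intro mult_mono c) auto
      also have "\<dots> = K * (\<bar>t\<bar> powr 2 * exp (- (2 * c * real n * t\<^sup>2)))" by (simp only: mult.assoc)
      also have "\<dots> \<le> K * (D * real n powr (- 2 / 2) * exp (- (c * real n * t\<^sup>2)))"
        using c n by (intro mult_left_mono D) auto
      finally show "cmod (\<chi> t ^ Suc n - \<chi> t ^ n) \<le> K * D * real n powr (-1) * exp (- (c * real n * t\<^sup>2))"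
        by (simp add: mult.assoc)
    qed (use c n D in auto)
    also have "\<dots> = K * D * sqrt (pi / c) * (real n powr (-1) * real n powr (-1/2))"
      by (simp only: mult_ac)
    also have "real n powr (-1) * real n powr (-1/2) = real n powr (-3/2)"
      by (subst powr_add[symmetric]) simp
    finally show "cmod (2 * of_real pi * ((\<Phi> ^ Suc n) $ Suc n - (\<Phi> ^ n) $ n)) \<le> K * D * sqrt (pi / c) * real n powr (-3/2)"
      unfolding e .
  qed
  then show ?thesis using c D by (intro exI[of _ "K * D * sqrt (pi / c)"]) auto
qed

text \<open>The factor \<open>1 - cis t\<close> is only linear in \<open>t\<close>, which alone
  would give the critical exponent -1. Its linear part times the even function \<open>gau n\<close>
  integrates to 0; what remains is the quadratic part, and the product with the error of the
  Gaussian approximation, which gains \<open>n powr (- \<delta> / 2)\<close>.\<close>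

lemma llt_neighbour:
  "\<exists>C>0. \<forall>n>0. cmod ((\<Phi> ^ n) $ n - (\<Phi> ^ n) $ (n - 1)) \<le> C * real n powr (-1 - \<delta>/2)"
proof -
  obtain c K where c: "c > 0" "K > 0"
    "\<And>n t. \<bar>t\<bar> \<le> pi \<Longrightarrow> cmod (\<chi> t ^ n - gau n t) \<le> K * real n * (\<bar>t\<bar> powr (2 + \<delta>) * exp (- (2 * c * real n * t\<^sup>2)))"
    "\<And>n t. cmod (gau n t) \<le> exp (- (2 * c * real n * t\<^sup>2))"
    using \<chi>_bounds by metis
  obtain D where D: "D > 0" "\<And>N t. N > 0 \<Longrightarrow> \<bar>t\<bar> powr (3 + \<delta>) * exp (- (2 * c * N * t\<^sup>2)) \<le> D * N powr (- (3 + \<delta>) / 2) * exp (- (c * N * t\<^sup>2))"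
    using abs_powr_gauss_bound[of "3 + \<delta>" c] c delta by auto
  obtain E where E: "E > 0" "\<And>N t. N > 0 \<Longrightarrow> \<bar>t\<bar> powr 2 * exp (- (2 * c * N * t\<^sup>2)) \<le> E * N powr (- 2 / 2) * exp (- (c * N * t\<^sup>2))"
    using abs_powr_gauss_bound[of 2 c] c by auto
  define C where "C = (K * D + E) * sqrt (pi / c)"
  have "C > 0" using c D E by (auto simp: C_def intro!: mult_pos_pos add_pos_pos)
  moreover have "cmod ((\<Phi> ^ n) $ n - (\<Phi> ^ n) $ (n - 1)) \<le> C * real n powr (-1 - \<delta>/2)" if n: "n > 0" for n
  proof (rule le_of_two_pi)
    let ?f = "\<lambda>t. (\<chi> t ^ n - gau n t) * (1 - cis t) + gau n t * (1 - cis t + \<i> * of_real t)"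
    let ?g = "\<lambda>t. gau n t * (\<i> * of_real t)"
    have n1: "real n - real (n - 1) = 1" using n by (simp add: of_nat_diff)
    have "(LINT t:{-pi..pi}|lborel. \<chi> t ^ n * cis (0 * t)) - (LINT t:{-pi..pi}|lborel. \<chi> t ^ n * cis (1 * t))
      = (LINT t:{-pi..pi}|lborel. \<chi> t ^ n * cis (0 * t) - \<chi> t ^ n * cis (1 * t))"
      by (rule set_integral_diff(2)[symmetric]) (intro set_integrable_cont continuous_on_mult cont_\<chi>_power cont_cis)+
    then have "2 * of_real pi * ((\<Phi> ^ n) $ n - (\<Phi> ^ n) $ (n - 1)) = (LINT t:{-pi..pi}|lborel. \<chi> t ^ n * cis (0 * t) - \<chi> t ^ n * cis (1 * t))"
      unfolding right_diff_distrib power_coeff_integral n1 by simp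
    also have "(\<lambda>t. \<chi> t ^ n * cis (0 * t) - \<chi> t ^ n * cis (1 * t)) = (\<lambda>t. ?f t - ?g t)"
      by (simp add: algebra_simps)
    also have "(LINT t:{-pi..pi}|lborel. ?f t - ?g t) = (LINT t:{-pi..pi}|lborel. ?f t) - (LINT t:{-pi..pi}|lborel. ?g t)"
    proof (rule set_integral_diff(2))
      have "continuous_on {-pi..pi} (\<lambda>t. cis t)" using cont_cis[of _ 1] by simp
      then show "set_integrable lborel {-pi..pi} ?f"
        by (intro set_integrable_cont continuous_on_add continuous_on_mult continuous_on_diff cont_\<chi>_power cont_gau
            continuous_on_const continuous_on_of_real continuous_on_id)
      show "set_integrable lborel {-pi..pi} ?g"
        by (intro set_integrable_cont continuous_on_mult cont_gau continuous_on_const continuous_on_of_real continuous_on_id)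
    qed
    also have "(LINT t:{-pi..pi}|lborel. ?g t) = 0"
      by (rule odd_set_integral_zero) (simp add: gau_def)
    finally have e: "2 * of_real pi * ((\<Phi> ^ n) $ n - (\<Phi> ^ n) $ (n - 1)) = (LINT t:{-pi..pi}|lborel. ?f t)" by simp
    have p: "real n * real n powr (- (3 + \<delta>) / 2) = real n powr (- 1/2 - \<delta> / 2)"
      using powr_add[of "real n" 1 "- (3 + \<delta>) / 2"] n by (simp add: field_simps)
    have p2: "real n powr (-2/2) \<le> real n powr (- 1/2 - \<delta> / 2)"
      using n delta by (intro powr_mono) auto
    have "cmod (LINT t:{-pi..pi}|lborel. ?f t) \<le> ((K * D + E) * real n powr (- 1/2 - \<delta> / 2)) * sqrt (pi / c) * real n powr (-1/2)"
    proof (rule set_integral_gauss_bound)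
      fix t assume t: "t \<in> {-pi..pi}"
      have "cmod ((\<chi> t ^ n - gau n t) * (1 - cis t)) \<le> (K * real n * (\<bar>t\<bar> powr (2 + \<delta>) * exp (- (2 * c * real n * t\<^sup>2)))) * \<bar>t\<bar>"
        unfolding norm_mult using t c by (intro mult_mono c cis_diff_bounds) auto
      also have "\<dots> = K * real n * ((\<bar>t\<bar> * \<bar>t\<bar> powr (2 + \<delta>)) * exp (- (2 * c * real n * t\<^sup>2)))"
        by (simp only: mult_ac)
      also have "\<bar>t\<bar> * \<bar>t\<bar> powr (2 + \<delta>) = \<bar>t\<bar> powr (3 + \<delta>)"
        by (simp add: powr_mult_base)
      also have "K * real n * (\<bar>t\<bar> powr (3 + \<delta>) * exp (- (2 * c * real n * t\<^sup>2))) \<le> K * real n * (D * real n powr (- (3 + \<delta>) / 2) * exp (- (c * real n * t\<^sup>2)))"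
        using c n by (intro mult_left_mono D) auto
      also have "\<dots> = K * D * (real n * real n powr (- (3 + \<delta>) / 2)) * exp (- (c * real n * t\<^sup>2))"
        by (simp only: mult_ac)
      finally have 1: "cmod ((\<chi> t ^ n - gau n t) * (1 - cis t)) \<le> K * D * real n powr (- 1/2 - \<delta> / 2) * exp (- (c * real n * t\<^sup>2))"
        unfolding p .
      have sq: "t\<^sup>2 = \<bar>t\<bar> powr 2" by (cases "t = 0") simp_all
      have "cmod (gau n t * (1 - cis t + \<i> * of_real t)) \<le> exp (- (2 * c * real n * t\<^sup>2)) * t\<^sup>2"
        unfolding norm_mult by (intro mult_mono c cis_diff_bounds) auto
      also have "\<dots> = \<bar>t\<bar> powr 2 * exp (- (2 * c * real n * t\<^sup>2))" unfolding sq[symmetric] by (rule mult.commute)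
      also have "\<dots> \<le> E * real n powr (- 2 / 2) * exp (- (c * real n * t\<^sup>2))"
        using n by (intro E) auto
      also have "\<dots> \<le> E * real n powr (- 1/2 - \<delta> / 2) * exp (- (c * real n * t\<^sup>2))"
        using E by (intro mult_right_mono mult_left_mono p2) auto
      finally have 2: "cmod (gau n t * (1 - cis t + \<i> * of_real t)) \<le> E * real n powr (- 1/2 - \<delta> / 2) * exp (- (c * real n * t\<^sup>2))" .
      show "cmod (?f t) \<le> ((K * D + E) * real n powr (- 1/2 - \<delta> / 2)) * exp (- (c * real n * t\<^sup>2))"
        unfolding distrib_right by (rule order_trans[OF norm_triangle_ineq add_mono[OF 1 2]])
    qed (use c n D E in auto)
    also have "\<dots> = C * (real n powr (- 1/2 - \<delta> / 2) * real n powr (-1/2))"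
      unfolding C_def by (simp only: mult_ac)
    also have "real n powr (- 1/2 - \<delta> / 2) * real n powr (-1/2) = real n powr (-1 - \<delta>/2)"
      by (subst powr_add[symmetric]) (simp add: algebra_simps)
    finally show "cmod (2 * of_real pi * ((\<Phi> ^ n) $ n - (\<Phi> ^ n) $ (n - 1))) \<le> C * real n powr (-1 - \<delta>/2)"
      unfolding e .
  qed
  ultimately show ?thesis by blast
qed

end

section \<open>Generating series of additive tree functionals\<close>

definition forests :: "nat \<Rightarrow> nat \<Rightarrow> ptree list set" where
  "forests d n = {ts. length ts = d \<and> sum_list (map tsize ts) = n}"

lemma tsize_pos: "tsize t > 0"
  by (cases t) simp

lemma length_le_size: "length ts \<le> sum_list (map tsize ts)"
proof (induction ts)
  case (Cons t ts)
  then show ?case using tsize_pos[of t] by simp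
qed simp

lemma trees_of_size_0: "trees_of_size 0 = {}"
  using tsize_pos by (auto simp: trees_of_size_def)

lemma forests_0: "forests 0 n = (if n = 0 then {[]} else {})"
  by (auto simp: forests_def)

lemma forests_Suc:
  "forests (Suc d) n = (\<Union>i\<le>n. (\<lambda>(t, ts). t # ts) ` (trees_of_size i \<times> forests d (n - i)))"
proof (intro equalityI subsetI)
  fix us assume "us \<in> forests (Suc d) n"
  then obtain t ts where "us = t # ts" "length ts = d" "tsize t + sum_list (map tsize ts) = n"
    by (cases us) (auto simp: forests_def)
  then show "us \<in> (\<Union>i\<le>n. (\<lambda>(t, ts). t # ts) ` (trees_of_size i \<times> forests d (n - i)))"
    by (intro UN_I[of "tsize t"] image_eqI[of _ _ "(t, ts)"]) (auto simp: forests_def trees_of_size_def)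
qed (auto simp: forests_def trees_of_size_def)

lemma trees_of_size_Suc: "trees_of_size (Suc n) = Node ` (\<Union>d\<le>n. forests d n)"
proof (intro equalityI subsetI)
  fix t assume "t \<in> trees_of_size (Suc n)"
  then obtain ts where "t = Node ts" "sum_list (map tsize ts) = n"
    by (cases t) (auto simp: trees_of_size_def)
  then show "t \<in> Node ` (\<Union>d\<le>n. forests d n)"
    using length_le_size[of ts] by (auto simp: forests_def)
qed (auto simp: forests_def trees_of_size_def)

lemma finite_forests:
  "(\<And>i. i \<le> n \<Longrightarrow> finite (trees_of_size i)) \<Longrightarrow> finite (forests d n)"
proof (induction d arbitrary: n)
  case (Suc d)
  have "finite (forests d (n - i))" for i by (intro Suc.IH Suc.prems) auto
  then show ?case unfolding forests_Suc using Suc.prems by (intro finite_UN_I finite_imageI finite_cartesian_product) auto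
qed (simp add: forests_0)

lemma finite_trees_of_size: "finite (trees_of_size n)"
proof (induction n rule: less_induct)
  case (less n)
  show ?case
  proof (cases n)
    case (Suc m)
    have "finite (forests d m)" for d by (intro finite_forests less.IH) (simp add: Suc)
    then show ?thesis by (simp add: Suc trees_of_size_Suc)
  qed (simp add: trees_of_size_0)
qed

lemma sum_forests_Suc:
  "(\<Sum>us\<in>forests (Suc d) n. g us) = (\<Sum>i\<le>n. \<Sum>t\<in>trees_of_size i. \<Sum>ts\<in>forests d (n - i). g (t # ts))"
proof -
  have fin: "finite (forests d m)" for m by (intro finite_forests finite_trees_of_size)
  have "(\<Sum>us\<in>forests (Suc d) n. g us) = (\<Sum>i\<le>n. \<Sum>us\<in>(\<lambda>(t, ts). t # ts) ` (trees_of_size i \<times> forests d (n - i)). g us)"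
    unfolding forests_Suc
  proof (rule sum.UNION_disjoint)
    show "\<forall>i\<in>{..n}. finite ((\<lambda>(t, ts). t # ts) ` (trees_of_size i \<times> forests d (n - i)))"
      by (intro ballI finite_imageI finite_cartesian_product finite_trees_of_size fin)
  qed (auto simp: trees_of_size_def)
  also have "\<dots> = (\<Sum>i\<le>n. \<Sum>x\<in>trees_of_size i \<times> forests d (n - i). g (fst x # snd x))"
    by (intro sum.cong refl, subst sum.reindex) (auto simp: inj_on_def intro!: sum.cong)
  also have "\<dots> = (\<Sum>i\<le>n. \<Sum>t\<in>trees_of_size i. \<Sum>ts\<in>forests d (n - i). g (t # ts))"
    by (simp add: sum.cartesian_product split_def)
  finally show ?thesis .
qed

lemma sum_trees_of_size_Suc:
  "(\<Sum>t\<in>trees_of_size (Suc n). g t) = (\<Sum>d\<le>n. \<Sum>ts\<in>forests d n. g (Node ts))"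
proof -
  have fin: "finite (forests d m)" for d m by (intro finite_forests finite_trees_of_size)
  have "(\<Sum>t\<in>trees_of_size (Suc n). g t) = (\<Sum>ts\<in>(\<Union>d\<le>n. forests d n). g (Node ts))"
    unfolding trees_of_size_Suc by (subst sum.reindex) (auto simp: inj_on_def)
  also have "\<dots> = (\<Sum>d\<le>n. \<Sum>ts\<in>forests d n. g (Node ts))"
  proof (rule sum.UNION_disjoint)
    show "\<forall>d\<in>{..n}. finite (forests d n)" by (intro ballI fin)
  qed (auto simp: forests_def)
  finally show ?thesis .
qed

section \<open>Moment series of an additive functional\<close>

fun toll_sum :: "(nat \<Rightarrow> complex) \<Rightarrow> ptree \<Rightarrow> complex" where
  "toll_sum f (Node ts) = f (tsize (Node ts)) + sum_list (map (toll_sum f) ts)"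

text \<open>The bivariate series of \<open>X ^ |T| * exp (u * F(T))\<close>: the outer index is the
  power of \<open>u\<close>, the inner one the power of \<open>X\<close>. Division by
  \<open>fact k\<close> makes the contributions of independent subtrees multiply.\<close>

definition tree_moments :: "nat pmf \<Rightarrow> (nat \<Rightarrow> complex) \<Rightarrow> complex fps fps" where
  "tree_moments p f = Abs_fps (\<lambda>k. Abs_fps (\<lambda>n. \<Sum>t\<in>trees_of_size n. of_real (gw_weight p t) * (toll_sum f t ^ k / fact k)))"

definition pgf :: "nat pmf \<Rightarrow> complex fps" where
  "pgf p = Abs_fps (\<lambda>k. of_real (pmf p k))"

lemma power_add_over_fact:
  fixes a b :: complex
  shows "(a + b) ^ k / fact k = (\<Sum>j\<le>k. (a ^ j / fact j) * (b ^ (k - j) / fact (k - j)))"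
proof -
  have "(a + b) ^ k / fact k = (\<Sum>j\<le>k. of_nat (k choose j) * a ^ j * b ^ (k - j) / fact k)"
    unfolding binomial_ring by (rule sum_divide_distrib)
  also have "\<dots> = (\<Sum>j\<le>k. (a ^ j / fact j) * (b ^ (k - j) / fact (k - j)))"
    by (intro sum.cong refl) (simp add: binomial_fact)
  finally show ?thesis .
qed

lemma fps_fps_mult_nth:
  fixes A B :: "complex fps fps"
  shows "((A * B) $ k) $ n = (\<Sum>j\<le>k. \<Sum>i\<le>n. (A $ j $ i) * (B $ (k - j) $ (n - i)))"
  by (simp add: fps_mult_nth fps_sum_nth atMost_atLeast0)

text \<open>Weights multiply and tolls add over a forest, so the exponential series of a forest is a
  power of that of a tree.\<close>

lemma forest_moments:
  "(\<Sum>ts\<in>forests d n. of_real (prod_list (map (gw_weight p) ts)) * (sum_list (map (toll_sum f) ts) ^ k / fact k))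
     = (tree_moments p f ^ d) $ k $ n"
proof (induction d arbitrary: k n)
  case 0
  then show ?case by (cases k) (auto simp: forests_0)
next
  case (Suc d)
  let ?w = "\<lambda>t. complex_of_real (gw_weight p t)" and ?W = "\<lambda>ts. complex_of_real (prod_list (map (gw_weight p) ts))"
  let ?S = "\<lambda>ts. sum_list (map (toll_sum f) ts)"
  have "(\<Sum>us\<in>forests (Suc d) n. ?W us * (?S us ^ k / fact k))
     = (\<Sum>i\<le>n. \<Sum>t\<in>trees_of_size i. \<Sum>ts\<in>forests d (n - i). ?w t * ?W ts * ((toll_sum f t + ?S ts) ^ k / fact k))"
    unfolding sum_forests_Suc by simp
  also have "\<dots> = (\<Sum>i\<le>n. \<Sum>t\<in>trees_of_size i. \<Sum>ts\<in>forests d (n - i). \<Sum>j\<le>k.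
      (?w t * (toll_sum f t ^ j / fact j)) * (?W ts * (?S ts ^ (k - j) / fact (k - j))))"
    unfolding power_add_over_fact sum_distrib_left by (intro sum.cong refl) (simp only: mult_ac)
  also have "\<dots> = (\<Sum>i\<le>n. \<Sum>t\<in>trees_of_size i. \<Sum>j\<le>k. \<Sum>ts\<in>forests d (n - i).
      (?w t * (toll_sum f t ^ j / fact j)) * (?W ts * (?S ts ^ (k - j) / fact (k - j))))"
    by (intro sum.cong refl sum.swap)
  also have "\<dots> = (\<Sum>i\<le>n. \<Sum>j\<le>k. \<Sum>t\<in>trees_of_size i. \<Sum>ts\<in>forests d (n - i).
      (?w t * (toll_sum f t ^ j / fact j)) * (?W ts * (?S ts ^ (k - j) / fact (k - j))))"
    by (intro sum.cong refl sum.swap)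
  also have "\<dots> = (\<Sum>i\<le>n. \<Sum>j\<le>k. (\<Sum>t\<in>trees_of_size i. ?w t * (toll_sum f t ^ j / fact j))
      * (\<Sum>ts\<in>forests d (n - i). ?W ts * (?S ts ^ (k - j) / fact (k - j))))"
    unfolding sum_product ..
  also have "\<dots> = (\<Sum>i\<le>n. \<Sum>j\<le>k. (tree_moments p f $ j $ i) * ((tree_moments p f ^ d) $ (k - j) $ (n - i)))"
    unfolding Suc.IH by (simp add: tree_moments_def)
  also have "\<dots> = (\<Sum>j\<le>k. \<Sum>i\<le>n. (tree_moments p f $ j $ i) * ((tree_moments p f ^ d) $ (k - j) $ (n - i)))"
    by (rule sum.swap)
  also have "\<dots> = (tree_moments p f ^ Suc d) $ k $ n"
    unfolding power_Suc fps_fps_mult_nth ..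
  finally show ?case .
qed

text \<open>Substitution of the bivariate \<open>G\<close> into \<open>A\<close>. Ordinary
  composition would require \<open>G\<close> to vanish at \<open>u = 0\<close>, where it is the size
  series; convergence comes from the other variable. If \<open>G\<close> has no term free of
  \<open>X\<close>, then \<open>G ^ d\<close> starts at \<open>X ^ d\<close> and the truncation at
  \<open>d \<le> n\<close> is exact.\<close>

definition subst_fps :: "complex fps \<Rightarrow> complex fps fps \<Rightarrow> complex fps fps" where
  "subst_fps A G = Abs_fps (\<lambda>k. Abs_fps (\<lambda>n. \<Sum>d\<le>n. A $ d * ((G ^ d) $ k $ n)))"

definition hadamard :: "(nat \<Rightarrow> complex) \<Rightarrow> complex fps \<Rightarrow> complex fps" where
  "hadamard f a = Abs_fps (\<lambda>n. f n * a $ n)"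

lemma hadamard_nth: "hadamard f a $ n = f n * a $ n"
  by (simp add: hadamard_def)

lemma subst_fps_nth: "subst_fps A G $ k $ n = (\<Sum>d\<le>n. A $ d * ((G ^ d) $ k $ n))"
  by (simp add: subst_fps_def)

text \<open>The toll of the root depends on the total size alone, so \<open>exp (u * f n)\<close>
  acts coefficientwise in \<open>X\<close>; the sum over \<open>j\<close> is its expansion in
  \<open>u\<close>.\<close>

lemma tree_moments_rec:
  "tree_moments p f $ k = (\<Sum>j\<le>k. hadamard (\<lambda>n. f n ^ (k - j) / fact (k - j)) (fps_X * subst_fps (pgf p) (tree_moments p f) $ j))"
proof (rule fps_ext)
  fix n
  let ?G = "tree_moments p f"
  show "tree_moments p f $ k $ n = (\<Sum>j\<le>k. hadamard (\<lambda>n. f n ^ (k - j) / fact (k - j)) (fps_X * subst_fps (pgf p) ?G $ j)) $ n"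
  proof (cases n)
    case 0
    then show ?thesis by (simp add: tree_moments_def trees_of_size_0 fps_sum_nth hadamard_nth)
  next
    case (Suc m)
    let ?W = "\<lambda>ts. complex_of_real (prod_list (map (gw_weight p) ts))"
    let ?S = "\<lambda>ts. sum_list (map (toll_sum f) ts)"
    have "?G $ k $ n = (\<Sum>d\<le>m. \<Sum>ts\<in>forests d m. of_real (pmf p d) * ?W ts * ((?S ts + f n) ^ k / fact k))"
      unfolding tree_moments_def fps_nth_Abs_fps Suc sum_trees_of_size_Suc
      by (intro sum.cong refl) (auto simp: forests_def add.commute)
    also have "\<dots> = (\<Sum>d\<le>m. \<Sum>ts\<in>forests d m. \<Sum>j\<le>k. (f n ^ (k - j) / fact (k - j)) * (of_real (pmf p d) * (?W ts * (?S ts ^ j / fact j))))"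
      unfolding power_add_over_fact sum_distrib_left by (intro sum.cong refl) (simp only: mult_ac)
    also have "\<dots> = (\<Sum>d\<le>m. \<Sum>j\<le>k. \<Sum>ts\<in>forests d m. (f n ^ (k - j) / fact (k - j)) * (of_real (pmf p d) * (?W ts * (?S ts ^ j / fact j))))"
      by (intro sum.cong refl sum.swap)
    also have "\<dots> = (\<Sum>j\<le>k. \<Sum>d\<le>m. \<Sum>ts\<in>forests d m. (f n ^ (k - j) / fact (k - j)) * (of_real (pmf p d) * (?W ts * (?S ts ^ j / fact j))))"
      by (rule sum.swap)
    also have "\<dots> = (\<Sum>j\<le>k. (f n ^ (k - j) / fact (k - j)) * (\<Sum>d\<le>m. of_real (pmf p d) * ((?G ^ d) $ j $ m)))"
      unfolding forest_moments[symmetric] sum_distrib_left ..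
    also have "\<dots> = (\<Sum>j\<le>k. hadamard (\<lambda>n. f n ^ (k - j) / fact (k - j)) (fps_X * subst_fps (pgf p) ?G $ j)) $ n"
      by (simp add: Suc fps_sum_nth hadamard_nth subst_fps_nth pgf_def)
    finally show ?thesis .
  qed
qed

lemma tree_moments_nth_0: "tree_moments p f $ k $ 0 = 0"
  by (simp add: tree_moments_def trees_of_size_0)

lemma low_mult:
  fixes A B :: "complex fps fps"
  assumes "\<And>k n. n < d \<Longrightarrow> A $ k $ n = 0" "\<And>k. B $ k $ 0 = 0" "n < Suc d"
  shows "(A * B) $ k $ n = 0"
  unfolding fps_fps_mult_nth
proof (intro sum.neutral ballI)
  fix j i assume "j \<in> {..k}" "i \<in> {..n}"
  show "(A $ j $ i) * (B $ (k - j) $ (n - i)) = 0"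
  proof (cases "i < d")
    case False
    then have "n - i = 0" using assms(3) by auto
    then show ?thesis using assms(2) by simp
  qed (simp add: assms(1))
qed

lemma low_power:
  fixes G :: "complex fps fps"
  assumes "\<And>k. G $ k $ 0 = 0" "n < d"
  shows "(G ^ d) $ k $ n = 0"
  using assms(2)
proof (induction d arbitrary: n k)
  case (Suc d)
  show ?case unfolding power_Suc2 by (rule low_mult[OF Suc.IH assms(1) Suc.prems])
qed simp

text \<open>The truncations at different \<open>i \<le> n\<close> may all be raised to
  \<open>n\<close>, because the added terms vanish by order counting in \<open>X\<close>; then the
  sums can be exchanged.\<close>

lemma subst_fps_mult_nth:
  assumes "\<And>k. G $ k $ 0 = 0"
  shows "(subst_fps A G * Q) $ k $ n = (\<Sum>d\<le>n. A $ d * ((G ^ d * Q) $ k $ n))"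
proof -
  have ext: "(\<Sum>d\<le>i. A $ d * ((G ^ d) $ j $ i)) = (\<Sum>d\<le>n. A $ d * ((G ^ d) $ j $ i))" if "i \<le> n" for i j
    using that by (intro sum.mono_neutral_left) (auto simp: low_power[OF assms])
  have "(subst_fps A G * Q) $ k $ n = (\<Sum>j\<le>k. \<Sum>i\<le>n. \<Sum>d\<le>n. A $ d * ((G ^ d $ j $ i) * (Q $ (k - j) $ (n - i))))"
    unfolding fps_fps_mult_nth subst_fps_nth
    by (intro sum.cong refl) (simp add: ext sum_distrib_right mult.assoc)
  also have "\<dots> = (\<Sum>j\<le>k. \<Sum>d\<le>n. \<Sum>i\<le>n. A $ d * ((G ^ d $ j $ i) * (Q $ (k - j) $ (n - i))))"
    by (intro sum.cong refl sum.swap)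
  also have "\<dots> = (\<Sum>d\<le>n. \<Sum>j\<le>k. \<Sum>i\<le>n. A $ d * ((G ^ d $ j $ i) * (Q $ (k - j) $ (n - i))))"
    by (rule sum.swap)
  also have "\<dots> = (\<Sum>d\<le>n. A $ d * ((G ^ d * Q) $ k $ n))"
    unfolding fps_fps_mult_nth sum_distrib_left ..
  finally show ?thesis .
qed

lemma of_nat_fps_mult_nth:
  fixes a :: "complex fps"
  shows "(of_nat m * a) $ n = of_nat m * a $ n"
  by (simp flip: fps_of_nat)

lemma of_nat_fps_fps_mult_nth:
  fixes A :: "complex fps fps"
  shows "(of_nat m * A) $ k $ n = of_nat m * (A $ k $ n)"
proof -
  have "(of_nat m * A) $ k = of_nat m * A $ k" by (simp flip: fps_of_nat)
  then show ?thesis by (simp add: of_nat_fps_mult_nth)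
qed

lemma fps_deriv_nth_nth:
  fixes A :: "complex fps fps"
  shows "fps_deriv A $ k $ n = of_nat (Suc k) * (A $ Suc k $ n)"
  by (simp add: of_nat_fps_mult_nth del: of_nat_Suc)

text \<open>The chain rule in \<open>u\<close>. It expresses the coefficients of
  \<open>\<Phi>(G)\<close> through those of \<open>\<Phi>'(G)\<close> and \<open>G\<close>, from
  which the moment recursion is obtained.\<close>

lemma subst_fps_deriv:
  assumes "\<And>k. G $ k $ 0 = 0"
  shows "fps_deriv (subst_fps A G) = subst_fps (fps_deriv A) G * fps_deriv G"
proof (intro fps_ext)
  fix k n
  have dG: "fps_deriv G $ k $ 0 = 0" for k unfolding fps_deriv_nth_nth by (simp add: assms)
  let ?g = "\<lambda>d. A $ d * (fps_deriv (G ^ d) $ k $ n)"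
  have "fps_deriv (subst_fps A G) $ k $ n = (\<Sum>d\<le>n. ?g d)"
    unfolding fps_deriv_nth_nth subst_fps_nth sum_distrib_left by (simp only: mult_ac)
  also have "\<dots> = ?g 0 + (\<Sum>d<n. ?g (Suc d))"
    unfolding lessThan_Suc_atMost[symmetric] by (rule sum.lessThan_Suc_shift)
  also have "?g 0 = 0" by simp
  also have "(\<Sum>d<n. ?g (Suc d)) = (\<Sum>d<n. fps_deriv A $ d * ((G ^ d * fps_deriv G) $ k $ n))"
  proof (intro sum.cong refl)
    fix d
    have "fps_deriv (G ^ Suc d) = of_nat (Suc d) * (G ^ d * fps_deriv G)"
      by (simp only: fps_deriv_power' diff_Suc_1 mult_ac)
    then have "fps_deriv (G ^ Suc d) $ k $ n = of_nat (Suc d) * ((G ^ d * fps_deriv G) $ k $ n)"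
      by (simp only: of_nat_fps_fps_mult_nth)
    then show "?g (Suc d) = fps_deriv A $ d * ((G ^ d * fps_deriv G) $ k $ n)"
      by (simp only: fps_deriv_nth Suc_eq_plus1 mult_ac)
  qed
  \<comment> \<open>The shifted sum ends one term early; the missing one vanishes because
    \<open>G ^ n * fps_deriv G\<close> has order at least \<open>n + 1\<close> in
    \<open>X\<close>.\<close>
  also have "\<dots> = (\<Sum>d\<le>n. fps_deriv A $ d * ((G ^ d * fps_deriv G) $ k $ n))"
  proof -
    have "(G ^ n * fps_deriv G) $ k $ n = 0"
      by (rule low_mult[of n]) (auto simp: low_power[OF assms] dG simp del: fps_deriv_nth)
    then show ?thesis unfolding lessThan_Suc_atMost[symmetric] sum.lessThan_Suc by simp
  qed
  also have "\<dots> = (subst_fps (fps_deriv A) G * fps_deriv G) $ k $ n"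
    by (rule subst_fps_mult_nth[OF assms, symmetric])
  finally show "fps_deriv (subst_fps A G) $ k $ n = (subst_fps (fps_deriv A) G * fps_deriv G) $ k $ n" by simp
qed

lemma power_nth_0:
  fixes G :: "complex fps fps"
  shows "(G ^ d) $ 0 = (G $ 0) ^ d"
  by (induction d) (auto simp: fps_mult_nth_0)

lemma subst_fps_nth_0: "subst_fps A G $ 0 = A oo (G $ 0)"
  by (rule fps_ext) (simp add: subst_fps_nth fps_compose_nth power_nth_0 atMost_atLeast0)

section \<open>Lagrange inversion\<close>

text \<open>Uniqueness of leading coefficients: a nonzero multiple of \<open>b\<close> cannot be
  polynomially smaller than \<open>b\<close>. The instances below are for the exponents 1/2, 1 and
  3/2, at which expansions are compared later.\<close>

lemma decay_eq_0:
  assumes "fps_const a * b \<in> decay \<theta>" "\<theta> < \<tau>" "c > 0"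
    and low: "\<And>n. n \<ge> N \<Longrightarrow> c * real n powr \<tau> \<le> cmod (b $ n)"
  shows "a = 0"
proof -
  obtain C where C: "C > 0" "\<And>n. cmod ((fps_const a * b) $ n) \<le> C * real (Suc n) powr \<theta>"
    using assms(1) by (rule decayE) blast
  have le: "cmod a * c \<le> C * 2 powr \<bar>\<theta>\<bar> * real n powr (\<theta> - \<tau>)" if n: "n \<ge> max N 1" for n
  proof -
    have "real (Suc n) powr \<theta> \<le> 2 powr \<bar>\<theta>\<bar> * real n powr \<theta>"
      by (rule powr_Suc_le) (use n in simp)
    then have "cmod ((fps_const a * b) $ n) \<le> C * (2 powr \<bar>\<theta>\<bar> * real n powr \<theta>)"
      using C by (meson order_trans mult_left_mono less_imp_le)
    moreover have "cmod a * (c * real n powr \<tau>) \<le> cmod ((fps_const a * b) $ n)"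
      using low[of n] n by (simp add: norm_mult mult_left_mono)
    ultimately have "cmod a * (c * real n powr \<tau>) * real n powr (-\<tau>) \<le> C * (2 powr \<bar>\<theta>\<bar> * real n powr \<theta>) * real n powr (-\<tau>)"
      by (intro mult_right_mono) auto
    moreover have "real n powr \<tau> * real n powr (-\<tau>) = 1" using n by (simp flip: powr_add)
    moreover have "real n powr \<theta> * real n powr (-\<tau>) = real n powr (\<theta> - \<tau>)" by (simp flip: powr_add)
    ultimately show ?thesis by (simp add: mult.assoc)
  qed
  have "((\<lambda>n. real n powr (\<theta> - \<tau>)) \<longlongrightarrow> 0) sequentially"
    using assms(2) by (intro tendsto_neg_powr filterlim_real_sequentially) auto
  then have "(\<lambda>n. C * 2 powr \<bar>\<theta>\<bar> * real n powr (\<theta> - \<tau>)) \<longlonglongrightarrow> C * 2 powr \<bar>\<theta>\<bar> * 0"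
    by (intro tendsto_mult tendsto_const)
  then have "cmod a * c \<le> C * 2 powr \<bar>\<theta>\<bar> * 0"
    by (rule LIMSEQ_le_const) (use le in blast)
  then show ?thesis using assms(3) by (simp add: mult_le_0_iff)
qed

lemma half_binom_lower: "\<exists>c>0. \<forall>n\<ge>2. c * real n powr (-1/2) \<le> half_binom n"
proof -
  obtain L where L: "L > 0" "\<And>n. n > 0 \<Longrightarrow> \<bar>half_binom n - L * real n powr (-1/2)\<bar> \<le> L * real n powr (-3/2)"
    using half_binom_asymp by blast
  have "L / 2 * real n powr (-1/2) \<le> half_binom n" if n: "n \<ge> 2" for n
  proof -
    have "real n powr (-3/2) = real n powr (-1/2) * real n powr (-1)" by (subst powr_add[symmetric]) simp
    also have "real n powr (-1) \<le> 1/2" using n by (simp add: powr_minus_divide divide_le_eq)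
    finally have "real n powr (-3/2) \<le> real n powr (-1/2) * (1/2)" by (simp add: mult_left_mono)
    then have "L * real n powr (-3/2) \<le> L * (real n powr (-1/2) * (1/2))" using L by (intro mult_left_mono) auto
    then show ?thesis using L(2)[of n] n by (simp add: abs_le_iff)
  qed
  then show ?thesis using L by (intro exI[of _ "L / 2"]) auto
qed

lemma inv_pow_half_eq_0:
  assumes "fps_const a * inv_pow (1/2) \<in> decay \<theta>" "\<theta> < -1/2"
  shows "a = 0"
proof -
  obtain c where c: "c > 0" "\<And>n. n \<ge> 2 \<Longrightarrow> c * real n powr (-1/2) \<le> half_binom n"
    using half_binom_lower by auto
  show ?thesis
  proof (rule decay_eq_0[OF assms c(1), of 2])
    fix n :: nat assume "n \<ge> 2"
    then show "c * real n powr (-1/2) \<le> cmod (inv_pow (1/2) $ n)"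
      unfolding inv_pow_nth norm_of_real using c(2)[of n] by linarith
  qed
qed

lemma inv_pow_one_eq_0:
  assumes "fps_const a * inv_pow 1 \<in> decay \<theta>" "\<theta> < 0"
  shows "a = 0"
  by (rule decay_eq_0[OF assms, of 1 1]) (auto simp: inv_pow_1_nth)

lemma inv_pow_three_half_eq_0:
  assumes "fps_const a * inv_pow (3/2) \<in> decay \<theta>" "\<theta> < 1/2"
  shows "a = 0"
proof -
  obtain c where c: "c > 0" "\<And>n. n \<ge> 2 \<Longrightarrow> c * real n powr (-1/2) \<le> half_binom n"
    using half_binom_lower by auto
  show ?thesis
  proof (rule decay_eq_0[OF assms c(1), of 2])
    fix n :: nat assume n: "n \<ge> 2"
    have "pochhammer (3/2::real) n = pochhammer (1/2) n * (1/2 + real n) / (1/2)"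
      using pochhammer_shift[of "1/2" n] by simp
    then have e: "pochhammer (3/2::real) n / fact n = half_binom n * (2 * real n + 1)"
      by (simp add: field_simps)
    have "real n powr (1/2) = real n powr (-1/2) * real n powr 1" by (subst powr_add[symmetric]) simp
    then have "c * real n powr (1/2) = c * real n powr (-1/2) * real n" by simp
    also have "\<dots> \<le> half_binom n * (2 * real n + 1)"
      using n by (intro mult_mono c less_imp_le[OF half_binom_pos]) auto
    finally show "c * real n powr (1/2) \<le> cmod (inv_pow (3/2) $ n)"
      unfolding inv_pow_nth norm_of_real e by linarith
  qed
qed

lemma fps_compose_mult_nth:
  fixes A y Z :: "complex fps"
  assumes "y $ 0 = 0"
  shows "((A oo y) * Z) $ n = (\<Sum>d\<le>n. A $ d * ((y ^ d * Z) $ n))"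
proof -
  have ext: "(A oo y) $ i = (\<Sum>d\<le>n. A $ d * ((y ^ d) $ i))" if "i \<le> n" for i
    unfolding fps_compose_nth atMost_atLeast0[symmetric] using that startsby_zero_power_prefix[OF assms]
    by (intro sum.mono_neutral_left) auto
  have "((A oo y) * Z) $ n = (\<Sum>i\<le>n. \<Sum>d\<le>n. A $ d * ((y ^ d $ i) * (Z $ (n - i))))"
    unfolding fps_mult_nth atMost_atLeast0[symmetric]
    by (intro sum.cong refl) (simp add: ext sum_distrib_right mult.assoc)
  also have "\<dots> = (\<Sum>d\<le>n. \<Sum>i\<le>n. A $ d * ((y ^ d $ i) * (Z $ (n - i))))"
    by (rule sum.swap)
  also have "\<dots> = (\<Sum>d\<le>n. A $ d * ((y ^ d * Z) $ n))"
    unfolding fps_mult_nth sum_distrib_left atMost_atLeast0[symmetric] ..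
  finally show ?thesis .
qed

text \<open>Used in place of the derivative because it multiplies the coefficient of index
  \<open>n\<close> by \<open>n\<close> without shifting it.\<close>

definition euler :: "complex fps \<Rightarrow> complex fps" where
  "euler a = fps_X * fps_deriv a"

lemma euler_nth: "euler a $ n = of_nat n * a $ n"
  by (cases n) (auto simp: euler_def)

lemma euler_mult: "euler (a * b) = euler a * b + a * euler b"
  by (simp add: euler_def algebra_simps)

lemma decay_euler:
  assumes "a \<in> decay \<theta>"
  shows "euler a \<in> decay (\<theta> + 1)"
proof -
  have "Abs_fps (\<lambda>n. of_nat n * a $ n) \<in> decay (\<theta> + 1)"
    by (rule decay_hadamard[OF assms, of _ 1]) simp
  moreover have "Abs_fps (\<lambda>n. of_nat n * a $ n) = euler a"
    by (rule fps_ext) (simp add: euler_nth)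
  ultimately show ?thesis by simp
qed

section \<open>The size series and its companion \<open>V\<close>\<close>

context offspring
begin

definition y :: "complex fps" where "y = Abs_fps (\<lambda>n. of_real (gw_size_prob p n))"

lemma \<Phi>_pgf: "\<Phi> = pgf p" by (simp add: \<Phi>_def pgf_def)

lemma tree_moments_0: "tree_moments p f $ 0 = y"
  by (rule fps_ext) (simp add: tree_moments_def y_def gw_size_prob_def)

lemma y_0: "y $ 0 = 0"
  using tree_moments_nth_0[of p "\<lambda>_. 0" 0] by (simp add: tree_moments_0)

lemma y_eq: "y = fps_X * (\<Phi> oo y)"
proof -
  have "y = hadamard (\<lambda>n. (\<lambda>_. 0) n ^ (0 - 0) / fact (0 - 0)) (fps_X * subst_fps \<Phi> (tree_moments p (\<lambda>_. 0)) $ 0)"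
    using tree_moments_rec[of p "\<lambda>_. 0" 0] by (simp add: tree_moments_0 \<Phi>_pgf)
  also have "\<dots> = fps_X * subst_fps \<Phi> (tree_moments p (\<lambda>_. 0)) $ 0"
    by (rule fps_ext) (simp add: hadamard_nth)
  finally show ?thesis by (simp only: subst_fps_nth_0 tree_moments_0)
qed

definition V :: "complex fps" where "V = Abs_fps (\<lambda>n. (\<Phi> ^ n) $ n)"

text \<open>Lagrange inversion: both sides satisfy \<open>a (m + 1) = X * (\<Sum>d. \<Phi> $ d * a (m + d))\<close>,
  which determines all \<open>a m\<close> from \<open>a 0\<close>.\<close>
lemma y_power_V_nth: "(y ^ m * V) $ n = (if m \<le> n then (\<Phi> ^ n) $ (n - m) else 0)"
proof (induction n arbitrary: m)
  case 0
  then show ?case by (cases m) (auto simp: V_def y_0 fps_mult_nth_0)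
next
  case (Suc n)
  show ?case
  proof (cases m)
    case 0
    then show ?thesis by (simp add: V_def)
  next
    case (Suc k)
    have "y ^ m * V = fps_X * ((\<Phi> oo y) * (y ^ k * V))"
      using Suc y_eq by (metis mult.assoc power_Suc)
    then have "(y ^ m * V) $ Suc n = ((\<Phi> oo y) * (y ^ k * V)) $ n"
      by (simp only: fps_X_mult_nth nat.simps if_False diff_Suc_1)
    also have "\<dots> = (\<Sum>d\<le>n. \<Phi> $ d * ((y ^ (d + k) * V) $ n))"
      unfolding fps_compose_mult_nth[OF y_0] by (simp add: power_add mult.assoc)
    also have "\<dots> = (\<Sum>d\<le>n. \<Phi> $ d * (if d + k \<le> n then (\<Phi> ^ n) $ (n - (d + k)) else 0))"
      by (simp only: Suc.IH)
    also have "\<dots> = (if m \<le> Suc n then (\<Phi> ^ Suc n) $ (Suc n - m) else 0)"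
    proof (cases "k \<le> n")
      case True
      have "(\<Sum>d\<le>n. \<Phi> $ d * (if d + k \<le> n then (\<Phi> ^ n) $ (n - (d + k)) else 0))
          = (\<Sum>d\<le>n - k. \<Phi> $ d * (\<Phi> ^ n) $ (n - k - d))"
        using True by (intro sum.mono_neutral_cong_right) (auto simp: add.commute)
      then show ?thesis using True Suc by (simp add: fps_mult_nth atMost_atLeast0)
    qed (use Suc in auto)
    finally show ?thesis .
  qed
qed

lemma V_eq: "V = 1 + fps_X * (fps_deriv \<Phi> oo y) * V"
proof (rule fps_ext)
  fix n show "V $ n = (1 + fps_X * (fps_deriv \<Phi> oo y) * V) $ n"
  proof (cases n)
    case (Suc m)
    have "((fps_deriv \<Phi> oo y) * V) $ m = (\<Sum>d\<le>m. fps_deriv \<Phi> $ d * (\<Phi> ^ m) $ (m - d))"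
      unfolding fps_compose_mult_nth[OF y_0] y_power_V_nth by (intro sum.cong) auto
    also have "\<dots> = (fps_deriv \<Phi> * \<Phi> ^ m) $ m"
      by (simp add: fps_mult_nth atMost_atLeast0)
    finally have 1: "(fps_X * (fps_deriv \<Phi> oo y) * V) $ n = (fps_deriv \<Phi> * \<Phi> ^ m) $ m"
      by (simp add: Suc mult.assoc)
    \<comment> \<open>The coefficient of \<open>X ^ m\<close> in the derivative of
      \<open>\<Phi> ^ Suc m\<close> is computed in two ways, and the common factor
      \<open>Suc m\<close> cancels.\<close>
    have "fps_deriv (\<Phi> ^ Suc m) $ m = (of_nat (Suc m) * (fps_deriv \<Phi> * \<Phi> ^ m)) $ m"
      by (simp only: fps_deriv_power' diff_Suc_1 mult.assoc)
    then have "of_nat (Suc m) * (\<Phi> ^ Suc m) $ Suc m = of_nat (Suc m) * (fps_deriv \<Phi> * \<Phi> ^ m) $ m"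
      by (simp only: of_nat_fps_mult_nth fps_deriv_nth Suc_eq_plus1)
    then have "(\<Phi> ^ Suc m) $ Suc m = (fps_deriv \<Phi> * \<Phi> ^ m) $ m"
      by (simp only: mult_cancel_left of_nat_eq_0_iff nat.simps) simp
    with 1 show ?thesis by (simp add: Suc V_def)
  qed (simp add: V_def)
qed

text \<open>Differentiating \<open>y = X * \<Phi>(y)\<close> gives a linear equation for
  \<open>euler y\<close>, and \<open>V\<close> is the inverse of its coefficient
  \<open>1 - X * \<Phi>'(y)\<close>.\<close>

lemma euler_y: "euler y = y * V"
proof -
  let ?P = "fps_deriv \<Phi> oo y"
  have "fps_deriv y = (\<Phi> oo y) + fps_X * (?P * fps_deriv y)"
    by (subst (1) y_eq) (simp add: fps_compose_deriv[OF y_0])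
  then have e: "euler y = y + fps_X * ?P * euler y"
    using y_eq unfolding euler_def by (metis distrib_left mult.assoc mult.left_commute)
  have 2: "V - fps_X * ?P * V = 1" using V_eq by (simp add: algebra_simps)
  have "euler y = euler y * (V - fps_X * ?P * V)" by (simp add: 2)
  also have "\<dots> = V * (euler y - fps_X * ?P * euler y)" by (simp add: algebra_simps)
  also have "euler y - fps_X * ?P * euler y = y" using e by (simp add: algebra_simps)
  finally show ?thesis by (simp add: mult.commute)
qed

text \<open>Obtained like \<open>euler_y\<close> by differentiating the equation of
  \<open>V\<close>. The two constants of the moment recursion will be read off from this exact
  identity.\<close>

lemma euler_V: "euler V = V\<^sup>2 - V + fps_X * (fps_deriv (fps_deriv \<Phi>) oo y) * y * V ^ 3"
proof -
  let ?P = "fps_deriv \<Phi> oo y" and ?Q = "fps_deriv (fps_deriv \<Phi>) oo y"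
  have eP: "euler ?P = ?Q * (y * V)"
    unfolding euler_y[symmetric] by (simp add: euler_def fps_compose_deriv[OF y_0] mult_ac)
  have eX: "euler fps_X = fps_X" by (simp add: euler_def)
  have "euler V = euler (1 + fps_X * ?P * V)" using V_eq by simp
  also have "\<dots> = euler 1 + euler (fps_X * ?P * V)" by (simp add: euler_def algebra_simps)
  also have "\<dots> = fps_X * ?P * V + fps_X * ?Q * y * V\<^sup>2 + fps_X * ?P * euler V"
    by (simp add: euler_mult eP eX euler_def[of 1] algebra_simps power2_eq_square)
  finally have 1: "euler V - fps_X * ?P * euler V = fps_X * ?P * V + fps_X * ?Q * y * V\<^sup>2"
    by (simp add: algebra_simps)
  have 2: "V - fps_X * ?P * V = 1" using V_eq by (simp add: algebra_simps)
  have "euler V = euler V * (V - fps_X * ?P * V)" by (simp add: 2)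
  also have "\<dots> = V * (euler V - fps_X * ?P * euler V)" by (simp add: algebra_simps)
  also have "\<dots> = V * (fps_X * ?P * V) + fps_X * ?Q * y * V ^ 3"
    unfolding 1 by (simp add: algebra_simps power2_eq_square power3_eq_cube)
  also have "fps_X * ?P * V = V - 1" using 2 by (simp add: algebra_simps)
  finally show ?thesis by (simp add: algebra_simps power2_eq_square)
qed

text \<open>The constant in front of \<open>(1 - X) powr (-1/2)\<close> in \<open>V\<close>; its
  existence is part of the lemma named \<open>c0\<close>. Classically it equals
  \<open>1 / (\<sigma> * sqrt 2)\<close>.\<close>

definition c0 :: real where
  "c0 = (SOME c. c > 0 \<and> V - fps_const (of_real c) * inv_pow (1/2) \<in> decay (-1/2 - \<delta>/2))"

lemma decay_from_real_n:
  assumes "\<And>n. n > 0 \<Longrightarrow> cmod (a $ n) \<le> C * real n powr t" "C \<ge> 0"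
  shows "a \<in> decay t"
proof (rule decay_finite[of 1])
  fix n :: nat assume n: "n \<ge> 1"
  have "cmod (a $ n) \<le> C * real n powr t" using assms n by auto
  also have "\<dots> \<le> C * (2 powr \<bar>t\<bar> * real (Suc n) powr t)"
    using n assms by (intro mult_left_mono powr_le_Suc_powr) auto
  finally show "cmod (a $ n) \<le> C * 2 powr \<bar>t\<bar> * real (Suc n) powr t" by (simp only: mult.assoc)
qed

lemma c0: "c0 > 0" "V - fps_const (of_real c0) * inv_pow (1/2) \<in> decay (-1/2 - \<delta>/2)"
proof -
  obtain a C where a: "a > 0" "C > 0" "\<And>n. n > 0 \<Longrightarrow> cmod ((\<Phi> ^ n) $ n - of_real (a * real n powr (-1/2))) \<le> C * real n powr (-1/2 - \<delta>/2)"
    using llt_rate by auto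
  obtain L where L: "L > 0" "\<And>n. n > 0 \<Longrightarrow> \<bar>half_binom n - L * real n powr (-1/2)\<bar> \<le> L * real n powr (-3/2)"
    using half_binom_asymp by blast
  \<comment> \<open>\<open>a\<close> belongs to the local limit theorem and \<open>L\<close> to
    \<open>half_binom\<close>; their quotient passes from powers of \<open>n\<close> to coefficients
    of \<open>inv_pow (1/2)\<close>.\<close>
  have "V - fps_const (of_real (a / L)) * inv_pow (1/2) \<in> decay (-1/2 - \<delta>/2)"
  proof (rule decay_from_real_n)
    fix n :: nat assume n: "n > 0"
    have "(V - fps_const (of_real (a / L)) * inv_pow (1/2)) $ n
       = ((\<Phi> ^ n) $ n - of_real (a * real n powr (-1/2))) - of_real (a / L * (half_binom n - L * real n powr (-1/2)))"
      using L by (simp add: V_def inv_pow_nth right_diff_distrib)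
    also have "cmod \<dots> \<le> C * real n powr (-1/2 - \<delta>/2) + cmod (of_real (a / L * (half_binom n - L * real n powr (-1/2))))"
      by (rule order_trans[OF norm_triangle_ineq4 add_right_mono[OF a(3)[OF n]]])
    also have "cmod (of_real (a / L * (half_binom n - L * real n powr (-1/2)))) = a / L * \<bar>half_binom n - L * real n powr (-1/2)\<bar>"
      using a L by (simp only: norm_of_real abs_mult) simp
    also have "\<dots> \<le> a / L * (L * real n powr (-3/2))" using a L n by (intro mult_left_mono L) auto
    also have "\<dots> = a * real n powr (-3/2)" using L by simp
    also have "\<dots> \<le> a * real n powr (-1/2 - \<delta>/2)" using a n delta by (intro mult_left_mono powr_mono) auto
    finally show "cmod ((V - fps_const (of_real (a / L)) * inv_pow (1/2)) $ n) \<le> (C + a) * real n powr (-1/2 - \<delta>/2)"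
      by (simp add: distrib_right)
  qed (use a in auto)
  then have "\<exists>c. c > 0 \<and> V - fps_const (of_real c) * inv_pow (1/2) \<in> decay (-1/2 - \<delta>/2)"
    using a L by (intro exI[of _ "a / L"]) auto
  from someI_ex[OF this] show "c0 > 0" "V - fps_const (of_real c0) * inv_pow (1/2) \<in> decay (-1/2 - \<delta>/2)"
    unfolding c0_def by auto
qed

lemma V_decay: "V \<in> decay (-1/2)"
proof -
  have "V - fps_const (of_real c0) * inv_pow (1/2) \<in> decay (-1/2)"
    using c0(2) delta by (rule_tac decay_mono) auto
  from decay_add[OF this decay_const_mult[OF inv_pow_half_decay, of "of_real c0"]] show ?thesis by simp
qed

lemma V_diff_decay: "(1 - fps_X) * V \<in> decay (-3/2)"
proof -
  obtain C where C: "C > 0" "\<And>n. n > 0 \<Longrightarrow> cmod ((\<Phi> ^ Suc n) $ Suc n - (\<Phi> ^ n) $ n) \<le> C * real n powr (-3/2)"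
    using llt_diff by auto
  show ?thesis
  proof (rule decay_finite[of 2])
    fix n :: nat assume n: "n \<ge> 2"
    then obtain m where m: "n = Suc m" "m > 0" by (cases n) auto
    have "cmod (((1 - fps_X) * V) $ n) = cmod ((\<Phi> ^ Suc m) $ Suc m - (\<Phi> ^ m) $ m)"
      by (simp add: m left_diff_distrib V_def)
    also have "\<dots> \<le> C * real m powr (-3/2)" using C m by auto
    also have "\<dots> \<le> C * (2 powr \<bar>-3/2\<bar> * real (Suc m) powr (-3/2))"
      using m C by (intro mult_left_mono powr_le_Suc_powr) auto
    also have "\<dots> \<le> C * (2 powr \<bar>-3/2\<bar> * (2 powr \<bar>-3/2\<bar> * real (Suc (Suc m)) powr (-3/2)))"
      using m C by (intro mult_left_mono powr_le_Suc_powr) auto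
    finally show "cmod (((1 - fps_X) * V) $ n) \<le> C * (2 powr \<bar>-3/2\<bar> * 2 powr \<bar>-3/2\<bar>) * real (Suc n) powr (-3/2)"
      by (simp only: m mult.assoc)
  qed
qed

lemma yV_nth: "n > 0 \<Longrightarrow> (y * V) $ n = (\<Phi> ^ n) $ (n - 1)"
  using y_power_V_nth[of 1 n] by simp

text \<open>The product \<open>(1 - y) * V\<close>, in which the square-root zero of
  \<open>1 - y\<close> at 1 cancels the singularity of \<open>V\<close>. Its summability replaces an
  expansion of \<open>1 - y\<close>.\<close>

definition Y :: "complex fps" where "Y = V - y * V"

lemma Y_decay: "Y \<in> decay (-1 - \<delta>/2)"
proof -
  obtain C where C: "C > 0" "\<And>n. n > 0 \<Longrightarrow> cmod ((\<Phi> ^ n) $ n - (\<Phi> ^ n) $ (n - 1)) \<le> C * real n powr (-1 - \<delta>/2)"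
    using llt_neighbour by auto
  show ?thesis
  proof (rule decay_from_real_n)
    fix n :: nat assume n: "n > 0"
    then show "cmod (Y $ n) \<le> C * real n powr (-1 - \<delta>/2)"
      using C(2)[OF n] yV_nth[OF n] by (simp add: Y_def V_def)
  qed (use C in auto)
qed

text \<open>The Otter-Dwass formula for the total progeny, here the coefficient form of
  \<open>euler_y\<close>.\<close>

lemma y_nth: "n > 0 \<Longrightarrow> y $ n = (\<Phi> ^ n) $ (n - 1) / of_nat n"
  using euler_nth[of y n] yV_nth[of n] by (simp add: euler_y field_simps)

lemma y_decay: "y \<in> decay (-3/2)"
proof -
  obtain C where C: "C > 0" "\<And>n m. n > 0 \<Longrightarrow> cmod ((\<Phi> ^ n) $ m) \<le> C * real n powr (-1/2)"
    using llt_uniform by auto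
  show ?thesis
  proof (rule decay_from_real_n)
    fix n :: nat assume n: "n > 0"
    have "cmod (y $ n) = cmod ((\<Phi> ^ n) $ (n - 1)) * real n powr (-1)"
      using n by (simp add: y_nth norm_divide powr_minus_divide)
    also have "\<dots> \<le> C * real n powr (-1/2) * real n powr (-1)"
      using C n by (intro mult_right_mono) auto
    also have "\<dots> = C * real n powr (-3/2)"
      unfolding mult.assoc by (subst powr_add[symmetric]) simp
    finally show "cmod (y $ n) \<le> C * real n powr (-3/2)" .
  qed (use C in auto)
qed

text \<open>Two evaluations of \<open>y * V\<close>: to leading order it is
  \<open>mass y * V\<close>, since \<open>y\<close> is summable, and also \<open>V\<close>, since
  \<open>Y\<close> is negligible. Thus the tree is finite almost surely.\<close>

lemma mass_y: "mass y = 1"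
proof -
  have "y * V - fps_const (mass y) * V \<in> decay (-1/2 - 1/2)"
    using y_decay V_decay V_diff_decay by (intro decay_mult_mass) auto
  moreover have "Y \<in> decay (-1/2 - 1/2)" using Y_decay delta by (rule_tac decay_mono) auto
  ultimately have "y * V - fps_const (mass y) * V + Y \<in> decay (-1/2 - 1/2)" by (rule decay_add)
  moreover have "y * V - fps_const (mass y) * V + Y = fps_const (1 - mass y) * V"
    by (simp add: Y_def left_diff_distrib flip: fps_const_sub)
  ultimately have "fps_const (1 - mass y) * V \<in> decay (-1/2 - 1/2)" by simp
  then have 1: "fps_const (1 - mass y) * V \<in> decay (-1/2 - \<delta>/2)" using delta by (rule_tac decay_mono) auto
  have "fps_const (1 - mass y) * (V - fps_const (of_real c0) * inv_pow (1/2)) \<in> decay (-1/2 - \<delta>/2)"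
    by (intro decay_const_mult c0)
  from decay_diff[OF 1 this] have "fps_const ((1 - mass y) * of_real c0) * inv_pow (1/2) \<in> decay (-1/2 - \<delta>/2)"
    by (simp add: right_diff_distrib mult.assoc flip: fps_const_mult)
  then have "(1 - mass y) * of_real c0 = 0" by (rule inv_pow_half_eq_0) (use delta in auto)
  then show ?thesis using c0(1) by simp
qed

end

section \<open>Derivatives of the offspring series along the size series\<close>

text \<open>A submultiplicative majorant of the coefficients up to \<open>n\<close>; for
  \<open>y\<close> it is the probability of at most \<open>n\<close> vertices.\<close>

definition psum :: "complex fps \<Rightarrow> nat \<Rightarrow> real" where
  "psum a n = (\<Sum>i\<le>n. cmod (a $ i))"

lemma psum_nonneg: "psum a n \<ge> 0"
  by (simp add: psum_def sum_nonneg)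

lemma psum_mult: "psum (a * b) n \<le> psum a n * psum b n"
proof -
  let ?f = "\<lambda>i j. cmod (a $ i) * cmod (b $ j)"
  have "psum (a * b) n \<le> (\<Sum>k\<le>n. \<Sum>i\<le>k. ?f i (k - i))"
    unfolding psum_def fps_mult_nth atMost_atLeast0[symmetric]
    by (intro sum_mono order_trans[OF norm_sum]) (simp add: norm_mult)
  also have "\<dots> = (\<Sum>(i, j)\<in>{(i, j). i + j \<le> n}. ?f i j)"
    by (rule sum.triangle_reindex_eq[symmetric])
  also have "\<dots> \<le> (\<Sum>(i, j)\<in>{..n} \<times> {..n}. ?f i j)"
    by (intro sum_mono2) auto
  also have "\<dots> = psum a n * psum b n"
    unfolding psum_def sum_product by (simp add: sum.cartesian_product)
  finally show ?thesis .
qed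

lemma psum_power: "psum (a ^ m) n \<le> psum a n ^ m"
proof (induction m)
  case 0
  have "(\<Sum>i\<le>n. cmod ((1::complex fps) $ i)) = (\<Sum>i\<in>{0}. cmod ((1::complex fps) $ i))"
    by (intro sum.mono_neutral_right) auto
  then show ?case by (simp add: psum_def)
next
  case (Suc m)
  have "psum (a ^ Suc m) n \<le> psum a n * psum (a ^ m) n" by (simp add: psum_mult)
  also have "\<dots> \<le> psum a n * psum a n ^ m" using Suc psum_nonneg by (intro mult_left_mono) auto
  finally show ?case by simp
qed

lemma decay_lower:
  assumes "a - b \<in> decay \<theta>" "\<theta> < \<tau>" "c > 0"
    and low: "\<And>n. n \<ge> N \<Longrightarrow> c * real n powr \<tau> \<le> cmod (b $ n)"
  shows "\<exists>N'. \<forall>n\<ge>N'. c / 2 * real n powr \<tau> \<le> cmod (a $ n)"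
proof -
  obtain C where C: "C > 0" "\<And>n. cmod ((a - b) $ n) \<le> C * real (Suc n) powr \<theta>"
    using assms(1) by (rule decayE) blast
  have "((\<lambda>n. real n powr (\<theta> - \<tau>)) \<longlongrightarrow> 0) sequentially"
    using assms(2) by (intro tendsto_neg_powr filterlim_real_sequentially) auto
  then have "(\<lambda>n. C * 2 powr \<bar>\<theta>\<bar> * real n powr (\<theta> - \<tau>)) \<longlonglongrightarrow> C * 2 powr \<bar>\<theta>\<bar> * 0"
    by (intro tendsto_mult tendsto_const)
  moreover have "C * 2 powr \<bar>\<theta>\<bar> * 0 < c / 2" using assms(3) by simp
  ultimately have "\<forall>\<^sub>F n in sequentially. C * 2 powr \<bar>\<theta>\<bar> * real n powr (\<theta> - \<tau>) < c / 2"
    by (rule order_tendstoD(2))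
  then obtain M where M: "\<And>n. n \<ge> M \<Longrightarrow> C * 2 powr \<bar>\<theta>\<bar> * real n powr (\<theta> - \<tau>) < c / 2"
    by (auto simp: eventually_sequentially)
  have "c / 2 * real n powr \<tau> \<le> cmod (a $ n)" if n: "n \<ge> max N (max M 1)" for n
  proof -
    have "real (Suc n) powr \<theta> \<le> 2 powr \<bar>\<theta>\<bar> * real n powr \<theta>"
      by (rule powr_Suc_le) (use n in simp)
    then have 1: "cmod ((a - b) $ n) \<le> C * (2 powr \<bar>\<theta>\<bar> * real n powr \<theta>)"
      using C by (meson order_trans mult_left_mono less_imp_le)
    have "real n powr \<theta> = real n powr (\<theta> - \<tau>) * real n powr \<tau>" by (simp flip: powr_add)
    then have "C * (2 powr \<bar>\<theta>\<bar> * real n powr \<theta>) = (C * 2 powr \<bar>\<theta>\<bar> * real n powr (\<theta> - \<tau>)) * real n powr \<tau>"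
      by (simp only: mult.assoc)
    also have "\<dots> \<le> c / 2 * real n powr \<tau>" using M[of n] n by (intro mult_right_mono) auto
    finally have 2: "cmod ((a - b) $ n) \<le> c / 2 * real n powr \<tau>" using 1 by linarith
    have "cmod (b $ n) \<le> cmod (a $ n) + cmod ((a - b) $ n)"
      using norm_triangle_ineq4[of "a $ n" "(a - b) $ n"] by simp
    then show ?thesis using low[of n] 2 n by simp
  qed
  then show ?thesis by blast
qed

context offspring
begin

lemma euler_y_power: "euler (y ^ m) = of_nat m * (y ^ m * V)"
proof (induction m)
  case (Suc m)
  have "euler (y ^ Suc m) = euler y * y ^ m + y * euler (y ^ m)" by (simp add: euler_mult)
  then show ?case by (simp add: Suc euler_y algebra_simps)
qed (simp add: euler_def)

text \<open>By \<open>euler_y_power\<close>, \<open>n\<close> times the coefficient of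
  \<open>y ^ m\<close> is \<open>m\<close> times a coefficient of \<open>\<Phi> ^ n\<close>, and
  those are bounded uniformly.\<close>

lemma y_power_bound: "\<exists>C>0. \<forall>n>0. \<forall>m. cmod ((y ^ m) $ n) \<le> C * real m * real n powr (-3/2)"
proof -
  obtain C where C: "C > 0" "\<And>n m. n > 0 \<Longrightarrow> cmod ((\<Phi> ^ n) $ m) \<le> C * real n powr (-1/2)"
    using llt_uniform by auto
  have "cmod ((y ^ m) $ n) \<le> C * real m * real n powr (-3/2)" if n: "n > 0" for n m
  proof -
    have "of_nat n * (y ^ m) $ n = of_nat m * (y ^ m * V) $ n"
      using euler_nth[of "y ^ m" n] by (simp only: euler_y_power of_nat_fps_mult_nth)
    then have "real n * cmod ((y ^ m) $ n) = real m * cmod ((y ^ m * V) $ n)"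
      by (metis norm_mult norm_of_nat)
    moreover have "cmod ((y ^ m * V) $ n) \<le> C * real n powr (-1/2)"
      unfolding y_power_V_nth using C n by auto
    ultimately have "real n * cmod ((y ^ m) $ n) \<le> real m * (C * real n powr (-1/2))"
      by (simp add: mult_left_mono)
    then have "cmod ((y ^ m) $ n) \<le> real m * (C * real n powr (-1/2)) / real n"
      using n by (subst pos_le_divide_eq) (auto simp: mult.commute)
    also have "\<dots> = C * real m * (real n powr (-1/2) * real n powr (-1))"
      using n by (simp add: powr_minus_divide)
    also have "real n powr (-1/2) * real n powr (-1) = real n powr (-3/2)" by (subst powr_add[symmetric]) simp
    finally show ?thesis .
  qed
  with C show ?thesis by blast
qed

lemma yV_lower: "\<exists>c>0. \<exists>N. \<forall>n\<ge>N. c * real n powr (-1/2) \<le> cmod ((y * V) $ n)"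
proof -
  obtain c where c: "c > 0" "\<And>n. n \<ge> 2 \<Longrightarrow> c * real n powr (-1/2) \<le> half_binom n"
    using half_binom_lower by auto
  have "Y \<in> decay (-1/2 - \<delta>/2)" using Y_decay by (rule decay_mono) auto
  from decay_diff[OF c0(2) this] have d: "y * V - fps_const (of_real c0) * inv_pow (1/2) \<in> decay (-1/2 - \<delta>/2)"
    by (simp add: Y_def)
  have low: "c0 * c * real n powr (-1/2) \<le> cmod ((fps_const (of_real c0) * inv_pow (1/2)) $ n)" if "n \<ge> 2" for n
  proof -
    have "cmod ((fps_const (of_real c0) * inv_pow (1/2)) $ n) = c0 * \<bar>half_binom n\<bar>"
      unfolding fps_mult_left_const_nth norm_mult inv_pow_nth norm_of_real using c0(1) by simp
    moreover have "c0 * (c * real n powr (-1/2)) \<le> c0 * \<bar>half_binom n\<bar>"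
      by (rule mult_left_mono[OF order_trans[OF c(2)[OF that] abs_ge_self] less_imp_le[OF c0(1)]])
    ultimately show ?thesis by (simp only: mult.assoc)
  qed
  have pos: "c0 * c > 0" using c0(1) c(1) by (rule mult_pos_pos)
  have "-1/2 - \<delta>/2 < -1/2" using delta by simp
  from decay_lower[OF d this pos low] have "\<exists>N'. \<forall>n\<ge>N'. c0 * c / 2 * real n powr (-1/2) \<le> cmod ((y * V) $ n)" .
  moreover have "c0 * c / 2 > 0" using pos by simp
  ultimately show ?thesis by blast
qed

lemma gw_size_prob_nonneg: "gw_size_prob p n \<ge> 0"
proof -
  have "gw_weight p t \<ge> 0" for t
    by (induction t) (auto intro!: mult_nonneg_nonneg prod_list_nonneg)
  then show ?thesis unfolding gw_size_prob_def by (intro sum_nonneg) auto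
qed

lemma norm_y_nth: "cmod (y $ n) = gw_size_prob p n"
  by (simp add: y_def gw_size_prob_nonneg)

lemma gw_size_prob_lower: "\<exists>c>0. \<exists>N>0. \<forall>n\<ge>N. c * real n powr (-3/2) \<le> gw_size_prob p n"
proof -
  obtain c N where c: "c > 0" "\<And>n. n \<ge> N \<Longrightarrow> c * real n powr (-1/2) \<le> cmod ((y * V) $ n)"
    using yV_lower by auto
  have "c * real n powr (-3/2) \<le> gw_size_prob p n" if n: "n \<ge> Suc N" for n
  proof -
    have n0: "n > 0" using n by simp
    have "c * real n powr (-3/2) = c * real n powr (-1/2) * real n powr (-1)"
      unfolding mult.assoc by (subst powr_add[symmetric]) simp
    also have "\<dots> \<le> cmod ((y * V) $ n) * real n powr (-1)"
      using c n by (intro mult_right_mono) auto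
    also have "\<dots> = cmod (y $ n)"
      using n0 by (simp add: y_nth yV_nth norm_divide powr_minus_divide)
    finally show ?thesis by (simp add: norm_y_nth)
  qed
  with c show ?thesis by blast
qed

lemma gw_size_prob_sums: "gw_size_prob p sums 1"
proof -
  have "summable (\<lambda>n. y $ n)" by (rule decay_summable[OF y_decay]) simp
  then have "(\<lambda>n. y $ n) sums 1" using mass_y unfolding mass_def by (metis summable_sums)
  then have "(\<lambda>n. Re (y $ n)) sums Re 1" by (rule sums_Re)
  then show ?thesis by (simp add: y_def)
qed

text \<open>The sizes between \<open>n\<close> and \<open>2 * n\<close> alone carry a probability of
  order \<open>n powr (-1/2)\<close>, which is missing from the partial sum. The exponential form
  survives raising to a power.\<close>

lemma psum_y_bound: "\<exists>c>0. \<forall>n>0. psum y n \<le> exp (- (c * real n powr (-1/2)))"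
proof -
  obtain b N where b: "b > 0" "N > 0" "\<And>n. n \<ge> N \<Longrightarrow> b * real n powr (-3/2) \<le> gw_size_prob p n"
    using gw_size_prob_lower by auto
  define b' where "b' = b * 2 powr (-3/2)"
  have b': "b' > 0" using b by (simp add: b'_def)
  have S: "summable (gw_size_prob p)" "suminf (gw_size_prob p) = 1"
    using gw_size_prob_sums by (auto simp: sums_iff)
  have psum_eq: "psum y n = sum (gw_size_prob p) {..n}" for n
    by (simp add: psum_def norm_y_nth)
  have big: "psum y n \<le> 1 - b' * real n powr (-1/2)" if n: "n \<ge> N" for n
  proof -
    have "b' * real n powr (-1/2) = (\<Sum>i\<in>{Suc n..2 * n}. b * (2 * real n) powr (-3/2))"
    proof -
      have "real n powr (-1/2) = real n powr 1 * real n powr (-3/2)" by (subst powr_add[symmetric]) simp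
      then show ?thesis by (simp add: b'_def powr_mult)
    qed
    also have "\<dots> \<le> (\<Sum>i\<in>{Suc n..2 * n}. gw_size_prob p i)"
    proof (rule sum_mono)
      fix i assume i: "i \<in> {Suc n..2 * n}"
      have "b * (2 * real n) powr (-3/2) \<le> b * real i powr (-3/2)"
        using i b by (intro mult_left_mono powr_mono2') auto
      also have "\<dots> \<le> gw_size_prob p i" using i n by (intro b) auto
      finally show "b * (2 * real n) powr (-3/2) \<le> gw_size_prob p i" .
    qed
    finally have 1: "b' * real n powr (-1/2) \<le> (\<Sum>i\<in>{Suc n..2 * n}. gw_size_prob p i)" .
    have "sum (gw_size_prob p) {..n} + sum (gw_size_prob p) {Suc n..2 * n} = sum (gw_size_prob p) ({..n} \<union> {Suc n..2 * n})"
      by (rule sum.union_disjoint[symmetric]) auto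
    also have "\<dots> \<le> 1" unfolding S(2)[symmetric]
      by (rule sum_le_suminf) (auto simp: S gw_size_prob_nonneg)
    finally show ?thesis using 1 unfolding psum_eq by linarith
  qed
  \<comment> \<open>Small enough that monotonicity transfers the bound at \<open>N\<close> to all
    smaller \<open>n\<close>.\<close>
  define c where "c = b' * real N powr (-1/2)"
  have c: "c > 0" using b b' by (simp add: c_def)
  have "psum y n \<le> exp (- (c * real n powr (-1/2)))" if n: "n > 0" for n
  proof -
    have "psum y n \<le> 1 - c * real n powr (-1/2)"
    proof (cases "n \<ge> N")
      case True
      have "real N powr (-1/2) \<le> 1 powr (-1/2)" using b by (intro powr_mono2') auto
      then have "c \<le> b'" unfolding c_def using b' by (simp add: mult_left_le)
      then have "c * real n powr (-1/2) \<le> b' * real n powr (-1/2)" by (intro mult_right_mono) auto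
      then show ?thesis using big[OF True] by linarith
    next
      case False
      have "psum y n \<le> psum y N" unfolding psum_def using False by (intro sum_mono2) auto
      also have "\<dots> \<le> 1 - c" using big[of N] by (simp add: c_def)
      also have "real n powr (-1/2) \<le> 1 powr (-1/2)" using n by (intro powr_mono2') auto
      then have "1 - c \<le> 1 - c * real n powr (-1/2)" using c by (simp add: mult_left_le)
      finally show ?thesis by simp
    qed
    also have "\<dots> \<le> exp (- (c * real n powr (-1/2)))"
      using exp_ge_add_one_self[of "- (c * real n powr (-1/2))"] by simp
    finally show ?thesis .
  qed
  with c show ?thesis by blast
qed

text \<open>Splitting \<open>y ^ m\<close> into two halves turns the pointwise bound and the bound on partial sums
  into a pointwise bound that decays for \<open>m\<close> large compared with \<open>sqrt n\<close>.\<close>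
lemma y_power_exp_bound:
  "\<exists>C>0. \<exists>c>0. \<forall>n>0. \<forall>m. cmod ((y ^ m) $ n) \<le> C * real m * real n powr (-3/2) * exp (- (c * real m * real n powr (-1/2)))"
proof -
  obtain C where C: "C > 0" "\<And>n m. n > 0 \<Longrightarrow> cmod ((y ^ m) $ n) \<le> C * real m * real n powr (-3/2)"
    using y_power_bound by auto
  obtain c where c: "c > 0" "\<And>n. n > 0 \<Longrightarrow> psum y n \<le> exp (- (c * real n powr (-1/2)))"
    using psum_y_bound by auto
  define K where "K = C * 2 powr \<bar>-3/2\<bar>"
  have K: "K > 0" using C by (simp add: K_def)
  have "cmod ((y ^ m) $ n) \<le> 2 * K * exp (c / 2) * real m * real n powr (-3/2) * exp (- (c / 2 * real m * real n powr (-1/2)))"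
    if n: "n > 0" for n m
  proof -
    define m1 where "m1 = m div 2"
    define m2 where "m2 = m - m1"
    have m: "m = m1 + m2" "m1 \<le> m" "m2 \<le> m" "m1 \<le> m2" by (auto simp: m1_def m2_def)
    let ?A = "K * real m * real n powr (-3/2)"
    have A: "?A \<ge> 0" using K by simp
    have pw: "cmod ((y ^ l) $ i) \<le> ?A" if "l \<le> m" "2 * i \<ge> n" "i \<le> n" for l i
    proof -
      have i: "i > 0" using that n by auto
      have "cmod ((y ^ l) $ i) \<le> C * real l * real i powr (-3/2)" using i by (rule C)
      also have "\<dots> \<le> C * real m * (2 powr \<bar>-3/2\<bar> * real n powr (-3/2))"
        using that C n by (intro mult_mono powr_half_compare) auto
      finally show ?thesis by (simp only: K_def mult_ac)
    qed
    have Q: "psum y n \<le> 1" using c(2)[OF n] c(1) by (auto intro: order_trans)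
    have ps1: "psum (y ^ m1) n \<le> psum y n ^ m1" by (rule psum_power)
    have ps2: "psum (y ^ m2) n \<le> psum y n ^ m1"
      by (rule order_trans[OF psum_power power_decreasing]) (auto simp: m Q psum_nonneg)
    have "cmod ((y ^ m) $ n) \<le> (\<Sum>i\<le>n. cmod ((y ^ m1) $ i * (y ^ m2) $ (n - i)))"
      unfolding m(1) power_add fps_mult_nth atMost_atLeast0[symmetric] by (rule norm_sum)
    also have "\<dots> \<le> (\<Sum>i\<le>n. ?A * cmod ((y ^ m2) $ (n - i)) + ?A * cmod ((y ^ m1) $ i))"
    proof (rule sum_mono)
      fix i assume i: "i \<in> {..n}"
      show "cmod ((y ^ m1) $ i * (y ^ m2) $ (n - i)) \<le> ?A * cmod ((y ^ m2) $ (n - i)) + ?A * cmod ((y ^ m1) $ i)"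
      proof (cases "2 * i \<ge> n")
        case True
        then have "cmod ((y ^ m1) $ i) * cmod ((y ^ m2) $ (n - i)) \<le> ?A * cmod ((y ^ m2) $ (n - i))"
          using i m by (intro mult_right_mono pw) auto
        then show ?thesis using A by (simp only: norm_mult) (simp add: add_increasing2)
      next
        case False
        then have "cmod ((y ^ m2) $ (n - i)) * cmod ((y ^ m1) $ i) \<le> ?A * cmod ((y ^ m1) $ i)"
          using i m by (intro mult_right_mono pw) auto
        then show ?thesis using A by (simp only: norm_mult mult.commute[of "cmod ((y ^ m1) $ i)"]) (simp add: add_increasing)
      qed
    qed
    also have "\<dots> = ?A * (\<Sum>i\<le>n. cmod ((y ^ m2) $ (n - i))) + ?A * psum (y ^ m1) n"
      unfolding psum_def by (simp only: sum.distrib sum_distrib_left)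
    also have "(\<Sum>i\<le>n. cmod ((y ^ m2) $ (n - i))) = psum (y ^ m2) n"
      unfolding psum_def by (rule sum.reindex_bij_witness[of _ "\<lambda>i. n - i" "\<lambda>i. n - i"]) auto
    also have "?A * psum (y ^ m2) n + ?A * psum (y ^ m1) n \<le> ?A * psum y n ^ m1 + ?A * psum y n ^ m1"
      by (intro add_mono mult_left_mono ps1 ps2 A)
    also have "\<dots> = 2 * ?A * psum y n ^ m1" by simp
    \<comment> \<open>\<open>m1\<close> is half of \<open>m\<close> rounded down; the factor
      \<open>exp (c / 2)\<close> pays for the rounding.\<close>
    also have "\<dots> \<le> 2 * ?A * (exp (c / 2) * exp (- (c / 2 * real m * real n powr (-1/2))))"
    proof (rule mult_left_mono)
      have "psum y n ^ m1 \<le> exp (- (c * real n powr (-1/2))) ^ m1"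
        using c(2)[OF n] psum_nonneg by (intro power_mono)
      also have "\<dots> = exp (- (c * real n powr (-1/2) * real m1))"
        by (simp add: exp_of_nat_mult[symmetric] mult_ac)
      also have "\<dots> \<le> exp (c / 2 + - (c / 2 * real m * real n powr (-1/2)))"
      proof -
        have "real n powr (-1/2) \<le> 1 powr (-1/2)" using n by (intro powr_mono2') auto
        then have x: "real n powr (-1/2) \<le> 1" by simp
        have "real m \<le> 2 * real m1 + 1" by (simp add: m1_def)
        then have "c / 2 * real n powr (-1/2) * real m \<le> c / 2 * real n powr (-1/2) * (2 * real m1 + 1)"
          using c by (intro mult_left_mono) auto
        also have "\<dots> = c * real n powr (-1/2) * real m1 + c / 2 * real n powr (-1/2)" by (simp add: algebra_simps)
        also have "\<dots> \<le> c * real n powr (-1/2) * real m1 + c / 2" using c x by (simp add: mult_left_le)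
        finally show ?thesis by (simp add: mult_ac)
      qed
      finally show "psum y n ^ m1 \<le> exp (c / 2) * exp (- (c / 2 * real m * real n powr (-1/2)))"
        by (simp only: exp_add)
    qed (use A in simp)
    finally show ?thesis by (simp only: mult_ac)
  qed
  moreover have "2 * K * exp (c / 2) > 0" "c / 2 > 0" using K c by auto
  ultimately show ?thesis by blast
qed

lemma funpow_deriv_bound: "cmod ((fps_deriv ^^ j) \<Phi> $ d) \<le> real (d + j) ^ j * pmf p (d + j)"
proof (induction j arbitrary: d)
  case 0
  then show ?case by (simp add: \<Phi>_nth)
next
  case (Suc j)
  have "cmod ((fps_deriv ^^ Suc j) \<Phi> $ d) = real (Suc d) * cmod ((fps_deriv ^^ j) \<Phi> $ Suc d)"
    by (simp add: norm_mult del: of_nat_Suc)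
  also have "\<dots> \<le> real (d + Suc j) * (real (Suc d + j) ^ j * pmf p (Suc d + j))"
    by (intro mult_mono Suc) auto
  finally show ?case by simp
qed

text \<open>With \<open>k = d + j\<close> the summands contain \<open>k ^ (j + 1)\<close>: a power
  \<open>j\<close> from differentiation and one from the coefficient of \<open>y ^ d\<close>. The
  moment assumption pays for \<open>k powr (2 + \<delta>)\<close>; the rest is traded against the
  exponential factor for a power of \<open>n\<close>, since effectively only \<open>k\<close> up to
  order \<open>sqrt n\<close> matters.\<close>

lemma deriv_compose_decay:
  assumes j: "j \<ge> 2"
  shows "((fps_deriv ^^ j) \<Phi> oo y) \<in> decay (real j / 2 - 2 - \<delta> / 2)"
proof -
  obtain C c where C: "C > 0" "c > 0" "\<And>n m. n > 0 \<Longrightarrow>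
      cmod ((y ^ m) $ n) \<le> C * real m * real n powr (-3/2) * exp (- (c * real m * real n powr (-1/2)))"
    using y_power_exp_bound by blast
  \<comment> \<open>The exponent not covered by the moment assumption; it is nonnegative because
    \<open>j \<ge> 2\<close> and \<open>\<delta> \<le> 1\<close>.\<close>
  define b where "b = real j - 1 - \<delta>"
  have b: "b \<ge> 0" using j delta by (simp add: b_def)
  obtain D where D: "D > 0" "\<And>x. x \<ge> 0 \<Longrightarrow> x powr b \<le> D * exp x" using powr_exp_bound[OF b] by auto
  have msum: "(\<lambda>k. pmf p k * real k powr (2 + \<delta>)) sums (\<integral>k. real k powr (2 + \<delta>) \<partial>measure_pmf p)"
    using pmf_expectation_sums[OF mom] by simp
  define M where "M = (\<integral>k. real k powr (2 + \<delta>) \<partial>measure_pmf p)"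
  have M: "M \<ge> 0" unfolding M_def by (intro integral_nonneg_AE AE_I2) auto
  define K where "K = C * exp (c * real j) * (D * c powr (- b)) * M"
  have K: "K \<ge> 0" using C D M by (simp add: K_def)
  show ?thesis
  proof (rule decay_from_real_n[OF _ K])
    fix n :: nat assume n: "n > 0"
    have bd: "cmod ((fps_deriv ^^ j) \<Phi> $ d * ((y ^ d) $ n))
       \<le> C * exp (c * real j) * (D * c powr (- b)) * (real n powr (real j / 2 - 2 - \<delta> / 2) * (pmf p (d + j) * real (d + j) powr (2 + \<delta>)))" for d
    proof -
      define k where "k = real (d + j)"
      have k: "k > 0" "real d \<le> k" "k = real d + real j" using j by (auto simp: k_def)
      let ?x = "c * k * real n powr (-1/2)"
      have n1: "real n powr (-1/2) \<le> 1" using n powr_mono2'[of "-1/2" 1 "real n"] by simp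
      have e: "exp (- (c * real d * real n powr (-1/2))) \<le> exp (c * real j) * exp (- ?x)"
      proof -
        have "c * real j * real n powr (-1/2) \<le> c * real j" using n1 C by (simp add: mult_left_le)
        then show ?thesis unfolding exp_add[symmetric] k(3) by (simp add: distrib_left distrib_right)
      qed
      have kb: "k powr b \<le> D * c powr (- b) * real n powr (b / 2) * exp ?x"
      proof -
        have "k = ?x * (c powr (-1) * real n powr (1/2))"
        proof -
          have "real n powr (-1/2) * real n powr (1/2) = 1" using n by (simp flip: powr_add)
          moreover have "c * c powr (-1) = 1" using C by (simp add: powr_minus_divide)
          moreover have "?x * (c powr (-1) * real n powr (1/2)) = k * (c * c powr (-1)) * (real n powr (-1/2) * real n powr (1/2))"
            by (simp only: mult_ac)
          ultimately show ?thesis by simp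
        qed
        then have "k powr b = (?x * (c powr (-1) * real n powr (1/2))) powr b" by (rule arg_cong)
        also have "\<dots> = ?x powr b * (c powr (-1) * real n powr (1/2)) powr b" by (rule powr_mult)
        also have "(c powr (-1) * real n powr (1/2)) powr b = (c powr (-1)) powr b * (real n powr (1/2)) powr b"
          by (rule powr_mult)
        also have "(c powr (-1)) powr b * (real n powr (1/2)) powr b = c powr (- b) * real n powr (b / 2)"
          by (simp only: powr_powr mult_minus1 times_divide_eq_left mult_1)
        also have "?x powr b * (c powr (- b) * real n powr (b / 2)) \<le> D * exp ?x * (c powr (- b) * real n powr (b / 2))"
          using C k by (intro mult_right_mono D) auto
        finally show ?thesis by (simp only: mult_ac)
      qed
      have kj: "k ^ j * k = k powr (2 + \<delta>) * k powr b"
      proof -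
        have "k ^ j * k = k powr (real j + 1)" using k by (simp add: powr_add powr_realpow)
        also have "real j + 1 = (2 + \<delta>) + b" by (simp add: b_def)
        finally show ?thesis by (simp only: powr_add)
      qed
      have "cmod ((fps_deriv ^^ j) \<Phi> $ d * ((y ^ d) $ n))
         \<le> (k ^ j * pmf p (d + j)) * (C * k * real n powr (-3/2) * (exp (c * real j) * exp (- ?x)))"
        unfolding norm_mult
      proof (rule mult_mono)
        show "cmod ((fps_deriv ^^ j) \<Phi> $ d) \<le> k ^ j * pmf p (d + j)"
          unfolding k_def by (rule funpow_deriv_bound)
        show "cmod ((y ^ d) $ n) \<le> C * k * real n powr (-3/2) * (exp (c * real j) * exp (- ?x))"
          by (rule order_trans[OF C(3)[OF n]]) (intro mult_mono e, use k C in auto)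
      qed (use k in auto)
      also have "\<dots> = C * exp (c * real j) * pmf p (d + j) * real n powr (-3/2) * (k ^ j * k) * exp (- ?x)"
        by (simp only: mult_ac)
      also have "\<dots> = C * exp (c * real j) * pmf p (d + j) * real n powr (-3/2) * k powr (2 + \<delta>) * exp (- ?x) * k powr b"
        unfolding kj by (simp only: mult_ac)
      also have "\<dots> \<le> C * exp (c * real j) * pmf p (d + j) * real n powr (-3/2) * k powr (2 + \<delta>) * exp (- ?x) * (D * c powr (- b) * real n powr (b / 2) * exp ?x)"
        using C by (intro mult_left_mono kb) auto
      also have "\<dots> = C * exp (c * real j) * (D * c powr (- b)) * ((real n powr (-3/2) * real n powr (b / 2)) * (pmf p (d + j) * k powr (2 + \<delta>))) * (exp (- ?x) * exp ?x)"
        by (simp only: mult_ac)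
      also have "exp (- ?x) * exp ?x = 1" by (simp flip: exp_add)
      also have "real n powr (-3/2) * real n powr (b / 2) = real n powr (real j / 2 - 2 - \<delta> / 2)"
        by (subst powr_add[symmetric]) (simp add: b_def field_simps)
      finally show ?thesis by (simp add: k_def)
    qed
    have "cmod (((fps_deriv ^^ j) \<Phi> oo y) $ n) \<le> (\<Sum>d\<le>n. C * exp (c * real j) * (D * c powr (- b)) * (real n powr (real j / 2 - 2 - \<delta> / 2) * (pmf p (d + j) * real (d + j) powr (2 + \<delta>))))"
      unfolding fps_compose_nth atMost_atLeast0[symmetric] by (intro sum_norm_le bd)
    also have "\<dots> = C * exp (c * real j) * (D * c powr (- b)) * (real n powr (real j / 2 - 2 - \<delta> / 2) * (\<Sum>d\<le>n. pmf p (d + j) * real (d + j) powr (2 + \<delta>)))"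
      by (simp only: sum_distrib_left)
    also have "(\<Sum>d\<le>n. pmf p (d + j) * real (d + j) powr (2 + \<delta>)) = (\<Sum>k\<in>(\<lambda>d. d + j) ` {..n}. pmf p k * real k powr (2 + \<delta>))"
      by (subst sum.reindex) (auto simp: inj_on_def)
    also have "C * exp (c * real j) * (D * c powr (- b)) * (real n powr (real j / 2 - 2 - \<delta> / 2) * (\<Sum>k\<in>(\<lambda>d. d + j) ` {..n}. pmf p k * real k powr (2 + \<delta>)))
       \<le> C * exp (c * real j) * (D * c powr (- b)) * (real n powr (real j / 2 - 2 - \<delta> / 2) * M)"
    proof (intro mult_left_mono)
      show "(\<Sum>k\<in>(\<lambda>d. d + j) ` {..n}. pmf p k * real k powr (2 + \<delta>)) \<le> M"
        unfolding M_def sums_unique[OF msum] by (rule sum_le_suminf) (use sums_summable[OF msum] in auto)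
    qed (use C D in auto)
    finally show "cmod (((fps_deriv ^^ j) \<Phi> oo y) $ n) \<le> K * real n powr (real j / 2 - 2 - \<delta> / 2)"
      unfolding K_def by (simp only: mult_ac)
  qed
qed

end

section \<open>Leading terms\<close>

text \<open>\<open>lead \<epsilon> k c b\<close> says that the coefficients of \<open>b\<close> are those of \<open>c * (1 - X) powr (-k/2)\<close>,
  of order \<open>n powr (k/2 - 1)\<close>, up to a polynomially smaller error.\<close>
definition lead :: "real \<Rightarrow> nat \<Rightarrow> complex \<Rightarrow> complex fps \<Rightarrow> bool" where
  "lead \<epsilon> k c b \<longleftrightarrow> b - fps_const c * inv_pow (real k / 2) \<in> decay (real k / 2 - 1 - \<epsilon>)"

lemma lead_decay:
  assumes "lead \<epsilon> k c b" "\<epsilon> \<ge> 0"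
  shows "b \<in> decay (real k / 2 - 1)"
proof -
  have "b - fps_const c * inv_pow (real k / 2) \<in> decay (real k / 2 - 1)"
    using assms unfolding lead_def by (elim decay_mono) auto
  from decay_add[OF this decay_const_mult[OF inv_pow_decay, of c k]] show ?thesis by simp
qed

lemma lead_add: "lead \<epsilon> k c a \<Longrightarrow> lead \<epsilon> k d b \<Longrightarrow> lead \<epsilon> k (c + d) (a + b)"
proof -
  assume "lead \<epsilon> k c a" "lead \<epsilon> k d b"
  from decay_add[OF this[unfolded lead_def]] show ?thesis
    unfolding lead_def by (simp add: algebra_simps flip: fps_const_add)
qed

lemma lead_const_mult:
  assumes "lead \<epsilon> k c a"
  shows "lead \<epsilon> k (r * c) (fps_const r * a)"
proof -
  have "fps_const r * (a - fps_const c * inv_pow (real k / 2)) = fps_const r * a - fps_const (r * c) * inv_pow (real k / 2)"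
    by (simp only: right_diff_distrib fps_const_mult[symmetric] mult.assoc)
  with decay_const_mult[OF assms[unfolded lead_def], of r] show ?thesis unfolding lead_def by simp
qed

lemma lead_negligible: "a \<in> decay (real k / 2 - 1 - \<epsilon>) \<Longrightarrow> lead \<epsilon> k 0 a"
  by (simp add: lead_def)

lemma lead_add_negligible: "lead \<epsilon> k c a \<Longrightarrow> b \<in> decay (real k / 2 - 1 - \<epsilon>) \<Longrightarrow> lead \<epsilon> k c (a + b)"
  using lead_add[of \<epsilon> k c a 0 b] lead_negligible by simp

lemma lead_sum:
  "finite I \<Longrightarrow> (\<And>i. i \<in> I \<Longrightarrow> lead \<epsilon> k (c i) (a i)) \<Longrightarrow> lead \<epsilon> k (\<Sum>i\<in>I. c i) (\<Sum>i\<in>I. a i)"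
proof (induction I rule: finite_induct)
  case empty
  then show ?case by (simp add: lead_negligible)
next
  case (insert i I)
  then show ?case by (simp add: lead_add)
qed

text \<open>The conditions \<open>\<epsilon> \<le> 1/4\<close> and \<open>k, l \<ge> 1\<close> keep
  every exponent above -1, so that exponents simply add and the gain \<open>\<epsilon>\<close> is
  kept in both error terms.\<close>

lemma lead_mult:
  assumes a: "lead \<epsilon> k c a" and b: "lead \<epsilon> l d b" and e: "0 < \<epsilon>" "\<epsilon> \<le> 1/4" and k: "k \<ge> 1" "l \<ge> 1"
  shows "lead \<epsilon> (k + l) (c * d) (a * b)"
proof -
  let ?B = "\<lambda>k. inv_pow (real k / 2)"
  have r: "real (k + l) / 2 = real k / 2 + real l / 2" by (simp add: add_divide_distrib)
  have k': "real k \<ge> 1" "real l \<ge> 1" using k by simp_all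
  have 1: "(a - fps_const c * ?B k) * b \<in> decay (real (k + l) / 2 - 1 - \<epsilon>)"
    unfolding r by (rule decay_mult[OF a[unfolded lead_def] lead_decay[OF b]]) (use e k' in linarith)+
  have 2: "(fps_const c * ?B k) * (b - fps_const d * ?B l) \<in> decay (real (k + l) / 2 - 1 - \<epsilon>)"
    unfolding r by (rule decay_mult[OF decay_const_mult[OF inv_pow_decay] b[unfolded lead_def]]) (use e k' in linarith)+
  have "?B (k + l) = ?B k * ?B l" unfolding inv_pow_add[symmetric] by (simp add: add_divide_distrib)
  then have "a * b - fps_const (c * d) * ?B (k + l) = (a - fps_const c * ?B k) * b + (fps_const c * ?B k) * (b - fps_const d * ?B l)"
    by (simp add: algebra_simps flip: fps_const_mult)
  with decay_add[OF 1 2] show ?thesis unfolding lead_def by simp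
qed

text \<open>The main term of \<open>b\<close> is slowly varying and sees only \<open>mass a\<close>;
  its error term keeps its order when multiplied by a summable series.\<close>

lemma lead_mass_mult:
  assumes a: "a \<in> decay (-1 - \<epsilon>)" and b: "lead \<epsilon> k c b" and e: "0 < \<epsilon>" "\<epsilon> \<le> 1/4" and k: "k \<ge> 1"
  shows "lead \<epsilon> k (mass a * c) (a * b)"
proof -
  let ?B = "inv_pow (real k / 2)"
  have 1: "a * (b - fps_const c * ?B) \<in> decay (real k / 2 - 1 - \<epsilon>)"
    by (rule decay_mult[OF a b[unfolded lead_def]]) (use e k in auto)
  have "a * ?B - fps_const (mass a) * ?B \<in> decay (real k / 2 - 1 - \<epsilon>)"
    by (rule decay_mult_mass[OF a _ _ inv_pow_decay inv_pow_diff_decay]) (use e k in auto)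
  then have 2: "fps_const c * (a * ?B - fps_const (mass a) * ?B) \<in> decay (real k / 2 - 1 - \<epsilon>)"
    by (rule decay_const_mult)
  have "a * b - fps_const (mass a * c) * ?B = a * (b - fps_const c * ?B) + fps_const c * (a * ?B - fps_const (mass a) * ?B)"
    by (simp add: algebra_simps flip: fps_const_mult)
  with decay_add[OF 1 2] show ?thesis unfolding lead_def by simp
qed

lemma lead_unique:
  assumes "lead \<epsilon> k c a" "lead \<epsilon> k d a" "\<epsilon> > 0" "k \<in> {2, 3}"
  shows "c = d"
proof -
  have "fps_const (d - c) * inv_pow (real k / 2) \<in> decay (real k / 2 - 1 - \<epsilon>)"
    using decay_diff[OF assms(1,2)[unfolded lead_def]] by (simp add: algebra_simps flip: fps_const_sub)
  then have "d - c = 0"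
    using assms inv_pow_one_eq_0[of "d - c"] inv_pow_three_half_eq_0[of "d - c"] by auto
  then show ?thesis by simp
qed

context offspring
begin

definition \<Phi>2 :: "complex fps" where "\<Phi>2 = (fps_deriv (fps_deriv \<Phi>) oo y)"

text \<open>\<open>j = 2\<close> is the only case of \<open>deriv_compose_decay\<close> with
  exponent below -1, so this composite has a value at 1.\<close>

lemma \<Phi>2_decay: "\<Phi>2 \<in> decay (-1 - \<delta>/2)"
  using deriv_compose_decay[of 2] by (simp add: \<Phi>2_def numeral_2_eq_2)

section \<open>The two constants that close the moment recursion\<close>

context
  fixes \<epsilon> :: real
  assumes e: "0 < \<epsilon>" "\<epsilon> \<le> \<delta> / 4"
begin

lemma e4: "\<epsilon> \<le> 1/4" using e delta by simp

lemma Y_decay_eps: "Y \<in> decay (-1 - \<epsilon>)"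
  using Y_decay by (rule decay_mono) (use e delta in auto)

lemma \<Phi>2_decay_eps: "\<Phi>2 \<in> decay (-1 - \<epsilon>)"
  using \<Phi>2_decay by (rule decay_mono) (use e delta in auto)

lemma y_decay_eps: "y \<in> decay (-1 - \<epsilon>)"
  using y_decay by (rule decay_mono) (use e4 in auto)

lemma lead_V: "lead \<epsilon> 1 (of_real c0) V"
  unfolding lead_def using c0(2) by (rule_tac decay_mono) (use e delta in auto)

lemma lead_V2: "lead \<epsilon> 2 ((of_real c0)\<^sup>2) (V\<^sup>2)"
  using lead_mult[OF lead_V lead_V e(1) e4] by (simp add: power2_eq_square numeral_2_eq_2)

lemma lead_V3: "lead \<epsilon> 3 (of_real c0 ^ 3) (V ^ 3)"
proof -
  have "lead \<epsilon> (1 + 2) (of_real c0 * (of_real c0)\<^sup>2) (V * V\<^sup>2)"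
    by (rule lead_mult[OF lead_V lead_V2 e(1) e4]) auto
  moreover have "1 + 2 = (3::nat)" "V * V\<^sup>2 = V ^ 3" "of_real c0 * (of_real c0)\<^sup>2 = (of_real c0 ^ 3 :: complex)"
    by (simp_all add: power2_eq_square power3_eq_cube)
  ultimately show ?thesis by metis
qed

lemma decay_mult_summable:
  assumes "a \<in> decay (-1 - \<epsilon>)" "b \<in> decay (-1 - \<epsilon>)"
  shows "a * b \<in> decay (-1 - \<epsilon>)"
  by (rule decay_mult[OF assms]) (use e in auto)

lemma mass_mult_eps:
  assumes "a \<in> decay (-1 - \<epsilon>)" "b \<in> decay (-1 - \<epsilon>)"
  shows "mass (a * b) = mass a * mass b"
  by (rule mass_mult[OF assms]) (use e in auto)

text \<open>The variance is never computed: the constants in this and the next identity come out of comparing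
  leading coefficients in exact identities between power series.\<close>
lemma c0_square: "(of_real c0)\<^sup>2 * mass (fps_X * \<Phi>2) = 1/2"
proof -
  let ?a = "fps_X * \<Phi>2 * y"
  have a: "?a \<in> decay (-1 - \<epsilon>)"
    by (intro decay_mult_summable decay_X_mult \<Phi>2_decay_eps y_decay_eps)
  have ma: "mass ?a = mass (fps_X * \<Phi>2)"
    by (simp add: mass_mult_eps[OF decay_X_mult[OF \<Phi>2_decay_eps] y_decay_eps] mass_y)
  \<comment> \<open>The leading term of \<open>euler V\<close> according to the exact identity; the
    quadratic terms there are of lower order.\<close>
  have 1: "lead \<epsilon> 3 (mass ?a * of_real c0 ^ 3) (?a * V ^ 3)"
    by (rule lead_mass_mult[OF a lead_V3 e(1) e4]) simp
  have "V\<^sup>2 \<in> decay 0" using lead_decay[OF lead_V2] e by simp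
  then have "V\<^sup>2 - V \<in> decay 0" using V_decay by (intro decay_diff) (auto elim: decay_mono)
  then have "V\<^sup>2 - V \<in> decay (real 3 / 2 - 1 - \<epsilon>)" by (rule decay_mono) (use e4 in simp)
  from lead_add_negligible[OF 1 this] have 2: "lead \<epsilon> 3 (mass ?a * of_real c0 ^ 3) (euler V)"
    unfolding euler_V \<Phi>2_def[symmetric] by (simp add: algebra_simps)
  \<comment> \<open>The same leading term from the asymptotics of \<open>V\<close>: at the level of
    coefficients, differentiation raises the exponent of the error by exactly one.\<close>
  have "euler (V - fps_const (of_real c0) * inv_pow (1/2)) \<in> decay (- 1/2 - \<epsilon> + 1)"
    using lead_V by (intro decay_euler) (simp add: lead_def)
  moreover have "euler (V - fps_const (of_real c0) * inv_pow (1/2)) = euler V - fps_const (of_real c0 / 2) * (fps_X * inv_pow (3/2))"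
    using inv_pow_deriv[of "1/2"] by (simp add: euler_def right_diff_distrib mult.left_commute[of fps_X] flip: fps_const_mult)
  ultimately have "euler V - fps_const (of_real c0 / 2) * (fps_X * inv_pow (3/2)) \<in> decay (real 3 / 2 - 1 - \<epsilon>)"
    by simp
  \<comment> \<open>This removes the factor \<open>X\<close> in front of
    \<open>inv_pow (3/2)\<close>.\<close>
  moreover have "fps_const (of_real c0 / 2) * ((1 - fps_X) * inv_pow (real 3/2)) \<in> decay (real 3 / 2 - 1 - \<epsilon>)"
    by (rule decay_const_mult, rule decay_mono[OF inv_pow_diff_decay]) (use e4 in auto)
  ultimately have "(euler V - fps_const (of_real c0 / 2) * (fps_X * inv_pow (3/2)))
      - fps_const (of_real c0 / 2) * ((1 - fps_X) * inv_pow (real 3/2)) \<in> decay (real 3 / 2 - 1 - \<epsilon>)"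
    by (rule decay_diff)
  then have "lead \<epsilon> 3 (of_real c0 / 2) (euler V)"
    unfolding lead_def by (simp add: algebra_simps)
  with 2 have "mass ?a * of_real c0 ^ 3 = of_real c0 / 2"
    by (rule lead_unique) (use e in auto)
  then show ?thesis using c0(1) unfolding ma by (simp add: power2_eq_square power3_eq_cube field_simps)
qed

lemma mass_X_\<Phi>2_Y: "mass (fps_X * \<Phi>2 * Y) = 1"
proof -
  let ?Z = "fps_X * \<Phi>2 * Y"
  have Z: "?Z \<in> decay (-1 - \<epsilon>)"
    by (intro decay_mult_summable decay_X_mult \<Phi>2_decay_eps Y_decay_eps)
  have "euler Y = euler V * (1 - y) - y * V * V"
  proof -
    have "euler Y = euler V - euler (y * V)" by (simp add: Y_def euler_def right_diff_distrib)
    then show ?thesis by (simp add: euler_mult euler_y algebra_simps)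
  qed
  also have "\<dots> = (Y * V - Y + ?Z * y * V\<^sup>2) - y * V\<^sup>2"
    unfolding euler_V \<Phi>2_def[symmetric] Y_def by (simp add: algebra_simps power2_eq_square power3_eq_cube)
  \<comment> \<open>The bracket is of lower order than \<open>V^2\<close>, so the two products with
    \<open>V^2\<close> must have the same leading coefficient.\<close>
  finally have eq: "?Z * y * V\<^sup>2 = y * V\<^sup>2 + (euler Y + Y - Y * V)" by simp
  have 1: "lead \<epsilon> 2 (mass (?Z * y) * (of_real c0)\<^sup>2) (?Z * y * V\<^sup>2)"
    by (rule lead_mass_mult[OF _ lead_V2 e(1) e4]) (auto intro: decay_mult_summable Z y_decay_eps)
  have 2: "lead \<epsilon> 2 (mass y * (of_real c0)\<^sup>2) (y * V\<^sup>2)"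
    by (rule lead_mass_mult[OF y_decay_eps lead_V2 e(1) e4]) simp
  have d1: "euler Y \<in> decay (real 2 / 2 - 1 - \<epsilon>)" using decay_euler[OF Y_decay_eps] by simp
  have d2: "Y \<in> decay (real 2 / 2 - 1 - \<epsilon>)" by (rule decay_mono[OF Y_decay_eps]) (use e in auto)
  have d3: "Y * V \<in> decay (real 2 / 2 - 1 - \<epsilon>)"
    by (rule decay_mult[OF Y_decay_eps V_decay]) (use e e4 in auto)
  have "lead \<epsilon> 2 (mass y * (of_real c0)\<^sup>2) (?Z * y * V\<^sup>2)"
    unfolding eq by (rule lead_add_negligible[OF 2 decay_diff[OF decay_add[OF d1 d2] d3]])
  from lead_unique[OF 1 this e(1)] have "mass (?Z * y) * (of_real c0)\<^sup>2 = mass y * (of_real c0)\<^sup>2" by simp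
  then have "mass (?Z * y) = 1" using c0(1) by (simp add: mass_y)
  then show ?thesis by (simp add: mass_mult_eps[OF Z y_decay_eps] mass_y)
qed

end

end

section \<open>Moments for a single toll\<close>

locale offspring_toll = offspring +
  fixes \<epsilon> :: real and g :: "nat \<Rightarrow> complex"
  assumes e: "0 < \<epsilon>" "\<epsilon> \<le> \<delta> / 4"
    and g: "\<exists>C. \<forall>n. cmod (g n) \<le> C * real (Suc n) powr (- \<epsilon>)"
begin

lemmas e4 = e4[OF e] and Y_decay_eps = Y_decay_eps[OF e] and \<Phi>2_decay_eps = \<Phi>2_decay_eps[OF e]
  and y_decay_eps = y_decay_eps[OF e] and lead_V = lead_V[OF e] and c0_square = c0_square[OF e]
  and mass_X_\<Phi>2_Y = mass_X_\<Phi>2_Y[OF e] and decay_mult_summable = decay_mult_summable[OF e]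
  and mass_mult_eps = mass_mult_eps[OF e]

text \<open>The expectation of \<open>g\<close> at the size of the unconditioned tree, so that the
  toll \<open>f\<close> is centred.\<close>

definition \<mu> :: complex where "\<mu> = mass (hadamard g y)"

definition f :: "nat \<Rightarrow> complex" where "f n = g n - \<mu>"

definition G :: "complex fps fps" where "G = tree_moments p f"

text \<open>\<open>\<Phi>\<close> is accompanied by all its derivatives because the chain rule in
  \<open>u\<close> leads from \<open>H j\<close> to \<open>H (Suc j)\<close>.\<close>

definition H :: "nat \<Rightarrow> complex fps fps" where "H j = subst_fps ((fps_deriv ^^ j) \<Phi>) G"

lemma hadamard_g_decay: "a \<in> decay \<theta> \<Longrightarrow> hadamard g a \<in> decay (\<theta> - \<epsilon>)"
  using g decay_hadamard[of a \<theta> g _ "- \<epsilon>"] unfolding hadamard_def by fastforce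

lemma hadamard_f_power_decay:
  assumes "a \<in> decay \<theta>"
  shows "hadamard (\<lambda>n. f n ^ i / fact i) a \<in> decay \<theta>"
proof -
  obtain C where C: "\<And>n. cmod (g n) \<le> C * real (Suc n) powr (- \<epsilon>)" using g by blast
  have C0: "C \<ge> 0" using order_trans[OF norm_ge_zero C[of 0]] by simp
  have "cmod (f n) \<le> C + cmod \<mu>" for n
  proof -
    have "real (Suc n) powr (- \<epsilon>) \<le> 1" using e powr_mono2'[of "-\<epsilon>" 1 "real (Suc n)"] by simp
    then have "C * real (Suc n) powr (- \<epsilon>) \<le> C" using C0 by (simp add: mult_left_le)
    then show ?thesis unfolding f_def using C[of n] norm_triangle_ineq4[of "g n" \<mu>] by linarith
  qed
  then have "cmod (f n ^ i / fact i) \<le> (C + cmod \<mu>) ^ i / fact i * real (Suc n) powr 0" for n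
    by (simp add: norm_divide norm_power divide_right_mono power_mono)
  from decay_hadamard[OF assms this] show ?thesis by (simp add: hadamard_def)
qed

lemma G_0: "G $ 0 = y"
  by (simp add: G_def tree_moments_0)

lemma G_nth_0: "G $ k $ 0 = 0"
  by (simp add: G_def tree_moments_nth_0)

lemma H_0: "H j $ 0 = ((fps_deriv ^^ j) \<Phi> oo y)"
  by (simp add: H_def subst_fps_nth_0 G_0)

lemma G_rec: "G $ k = (\<Sum>j\<le>k. hadamard (\<lambda>n. f n ^ (k - j) / fact (k - j)) (fps_X * H 0 $ j))"
  unfolding G_def H_def \<Phi>_pgf funpow_0 by (rule tree_moments_rec)

lemma fps_deriv_nth_fps: "fps_deriv A $ k = of_nat (Suc k) * A $ Suc k" for A :: "complex fps fps"
  by simp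

lemma H_Suc:
  "of_nat (Suc k) * H j $ Suc k = (\<Sum>i\<le>k. H (Suc j) $ i * (of_nat (Suc (k - i)) * G $ Suc (k - i)))"
proof -
  have "fps_deriv (H j) = H (Suc j) * fps_deriv G"
    unfolding H_def using subst_fps_deriv[OF G_nth_0] by simp
  then have "fps_deriv (H j) $ k = (\<Sum>i\<le>k. H (Suc j) $ i * fps_deriv G $ (k - i))"
    by (simp only: fps_mult_nth atMost_atLeast0)
  then show ?thesis by (simp only: fps_deriv_nth_fps)
qed

lemma H_Suc':
  "H j $ Suc k = fps_const (1 / of_nat (Suc k)) * (\<Sum>i\<le>k. H (Suc j) $ i * (of_nat (Suc (k - i)) * G $ Suc (k - i)))"
proof -
  have "fps_const (1 / of_nat (Suc k)) * (of_nat (Suc k) * H j $ Suc k) = H j $ Suc k"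
    unfolding fps_of_nat[symmetric] mult.assoc[symmetric] fps_const_mult by (simp del: of_nat_Suc)
  then show ?thesis unfolding H_Suc by simp
qed

text \<open>The order expected of \<open>G $ k\<close>. The generic exponent
  \<open>k / 2 - 3/2\<close> would be the critical -1 at \<open>k = 1\<close>; there centring yields
  a little more.\<close>

definition \<gamma> :: "nat \<Rightarrow> real" where
  "\<gamma> k = (if k = 0 then -3/2 else if k = 1 then -1 - \<epsilon> else real k / 2 - 3/2)"

lemma \<gamma>_mono: "j \<le> k \<Longrightarrow> \<gamma> j \<le> \<gamma> k"
proof -
  assume jk: "j \<le> k"
  then have "real j \<le> real k" by simp
  moreover have "k \<ge> 2 \<Longrightarrow> real k \<ge> 2" by simp
  ultimately show ?thesis using jk e e4 unfolding \<gamma>_def by auto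
qed

lemma \<gamma>_two_less:
  assumes "k \<ge> 3"
  shows "\<gamma> (k - 2) \<le> real (k - 2) / 2 - 1 - \<epsilon>"
proof -
  consider "k = 3" | "k \<ge> 4" using assms by linarith
  then show ?thesis
  proof cases
    case 2
    then have "real (k - 2) / 2 \<ge> 1" by simp
    then show ?thesis using 2 e4 by (simp add: \<gamma>_def)
  qed (use e4 in \<open>simp add: \<gamma>_def\<close>)
qed

text \<open>A factor \<open>G $ b\<close> raises the exponent by \<open>(b - 1) / 2\<close>; for
  \<open>b = 1\<close> it is summable and costs nothing.\<close>

lemma decay_mult_G:
  assumes X: "X \<in> decay \<theta>" and G: "G $ b \<in> decay (\<gamma> b)" and b: "b \<ge> 1" and \<theta>: "\<theta> \<ge> -1/2 - \<epsilon>"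
  shows "X * G $ b \<in> decay (\<theta> + real b / 2 - 1/2)"
proof (cases "b = 1")
  case True
  then have "G $ b \<in> decay (-1 - \<epsilon>)" using G by (simp add: \<gamma>_def)
  from decay_mult[OF X this, of \<theta>] show ?thesis using e e4 \<theta> True by auto
next
  case False
  then have b2: "real b \<ge> 2" using b by simp
  have "G $ b \<in> decay (real b / 2 - 3/2)" using G False b by (simp add: \<gamma>_def)
  then show ?thesis by (rule decay_mult[OF X]) (use e4 \<theta> b2 in linarith)+
qed

lemma decay_of_nat_mult: "a \<in> decay \<theta> \<Longrightarrow> of_nat m * a \<in> decay \<theta>"
  unfolding fps_of_nat[symmetric] by (rule decay_const_mult)

text \<open>Induction on the power of \<open>u\<close> for all \<open>j\<close> simultaneously, as
  \<open>H_Suc'\<close> lowers the one and raises the other. The gain \<open>\<epsilon>\<close> of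
  the base case \<open>deriv_compose_decay\<close> survives every step and makes higher derivatives
  negligible.\<close>

lemma H_decay:
  assumes "\<And>b. 1 \<le> b \<Longrightarrow> b \<le> k \<Longrightarrow> G $ b \<in> decay (\<gamma> b)" "j \<ge> 2"
  shows "H j $ k \<in> decay (real (j + k) / 2 - 2 - \<epsilon>)"
  using assms
proof (induction k arbitrary: j rule: less_induct)
  case (less k)
  show ?case
  proof (cases k)
    case 0
    have "H j $ 0 \<in> decay (real j / 2 - 2 - \<delta> / 2)"
      unfolding H_0 by (rule deriv_compose_decay[OF less.prems(2)])
    then have "H j $ 0 \<in> decay (real j / 2 - 2 - \<epsilon>)" by (rule decay_mono) (use e in auto)
    then show ?thesis using 0 by simp
  next
    case (Suc m)
    have "H (Suc j) $ i * (of_nat (Suc (m - i)) * G $ Suc (m - i)) \<in> decay (real (j + k) / 2 - 2 - \<epsilon>)"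
      if i: "i \<le> m" for i
    proof -
      have 1: "H (Suc j) $ i \<in> decay (real (Suc j + i) / 2 - 2 - \<epsilon>)"
        using i less.prems Suc by (intro less.IH) auto
      have 2: "G $ Suc (m - i) \<in> decay (\<gamma> (Suc (m - i)))"
        using i Suc by (intro less.prems) auto
      have j3: "real (Suc j + i) \<ge> 3" using less.prems(2) by simp
      have r: "real (j + k) = real (Suc j + i) + real (Suc (m - i)) - 1" using i Suc by simp
      have "H (Suc j) $ i * G $ Suc (m - i) \<in> decay (real (Suc j + i) / 2 - 2 - \<epsilon> + real (Suc (m - i)) / 2 - 1/2)"
      proof (rule decay_mult_G[OF 1 2])
        have "-1/2 - \<epsilon> \<le> x / 2 - 2 - \<epsilon>" if "x \<ge> 3" for x :: real using that by simp
        from this[OF j3] show "-1/2 - \<epsilon> \<le> real (Suc j + i) / 2 - 2 - \<epsilon>" .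
      qed simp
      also have "real (Suc j + i) / 2 - 2 - \<epsilon> + real (Suc (m - i)) / 2 - 1/2 = real (j + k) / 2 - 2 - \<epsilon>"
        unfolding r by (simp only: add_divide_distrib diff_divide_distrib)
      finally show ?thesis by (subst mult.left_commute) (rule decay_of_nat_mult)
    qed
    then show ?thesis unfolding Suc H_Suc' by (intro decay_const_mult decay_sum) (auto simp: Suc)
  qed
qed

text \<open>The part of \<open>G $ k\<close> in which the toll of the root occurs at least
  once.\<close>

definition T :: "nat \<Rightarrow> complex fps" where
  "T k = (\<Sum>j<k. hadamard (\<lambda>n. f n ^ (k - j) / fact (k - j)) (fps_X * H 0 $ j))"

text \<open>The part of \<open>X * H 0 $ k\<close> free of \<open>G $ k\<close>; the omitted term
  \<open>X * \<Phi>'(y) * G $ k\<close> is the one inverted by \<open>V\<close>.\<close>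

definition R :: "nat \<Rightarrow> complex fps" where
  "R k = fps_const (1 / of_nat k) * (fps_X * (\<Sum>i\<in>{1..<k}. H 1 $ i * (of_nat (k - i) * G $ (k - i))))"

lemma G_split: "G $ k = fps_X * H 0 $ k + T k"
proof -
  have "hadamard (\<lambda>n. f n ^ (k - k) / fact (k - k)) (fps_X * H 0 $ k) = fps_X * H 0 $ k"
    by (rule fps_ext) (simp add: hadamard_nth)
  then show ?thesis unfolding G_rec[of k] T_def lessThan_Suc_atMost[symmetric] sum.lessThan_Suc by (simp only: add.commute)
qed

text \<open>The recursion read backwards: \<open>X * H 0 $ k\<close> is \<open>G $ k\<close> minus
  terms of lower index, so \<open>\<Phi>(G)\<close> inherits its bounds from
  \<open>G\<close>.\<close>

lemma X_H_decay:
  assumes "\<And>i. i \<le> k \<Longrightarrow> G $ i \<in> decay (\<gamma> i)"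
  shows "fps_X * H 0 $ k \<in> decay (\<gamma> k)"
  using assms
proof (induction k rule: less_induct)
  case (less k)
  have "T k \<in> decay (\<gamma> k)"
    unfolding T_def
  proof (intro decay_sum hadamard_f_power_decay)
    fix j assume j: "j \<in> {..<k}"
    then have "fps_X * H 0 $ j \<in> decay (\<gamma> j)" by (intro less) auto
    then show "fps_X * H 0 $ j \<in> decay (\<gamma> k)" using j by (elim decay_mono) (auto intro: \<gamma>_mono)
  qed
  moreover have "fps_X * H 0 $ k = G $ k - T k" using G_split[of k] by simp
  ultimately show ?case using less.prems[of k] by (simp add: decay_diff)
qed

lemma G_eq:
  assumes "k \<ge> 1"
  shows "G $ k = V * (R k + T k)"
proof -
  obtain m where k: "k = Suc m" using assms by (cases k) auto
  have s: "(\<Sum>i\<le>m. H 1 $ i * (of_nat (Suc (m - i)) * G $ Suc (m - i)))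
      = H 1 $ 0 * (of_nat k * G $ k) + (\<Sum>i\<in>{1..<k}. H 1 $ i * (of_nat (k - i) * G $ (k - i)))"
  proof -
    have "(\<Sum>i\<le>m. H 1 $ i * (of_nat (Suc (m - i)) * G $ Suc (m - i))) = (\<Sum>i\<in>{0..<k}. H 1 $ i * (of_nat (k - i) * G $ (k - i)))"
      by (rule sum.cong) (auto simp: k Suc_diff_le)
    also have "\<dots> = H 1 $ 0 * (of_nat (k - 0) * G $ (k - 0)) + (\<Sum>i\<in>{Suc 0..<k}. H 1 $ i * (of_nat (k - i) * G $ (k - i)))"
      by (rule sum.atLeast_Suc_lessThan) (simp add: k)
    finally show ?thesis by simp
  qed
  have c: "fps_const (1 / of_nat k) * (of_nat k * a) = a" for a :: "complex fps"
    unfolding fps_of_nat[symmetric] mult.assoc[symmetric] fps_const_mult using assms by simp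
  have "H 0 $ k = fps_const (1 / of_nat k) * (\<Sum>i\<le>m. H 1 $ i * (of_nat (Suc (m - i)) * G $ Suc (m - i)))"
    using H_Suc'[of 0 m] by (simp only: k One_nat_def)
  also have "\<dots> = fps_const (1 / of_nat k) * (of_nat k * (H 1 $ 0 * G $ k))
      + fps_const (1 / of_nat k) * (\<Sum>i\<in>{1..<k}. H 1 $ i * (of_nat (k - i) * G $ (k - i)))"
    unfolding s by (simp only: distrib_left mult.left_commute)
  finally have "fps_X * H 0 $ k = fps_X * (H 1 $ 0 * G $ k) + R k"
    unfolding c R_def by (simp only: distrib_left mult.left_commute)
  then have "G $ k = fps_X * (fps_deriv \<Phi> oo y) * G $ k + (R k + T k)"
    using G_split[of k] H_0[of 1] by (simp add: add.assoc mult.assoc)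
  then have 1: "G $ k - fps_X * (fps_deriv \<Phi> oo y) * G $ k = R k + T k" by (simp add: algebra_simps)
  have 2: "V - fps_X * (fps_deriv \<Phi> oo y) * V = 1" using V_eq by (simp add: algebra_simps)
  have "G $ k = G $ k * (V - fps_X * (fps_deriv \<Phi> oo y) * V)" by (simp add: 2)
  also have "\<dots> = V * (G $ k - fps_X * (fps_deriv \<Phi> oo y) * G $ k)" by (simp add: algebra_simps)
  finally show ?thesis unfolding 1 .
qed

lemma X_H_0: "fps_X * H 0 $ 0 = y"
  using y_eq by (simp add: H_0)

text \<open>Arranged so that both summands are summable: next to \<open>V\<close> the series
  \<open>y\<close> is replaced by its value 1, and \<open>Y\<close> collects the difference.\<close>

lemma G_1: "G $ 1 = (hadamard g y * V - fps_const \<mu> * V) + fps_const \<mu> * Y"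
proof -
  have "T 1 = hadamard g y - fps_const \<mu> * y"
    unfolding T_def by (rule fps_ext) (simp add: hadamard_nth X_H_0 f_def left_diff_distrib)
  moreover have "R 1 = 0" by (simp add: R_def)
  ultimately have "G $ 1 = V * (hadamard g y - fps_const \<mu> * y)" using G_eq[of 1] by simp
  then show ?thesis by (simp add: Y_def algebra_simps)
qed

lemma hadamard_g_y_decay: "hadamard g y \<in> decay (-1 - (1/2 + \<epsilon>))"
proof -
  have "-1 - (1/2 + \<epsilon>) = -3/2 - \<epsilon>" by simp
  then show ?thesis using hadamard_g_decay[OF y_decay] by (simp only:)
qed

lemma Z_decay: "hadamard g y * V - fps_const \<mu> * V \<in> decay (-1 - \<epsilon>)"
proof -
  have "hadamard g y * V - fps_const \<mu> * V \<in> decay (-1/2 - (1/2 + \<epsilon>))"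
    unfolding \<mu>_def
    by (rule decay_mult_mass[OF hadamard_g_y_decay _ _ V_decay]) (use e e4 V_diff_decay in auto)
  then show ?thesis by simp
qed

lemma G_1_decay: "G $ 1 \<in> decay (-1 - \<epsilon>)"
  unfolding G_1 by (intro decay_add Z_decay decay_const_mult Y_decay_eps)

text \<open>At 1 the product \<open>(hadamard g y - \<mu>) * V\<close> has the form zero times
  infinity. Multiplication by \<open>inv_pow 1\<close> passes to partial sums: they approach the
  value at 1, while \<open>decay_mult_mass\<close>, applied to \<open>V * inv_pow 1\<close>, shows
  that they tend to 0.\<close>

lemma mass_Z: "mass (hadamard g y * V - fps_const \<mu> * V) = 0"
proof -
  let ?Z = "hadamard g y * V - fps_const \<mu> * V" and ?B = "inv_pow 1"
  have "lead \<epsilon> 2 1 ?B" by (simp add: lead_def)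
  from lead_mass_mult[OF Z_decay this e(1) e4] have 1: "lead \<epsilon> 2 (mass ?Z) (?Z * ?B)" by simp
  have VB: "V * ?B \<in> decay (1/2)"
  proof (rule decay_mult[OF V_decay])
    show "?B \<in> decay 0" using inv_pow_decay[of 2] by simp
  qed auto
  have VBeq: "(1 - fps_X) * (V * ?B) = V"
  proof -
    have "(1 - fps_X) * ?B = 1" using one_minus_X_inv_pow[of 1] by (simp add: inv_pow_0)
    then show ?thesis by (metis mult.left_commute mult_1_right)
  qed
  then have dVB: "(1 - fps_X) * (V * ?B) \<in> decay (1/2 - 1)" unfolding VBeq using V_decay by simp
  have "hadamard g y * (V * ?B) - fps_const \<mu> * (V * ?B) \<in> decay (1/2 - (1/2 + \<epsilon>))"
    unfolding \<mu>_def by (rule decay_mult_mass[OF hadamard_g_y_decay _ _ VB dVB]) (use e e4 in auto)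
  moreover have "hadamard g y * (V * ?B) - fps_const \<mu> * (V * ?B) = ?Z * ?B" by (simp add: algebra_simps)
  ultimately have "lead \<epsilon> 2 0 (?Z * ?B)" by (intro lead_negligible) simp
  with 1 show ?thesis by (rule lead_unique) (use e in auto)
qed

text \<open>Of the two summands in \<open>G_1\<close> the first has value 0 at 1, and
  \<open>mass_X_\<Phi>2_Y\<close> turns the second into exactly \<open>\<mu>\<close>. This will
  offset the constant part \<open>- \<mu>\<close> of the toll.\<close>

lemma mass_X_\<Phi>2_G1: "mass (fps_X * \<Phi>2 * G $ 1) = \<mu>"
proof -
  let ?Z = "hadamard g y * V - fps_const \<mu> * V" and ?P = "fps_X * \<Phi>2"
  have P: "?P \<in> decay (-1 - \<epsilon>)" by (intro decay_X_mult \<Phi>2_decay_eps)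
  have "?P * G $ 1 = ?P * ?Z + fps_const \<mu> * (?P * Y)"
    unfolding G_1 by (simp add: algebra_simps)
  also have "mass \<dots> = mass (?P * ?Z) + mass (fps_const \<mu> * (?P * Y))"
    by (rule mass_add[of _ "-1 - \<epsilon>"]) (use e in \<open>auto intro: decay_mult_summable P Z_decay decay_const_mult Y_decay_eps\<close>)
  also have "mass (fps_const \<mu> * (?P * Y)) = \<mu> * mass (?P * Y)"
    by (rule mass_const_mult[of _ "-1 - \<epsilon>"]) (use e in \<open>auto intro: decay_mult_summable P Y_decay_eps\<close>)
  finally show ?thesis
    by (simp add: mass_mult_eps[OF P Z_decay] mass_Z mass_X_\<Phi>2_Y)
qed

text \<open>The start of the recursion and the origin of the variance: \<open>R 2 + T 2\<close> is
  summable, so to leading order \<open>G $ 2\<close> is a multiple of \<open>V\<close>.\<close>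

lemma G_2: "lead \<epsilon> 1 (mass (R 2 + T 2) * of_real c0) (G $ 2)"
proof -
  have H1: "H 1 $ 1 = \<Phi>2 * G $ 1"
    using H_Suc'[of 1 0] by (simp add: H_0 \<Phi>2_def)
  have "R 2 \<in> decay (-1 - \<epsilon>)"
  proof -
    have "{1..<2} = {1::nat}" by auto
    then have "R 2 = fps_const (1/2) * (fps_X * (\<Phi>2 * G $ 1 * G $ 1))" by (simp add: R_def H1[simplified])
    then show ?thesis
      by (simp only:) (intro decay_const_mult decay_X_mult decay_mult_summable \<Phi>2_decay_eps G_1_decay)
  qed
  moreover have "T 2 \<in> decay (-1 - \<epsilon>)"
    unfolding T_def
  proof (intro decay_sum hadamard_f_power_decay)
    fix j :: nat assume j: "j \<in> {..<2}"
    have "G $ i \<in> decay (\<gamma> i)" if "i \<le> j" for i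
    proof -
      have "i = 0 \<or> i = 1" using that j by auto
      then show ?thesis using y_decay G_1_decay by (auto simp: G_0 \<gamma>_def)
    qed
    then have "fps_X * H 0 $ j \<in> decay (\<gamma> j)" by (rule X_H_decay)
    then show "fps_X * H 0 $ j \<in> decay (-1 - \<epsilon>)"
      using j e e4 by (elim decay_mono) (auto simp: \<gamma>_def)
  qed
  ultimately have "R 2 + T 2 \<in> decay (-1 - \<epsilon>)" by (rule decay_add)
  from lead_mass_mult[OF this lead_V e(1) e4] show ?thesis
    using G_eq[of 2] by (simp add: mult.commute)
qed

text \<open>Only a single root toll, at \<open>j = k - 1\<close>, reaches this order, and of that
  only its constant part \<open>- \<mu>\<close>: the part \<open>g\<close> gains a factor
  \<open>n powr (- \<epsilon>)\<close>.\<close>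

lemma T_lead:
  assumes k: "k \<ge> 3" and G: "\<And>i. i < k \<Longrightarrow> G $ i \<in> decay (\<gamma> i)" and l: "lead \<epsilon> (k - 2) d (G $ (k - 1))"
  shows "lead \<epsilon> (k - 2) (- \<mu> * d) (T k)"
proof -
  obtain m where m: "k = Suc m" "m \<ge> 2" using k by (cases k) auto
  have N: "fps_X * H 0 $ j \<in> decay (\<gamma> j)" if "j < k" for j using that by (intro X_H_decay G) auto
  have small: "a \<in> decay (real (k - 2) / 2 - 1 - \<epsilon>)" if "a \<in> decay (\<gamma> (k - 2))" for a
    using that \<gamma>_two_less[OF k] by (rule decay_mono)
  let ?h = "\<lambda>k j. hadamard (\<lambda>n. f n ^ (k - j) / fact (k - j)) (fps_X * H 0 $ j)"
  have low: "(\<Sum>j<m. ?h i j) \<in> decay (real (k - 2) / 2 - 1 - \<epsilon>)" for i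
  proof (rule small, intro decay_sum hadamard_f_power_decay)
    fix j assume j: "j \<in> {..<m}"
    then have "\<gamma> j \<le> \<gamma> (k - 2)" using m by (intro \<gamma>_mono) auto
    then show "fps_X * H 0 $ j \<in> decay (\<gamma> (k - 2))" using N[of j] j m by (auto elim: decay_mono)
  qed
  have "T k = hadamard (\<lambda>n. f n ^ (k - m) / fact (k - m)) (fps_X * H 0 $ m) + (\<Sum>j<m. ?h k j)"
    unfolding T_def m sum.lessThan_Suc by (simp add: add.commute)
  also have "hadamard (\<lambda>n. f n ^ (k - m) / fact (k - m)) (fps_X * H 0 $ m)
     = hadamard g (fps_X * H 0 $ m) - fps_const \<mu> * (fps_X * H 0 $ m)"
    by (rule fps_ext) (simp add: m hadamard_nth f_def left_diff_distrib)
  \<comment> \<open>Brings in \<open>G $ m\<close>, whose leading term is known; the correction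
    \<open>T m\<close> has lower order.\<close>
  also have "fps_X * H 0 $ m = G $ m - T m" using G_split[of m] by simp
  finally have e1: "T k = fps_const (- \<mu>) * G $ (k - 1) + (hadamard g (G $ m - T m) + fps_const \<mu> * T m + (\<Sum>j<m. ?h k j))"
    by (simp add: m algebra_simps fps_const_neg[symmetric] del: fps_const_neg)
  have d1: "hadamard g (G $ m - T m) \<in> decay (real (k - 2) / 2 - 1 - \<epsilon>)"
  proof -
    have "G $ m - T m \<in> decay (\<gamma> m)" using N[of m] G_split[of m] m by simp
    from hadamard_g_decay[OF this] have "hadamard g (G $ m - T m) \<in> decay (\<gamma> m - \<epsilon>)" .
    moreover have "real (k - 2) / 2 - 1 - \<epsilon> = \<gamma> m - \<epsilon>"
      using m by (simp add: \<gamma>_def of_nat_diff diff_divide_distrib)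
    ultimately show ?thesis by (simp only:)
  qed
  have d2: "fps_const \<mu> * T m \<in> decay (real (k - 2) / 2 - 1 - \<epsilon>)"
    unfolding T_def by (rule decay_const_mult, rule low)
  show ?thesis unfolding e1
    by (rule lead_add_negligible[OF lead_const_mult[OF l] decay_add[OF decay_add[OF d1 d2] low]])
qed

text \<open>To leading order a single \<open>G\<close> comes out of \<open>\<Phi>'(G)\<close>,
  multiplied by \<open>\<Phi>''(y)\<close>. The other terms contain \<open>H 2 $ a\<close> with
  \<open>a \<ge> 1\<close> and are smaller by the \<open>\<epsilon>\<close> of
  \<open>H_decay\<close>; for \<open>i = 1\<close> there are none.\<close>

lemma H1_decay:
  assumes G: "\<And>b. 1 \<le> b \<Longrightarrow> b \<le> i \<Longrightarrow> G $ b \<in> decay (\<gamma> b)" and i: "i \<ge> 1"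
  shows "i = 1 \<and> H 1 $ i = \<Phi>2 * G $ i \<or> i \<ge> 2 \<and> H 1 $ i - \<Phi>2 * G $ i \<in> decay (real i / 2 - 3/2 - \<epsilon>)"
proof (cases "i = 1")
  case True
  then show ?thesis using H_Suc'[of 1 0] by (simp add: H_0 \<Phi>2_def)
next
  case False
  then obtain m where m: "i = Suc m" "m \<ge> 1" using i by (cases i) auto
  have c: "fps_const (1 / of_nat i) * (of_nat i * a) = a" for a :: "complex fps"
    unfolding fps_of_nat[symmetric] mult.assoc[symmetric] fps_const_mult using i by simp
  have H20: "H 2 $ 0 = \<Phi>2" by (simp add: H_0 \<Phi>2_def numeral_2_eq_2)
  have "H 1 $ i = fps_const (1 / of_nat i) * (\<Sum>a\<le>m. H 2 $ a * (of_nat (Suc (m - a)) * G $ Suc (m - a)))"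
    using H_Suc'[of 1 m] by (simp only: m Suc_1)
  also have "(\<Sum>a\<le>m. H 2 $ a * (of_nat (Suc (m - a)) * G $ Suc (m - a)))
     = of_nat i * (\<Phi>2 * G $ i) + (\<Sum>a\<in>{1..m}. H 2 $ a * (of_nat (Suc (m - a)) * G $ Suc (m - a)))"
  proof -
    have "{..m} = insert 0 {1..m}" by auto
    then show ?thesis by (simp add: H20 m mult.left_commute)
  qed
  finally have eq: "H 1 $ i - \<Phi>2 * G $ i = fps_const (1 / of_nat i) * (\<Sum>a\<in>{1..m}. H 2 $ a * (of_nat (Suc (m - a)) * G $ Suc (m - a)))"
    by (simp only: distrib_left c) simp
  have "H 2 $ a * (of_nat (Suc (m - a)) * G $ Suc (m - a)) \<in> decay (real i / 2 - 3/2 - \<epsilon>)" if a: "a \<in> {1..m}" for a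
  proof -
    have 1: "H 2 $ a \<in> decay (real (2 + a) / 2 - 2 - \<epsilon>)" using a m by (intro H_decay G) auto
    have 2: "G $ Suc (m - a) \<in> decay (\<gamma> (Suc (m - a)))" using a m by (intro G) auto
    have a1: "real a \<ge> 1" using a by simp
    have r: "real (Suc (m - a)) = real i - real a" using a m by (simp add: of_nat_diff)
    have r2: "real (2 + a) / 2 = 1 + real a / 2" by (simp add: add_divide_distrib)
    have "H 2 $ a * G $ Suc (m - a) \<in> decay (real (2 + a) / 2 - 2 - \<epsilon> + real (Suc (m - a)) / 2 - 1/2)"
      by (rule decay_mult_G[OF 1 2]) (use a1 r2 in linarith)+
    also have "real (2 + a) / 2 - 2 - \<epsilon> + real (Suc (m - a)) / 2 - 1/2 = real i / 2 - 3/2 - \<epsilon>"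
      unfolding r r2 by (simp add: diff_divide_distrib)
    finally show ?thesis by (subst mult.left_commute) (rule decay_of_nat_mult)
  qed
  then have "H 1 $ i - \<Phi>2 * G $ i \<in> decay (real i / 2 - 3/2 - \<epsilon>)"
    unfolding eq by (intro decay_const_mult decay_sum)
  then show ?thesis using m by simp
qed

text \<open>The indices 1 and \<open>k - 1\<close> involve the summable \<open>G $ 1\<close>, which
  acts through \<open>mass_X_\<Phi>2_G1\<close>; the inner indices form the convolution.\<close>

lemma R_lead:
  assumes k: "k \<ge> 3" and G: "\<And>i. i < k \<Longrightarrow> G $ i \<in> decay (\<gamma> i)"
    and l: "\<And>i. 2 \<le> i \<Longrightarrow> i < k \<Longrightarrow> lead \<epsilon> (i - 1) (d i) (G $ i)"
  shows "lead \<epsilon> (k - 2) (\<mu> * d (k - 1) + mass (fps_X * \<Phi>2) / 2 * (\<Sum>i\<in>{2..k-2}. d i * d (k - i))) (R k)"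
proof -
  let ?P = "fps_X * \<Phi>2"
  have P: "?P \<in> decay (-1 - \<epsilon>)" by (intro decay_X_mult \<Phi>2_decay_eps)
  define S where "S = mass ?P"
  \<comment> \<open>The leading coefficient of the term of index \<open>i\<close>, apart from its
    weight \<open>k - i\<close>.\<close>
  define c where "c i = (if i = 1 \<or> i = k - 1 then \<mu> * d (k - 1) else S * (d i * d (k - i)))" for i
  have main: "lead \<epsilon> (k - 2) (of_nat (k - i) * c i) (fps_X * (H 1 $ i * (of_nat (k - i) * G $ (k - i))))"
    if i: "i \<in> {1..<k}" for i
  proof -
    have ki: "1 \<le> k - i" "k - i < k" using i by auto
    have Gk: "G $ (k - i) \<in> decay (\<gamma> (k - i))" by (rule G) (use ki in auto)
    have PG1: "?P * G $ 1 \<in> decay (-1 - \<epsilon>)" by (intro decay_mult_summable P G_1_decay)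
    have k1: "lead \<epsilon> (k - 2) (d (k - 1)) (G $ (k - 1))"
    proof -
      have "lead \<epsilon> (k - 1 - 1) (d (k - 1)) (G $ (k - 1))" by (rule l) (use k in auto)
      moreover have "k - 1 - 1 = k - 2" by simp
      ultimately show ?thesis by (simp only:)
    qed
    have pm: "lead \<epsilon> (k - 2) (\<mu> * d (k - 1)) (?P * G $ 1 * G $ (k - 1))"
      using lead_mass_mult[OF PG1 k1 e(1) e4] k unfolding mass_X_\<Phi>2_G1 by simp
    have 1: "lead \<epsilon> (k - 2) (c i) (?P * G $ i * G $ (k - i))"
    proof -
      consider "i = 1" | "i = k - 1" | "2 \<le> i" "i \<le> k - 2" using i by force
      then show ?thesis
      proof cases
        case 1
        then show ?thesis using pm by (simp add: c_def)
      next
        case 2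
        then have "k - i = 1" using k by simp
        then have "?P * G $ i * G $ (k - i) = ?P * G $ 1 * G $ (k - 1)"
          by (simp only: 2(1)[symmetric] mult_ac)
        moreover have "c i = \<mu> * d (k - 1)" using 2 by (simp add: c_def)
        ultimately show ?thesis using pm by (simp only:)
      next
        case 3
        have "lead \<epsilon> ((i - 1) + (k - i - 1)) (d i * d (k - i)) (G $ i * G $ (k - i))"
          by (rule lead_mult[OF l l e(1) e4]) (use 3 in auto)
        moreover have "(i - 1) + (k - i - 1) = k - 2" using 3 by simp
        ultimately have "lead \<epsilon> (k - 2) (d i * d (k - i)) (G $ i * G $ (k - i))" by simp
        from lead_mass_mult[OF P this e(1) e4]
        have "lead \<epsilon> (k - 2) (S * (d i * d (k - i))) (?P * (G $ i * G $ (k - i)))" using k by (simp add: S_def)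
        moreover have "c i = S * (d i * d (k - i))"
        proof -
          have "i \<noteq> 1" "i \<noteq> k - 1" using 3 k by auto
          then show ?thesis by (simp add: c_def)
        qed
        ultimately show ?thesis by (simp only: mult.assoc)
      qed
    qed
    have 2: "fps_X * ((H 1 $ i - \<Phi>2 * G $ i) * G $ (k - i)) \<in> decay (real (k - 2) / 2 - 1 - \<epsilon>)"
    proof -
      have "i = 1 \<and> H 1 $ i = \<Phi>2 * G $ i \<or> i \<ge> 2 \<and> H 1 $ i - \<Phi>2 * G $ i \<in> decay (real i / 2 - 3/2 - \<epsilon>)"
        by (rule H1_decay) (use i in \<open>auto intro: G\<close>)
      then show ?thesis
      proof (elim disjE conjE)
        assume h: "i \<ge> 2" "H 1 $ i - \<Phi>2 * G $ i \<in> decay (real i / 2 - 3/2 - \<epsilon>)"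
        have i2: "real i \<ge> 2" using h by simp
        have r: "real (k - i) = real k - real i" "real (k - 2) = real k - 2" using i k by (auto simp: of_nat_diff)
        have "(H 1 $ i - \<Phi>2 * G $ i) * G $ (k - i) \<in> decay (real i / 2 - 3/2 - \<epsilon> + real (k - i) / 2 - 1/2)"
          by (rule decay_mult_G[OF h(2) Gk ki(1)]) (use i2 in linarith)
        also have "real i / 2 - 3/2 - \<epsilon> + real (k - i) / 2 - 1/2 = real (k - 2) / 2 - 1 - \<epsilon>"
          unfolding r by (simp add: diff_divide_distrib)
        finally show ?thesis by (rule decay_X_mult)
      qed simp
    qed
    have "fps_X * (H 1 $ i * (of_nat (k - i) * G $ (k - i)))
      = fps_const (of_nat (k - i)) * (?P * G $ i * G $ (k - i) + fps_X * ((H 1 $ i - \<Phi>2 * G $ i) * G $ (k - i)))"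
      by (simp add: fps_of_nat algebra_simps)
    then show ?thesis using lead_const_mult[OF lead_add_negligible[OF 1 2]] by simp
  qed
  have "R k = fps_const (1 / of_nat k) * (\<Sum>i\<in>{1..<k}. fps_X * (H 1 $ i * (of_nat (k - i) * G $ (k - i))))"
    unfolding R_def sum_distrib_left ..
  then have L: "lead \<epsilon> (k - 2) (1 / of_nat k * (\<Sum>i\<in>{1..<k}. of_nat (k - i) * c i)) (R k)"
    by (simp only:) (intro lead_const_mult lead_sum finite_atLeastLessThan main)
  have csym: "c (k - i) = c i" if "i \<in> {1..<k}" for i
    using that by (auto simp: c_def mult.commute)
  \<comment> \<open>By the symmetry of \<open>c\<close> the weights \<open>(k - i) / k\<close>
    average to one half.\<close>
  have "(\<Sum>i\<in>{1..<k}. of_nat (k - i) * c i) = (\<Sum>i\<in>{1..<k}. of_nat i * c i)"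
    by (rule sum.reindex_bij_witness[of _ "\<lambda>i. k - i" "\<lambda>i. k - i"]) (auto simp: csym)
  then have "2 * (\<Sum>i\<in>{1..<k}. of_nat (k - i) * c i) = (\<Sum>i\<in>{1..<k}. of_nat (k - i) * c i + of_nat i * c i)"
    unfolding sum.distrib by simp
  also have "\<dots> = (\<Sum>i\<in>{1..<k}. of_nat k * c i)"
    by (intro sum.cong refl) (simp add: of_nat_diff algebra_simps)
  also have "\<dots> = of_nat k * (\<Sum>i\<in>{1..<k}. c i)" by (simp add: sum_distrib_left)
  finally have "1 / of_nat k * (\<Sum>i\<in>{1..<k}. of_nat (k - i) * c i) = (\<Sum>i\<in>{1..<k}. c i) / 2"
    using k by (simp add: field_simps)
  also have "(\<Sum>i\<in>{1..<k}. c i) = c 1 + c (k - 1) + (\<Sum>i\<in>{2..k-2}. c i)"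
  proof -
    have "{1..<k} = insert 1 (insert (k - 1) {2..k-2})" "1 \<notin> insert (k - 1) {2..k-2}" "k - 1 \<notin> {2..k-2}"
      using k by auto
    then show ?thesis by simp
  qed
  also have "(\<Sum>i\<in>{2..k-2}. c i) = S * (\<Sum>i\<in>{2..k-2}. d i * d (k - i))"
    unfolding sum_distrib_left by (rule sum.cong) (auto simp: c_def)
  also have "(c 1 + c (k - 1) + S * (\<Sum>i\<in>{2..k-2}. d i * d (k - i))) / 2
      = \<mu> * d (k - 1) + S / 2 * (\<Sum>i\<in>{2..k-2}. d i * d (k - i))"
    by (simp add: c_def add_divide_distrib)
  finally show ?thesis using L by (simp only: S_def)
qed

end

text \<open>The square of \<open>(1 + z) powr (1/2)\<close> is \<open>1 + z\<close>, whose
  coefficients of degree at least 2 vanish; separating the two end terms of the convolution produces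
  the factor -2.\<close>

lemma half_gbinomial_convolution:
  assumes "m \<ge> 2"
  shows "(\<Sum>a\<in>{1..m-1}. ((1/2) gchoose a) * ((1/2) gchoose (m - a))) = - 2 * ((1/2 :: complex) gchoose m)"
proof -
  let ?h = "\<lambda>a. (1/2 :: complex) gchoose a"
  have "(\<Sum>a\<in>{0..m}. ?h a * ?h (m - a)) = (1/2 + 1/2) gchoose m"
    by (rule gbinomial_Vandermonde)
  also have "(1/2 + 1/2 :: complex) gchoose m = of_nat (1 choose m)"
    unfolding binomial_gbinomial by simp
  also have "\<dots> = 0" using assms by simp
  also have "{0..m} = insert 0 (insert m {1..m-1})" using assms by auto
  finally show ?thesis using assms by (simp add: eq_neg_iff_add_eq_0 algebra_simps)
qed

lemma decay_ratio_tendsto: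
  fixes b :: "nat \<Rightarrow> complex"
  assumes E: "E \<in> decay \<theta>" and lt: "\<theta> < \<tau>" and c: "c > 0" "\<And>n. n \<ge> N \<Longrightarrow> c * real n powr \<tau> \<le> cmod (b n)"
  shows "(\<lambda>n. E $ n / b n) \<longlonglongrightarrow> 0"
proof -
  obtain C where C: "C > 0" "\<And>n. cmod (E $ n) \<le> C * real (Suc n) powr \<theta>"
    using E by (rule decayE) blast
  define D where "D = C * 2 powr \<bar>\<theta>\<bar> / c"
  have "((\<lambda>n. real n powr (\<theta> - \<tau>)) \<longlongrightarrow> 0) sequentially"
    using lt by (intro tendsto_neg_powr filterlim_real_sequentially) auto
  then have lim: "(\<lambda>n. D * real n powr (\<theta> - \<tau>)) \<longlonglongrightarrow> 0"
    using tendsto_mult[OF tendsto_const[of D]] by fastforce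
  show ?thesis
  proof (rule Lim_null_comparison[OF _ lim])
    show "\<forall>\<^sub>F n in sequentially. norm (E $ n / b n) \<le> D * real n powr (\<theta> - \<tau>)"
      using eventually_ge_at_top[of "max N 1"]
    proof eventually_elim
      case (elim n)
      then have n: "n \<ge> N" "n > 0" by auto
      have "real (Suc n) powr \<theta> \<le> 2 powr \<bar>\<theta>\<bar> * real n powr \<theta>"
        by (rule powr_Suc_le) (use n in simp)
      then have 1: "cmod (E $ n) \<le> C * (2 powr \<bar>\<theta>\<bar> * real n powr \<theta>)"
        using C by (meson order_trans mult_left_mono less_imp_le)
      have cn: "c * real n powr \<tau> > 0" using c n by simp
      have "norm (E $ n / b n) = cmod (E $ n) / cmod (b n)" by (rule norm_divide)
      also have "\<dots> \<le> C * (2 powr \<bar>\<theta>\<bar> * real n powr \<theta>) / (c * real n powr \<tau>)"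
        using 1 c(2)[OF n(1)] cn C by (intro frac_le) auto
      also have "\<dots> = D * (real n powr \<theta> / real n powr \<tau>)" by (simp add: D_def)
      also have "real n powr \<theta> / real n powr \<tau> = real n powr (\<theta> - \<tau>)" by (simp add: powr_diff)
      finally show ?case .
    qed
  qed
qed

section \<open>Solution of the recursion and limits of the moments\<close>

context offspring_toll
begin

text \<open>The coefficient of \<open>u ^ k\<close> in
  \<open>- 2 * c0 * sqrt (1 + \<rho> * u^2)\<close>.\<close>

definition dcoef :: "complex \<Rightarrow> nat \<Rightarrow> complex" where
  "dcoef \<rho> k = (if even k then - 2 * of_real c0 * \<rho> ^ (k div 2) * ((1/2) gchoose (k div 2)) else 0)"

lemma dcoef_convolution:
  assumes "k \<ge> 3"
  shows "(\<Sum>i\<in>{2..k-2}. dcoef \<rho> i * dcoef \<rho> (k - i)) = 4 * of_real c0 * dcoef \<rho> k"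
proof (cases "even k")
  case False
  have "dcoef \<rho> i * dcoef \<rho> (k - i) = 0" if "i \<in> {2..k-2}" for i
    using False that by (auto simp: dcoef_def)
  then have "(\<Sum>i\<in>{2..k-2}. dcoef \<rho> i * dcoef \<rho> (k - i)) = 0" by (intro sum.neutral) auto
  then show ?thesis using False by (simp add: dcoef_def)
next
  case True
  then obtain m where m: "k = 2 * m" by (rule evenE)
  then have m2: "m \<ge> 2" using assms by simp
  have "(\<Sum>i\<in>{2..k-2}. dcoef \<rho> i * dcoef \<rho> (k - i)) = (\<Sum>i\<in>(\<lambda>a. 2 * a) ` {1..m-1}. dcoef \<rho> i * dcoef \<rho> (k - i))"
  proof (rule sum.mono_neutral_right)
    show "\<forall>i\<in>{2..k-2} - (\<lambda>a. 2 * a) ` {1..m-1}. dcoef \<rho> i * dcoef \<rho> (k - i) = 0"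
    proof
      fix i assume i: "i \<in> {2..k-2} - (\<lambda>a. 2 * a) ` {1..m-1}"
      have "odd i"
      proof
        assume "even i"
        then obtain a where "i = 2 * a" by (rule evenE)
        then have "i \<in> (\<lambda>a. 2 * a) ` {1..m-1}" using i m by (intro image_eqI[of _ _ a]) auto
        then show False using i by simp
      qed
      then show "dcoef \<rho> i * dcoef \<rho> (k - i) = 0" by (simp add: dcoef_def)
    qed
  qed (use m in auto)
  also have "\<dots> = (\<Sum>a\<in>{1..m-1}. dcoef \<rho> (2 * a) * dcoef \<rho> (k - 2 * a))"
    by (subst sum.reindex) (auto simp: inj_on_def)
  also have "\<dots> = (\<Sum>a\<in>{1..m-1}. 4 * (of_real c0)\<^sup>2 * \<rho> ^ m * (((1/2) gchoose a) * ((1/2) gchoose (m - a))))"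
  proof (rule sum.cong[OF refl])
    fix a assume a: "a \<in> {1..m-1}"
    have "k - 2 * a = 2 * (m - a)" using m by simp
    moreover have "\<rho> ^ m = \<rho> ^ a * \<rho> ^ (m - a)"
    proof -
      have "a + (m - a) = m" using a by auto
      then show ?thesis by (metis power_add)
    qed
    ultimately show "dcoef \<rho> (2 * a) * dcoef \<rho> (k - 2 * a) = 4 * (of_real c0)\<^sup>2 * \<rho> ^ m * (((1/2) gchoose a) * ((1/2) gchoose (m - a)))"
      by (simp add: dcoef_def power2_eq_square mult_ac)
  qed
  also have "\<dots> = 4 * of_real c0 * dcoef \<rho> k"
    unfolding sum_distrib_left[symmetric] half_gbinomial_convolution[OF m2]
    by (simp add: dcoef_def m power2_eq_square mult_ac)
  finally show ?thesis .
qed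

lemma G_lead: "\<exists>\<rho>. \<forall>k\<ge>2. lead \<epsilon> (k - 1) (dcoef \<rho> k) (G $ k)"
proof -
  \<comment> \<open>Chosen so that \<open>dcoef \<rho> 2\<close> agrees with \<open>G_2\<close>; the
    limiting second moment will be \<open>- 2 * \<rho>\<close>.\<close>
  define \<rho> where "\<rho> = - mass (R 2 + T 2)"
  have "lead \<epsilon> (k - 1) (dcoef \<rho> k) (G $ k)" if "k \<ge> 2" for k
    using that
  proof (induction k rule: less_induct)
    case (less k)
    show ?case
    proof (cases "k = 2")
      case True
      have "dcoef \<rho> 2 = mass (R 2 + T 2) * of_real c0" by (simp add: dcoef_def \<rho>_def)
      then show ?thesis using G_2 True by simp
    next
      case False
      then have k: "k \<ge> 3" using less.prems by simp
      have l: "lead \<epsilon> (i - 1) (dcoef \<rho> i) (G $ i)" if "2 \<le> i" "i < k" for i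
        using that by (intro less.IH) auto
      have Gd: "G $ i \<in> decay (\<gamma> i)" if "i < k" for i
      proof -
        consider "i = 0" | "i = 1" | "i \<ge> 2" by linarith
        then show ?thesis
        proof cases
          case 3
          have "G $ i \<in> decay (real (i - 1) / 2 - 1)" using lead_decay[OF l[OF 3 that]] e by simp
          moreover have "real (i - 1) / 2 - 1 = \<gamma> i" using 3 by (simp add: \<gamma>_def of_nat_diff diff_divide_distrib)
          ultimately show ?thesis by simp
        qed (use y_decay G_1_decay in \<open>simp_all add: G_0 \<gamma>_def\<close>)
      qed
      have "lead \<epsilon> (k - 1 - 1) (dcoef \<rho> (k - 1)) (G $ (k - 1))" by (rule l) (use k in auto)
      moreover have "k - 1 - 1 = k - 2" by simp
      ultimately have "lead \<epsilon> (k - 2) (dcoef \<rho> (k - 1)) (G $ (k - 1))" by (simp only:)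
      note TT = T_lead[OF k Gd this]
      define S where "S = mass (fps_X * \<Phi>2)"
      have RR: "lead \<epsilon> (k - 2) (\<mu> * dcoef \<rho> (k - 1) + S / 2 * (4 * of_real c0 * dcoef \<rho> k)) (R k)"
        using R_lead[OF k Gd l] unfolding dcoef_convolution[OF k] S_def by blast
      have "lead \<epsilon> (k - 2) (S / 2 * (4 * of_real c0 * dcoef \<rho> k)) (R k + T k)"
        using lead_add[OF RR TT] by simp
      from lead_mult[OF lead_V this e(1) e4]
      have "lead \<epsilon> (1 + (k - 2)) (of_real c0 * (S / 2 * (4 * of_real c0 * dcoef \<rho> k))) (V * (R k + T k))"
        using k by simp
      moreover have "1 + (k - 2) = k - 1" using k by simp
      \<comment> \<open>The accumulated factor is \<open>2 * c0^2 * S\<close>, which is 1 by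
        \<open>c0_square\<close>.\<close>
      moreover have "of_real c0 * (S / 2 * (4 * of_real c0 * dcoef \<rho> k)) = dcoef \<rho> k"
      proof -
        have "of_real c0 * (S / 2 * (4 * of_real c0 * dcoef \<rho> k)) = 2 * ((of_real c0)\<^sup>2 * S) * dcoef \<rho> k"
          by (simp add: power2_eq_square)
        then show ?thesis using c0_square by (simp add: S_def)
      qed
      moreover have "V * (R k + T k) = G $ k" using G_eq[of k] k by simp
      ultimately show ?thesis by (simp only:)
    qed
  qed
  then show ?thesis by blast
qed

text \<open>\<open>n\<close> times the size probability is a coefficient of \<open>y * V\<close>,
  and \<open>y * V\<close> differs negligibly from \<open>V\<close>. Stated relative to
  \<open>half_binom\<close>, it combines with \<open>inv_pow_ratio_tendsto\<close>.\<close>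

lemma gw_size_prob_ratio:
  "(\<lambda>n. complex_of_real (half_binom n / (real n * gw_size_prob p n))) \<longlonglongrightarrow> 1 / of_real c0"
proof -
  obtain c where c: "c > 0" "\<And>n. n \<ge> 2 \<Longrightarrow> c * real n powr (-1/2) \<le> half_binom n"
    using half_binom_lower by auto
  have E: "y * V - fps_const (of_real c0) * inv_pow (1/2) \<in> decay (-1/2 - \<delta>/2)"
  proof -
    have "Y \<in> decay (-1/2 - \<delta>/2)" using Y_decay by (rule decay_mono) auto
    from decay_diff[OF c0(2) this] show ?thesis by (simp add: Y_def)
  qed
  have r0: "(\<lambda>n. (y * V - fps_const (of_real c0) * inv_pow (1/2)) $ n / of_real (half_binom n)) \<longlonglongrightarrow> 0"
  proof (rule decay_ratio_tendsto[OF E _ c(1)])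
    show "c * real n powr (-1/2) \<le> cmod (of_real (half_binom n))" if "n \<ge> 2" for n
      unfolding norm_of_real using c(2)[OF that] by linarith
  qed (use delta in simp)
  have "(y * V - fps_const (of_real c0) * inv_pow (1/2)) $ n / of_real (half_binom n) + of_real c0
      = complex_of_real (real n * gw_size_prob p n / half_binom n)" for n
  proof -
    have hb: "complex_of_real (half_binom n) \<noteq> 0" using half_binom_pos[of n] by (metis of_real_eq_0_iff less_irrefl)
    have "(y * V) $ n = of_real (real n * gw_size_prob p n)"
    proof -
      have "y $ n = of_real (gw_size_prob p n)" by (simp add: y_def)
      then show ?thesis using euler_nth[of y n] by (simp add: euler_y)
    qed
    then have "(y * V - fps_const (of_real c0) * inv_pow (1/2)) $ n
        = of_real (real n * gw_size_prob p n) - of_real c0 * of_real (half_binom n)"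
      by (simp only: fps_sub_nth fps_mult_left_const_nth inv_pow_nth)
    then show ?thesis using hb by (simp only: diff_divide_distrib of_real_divide) simp
  qed
  with tendsto_add[OF r0 tendsto_const[of "of_real c0"]]
  have "(\<lambda>n. complex_of_real (real n * gw_size_prob p n / half_binom n)) \<longlonglongrightarrow> of_real c0" by simp
  from tendsto_inverse[OF this] c0(1)
  have "(\<lambda>n. inverse (complex_of_real (real n * gw_size_prob p n / half_binom n))) \<longlonglongrightarrow> inverse (of_real c0)" by simp
  moreover have "inverse (complex_of_real (a / b)) = complex_of_real (b / a)" for a b :: real
    by (simp flip: of_real_inverse)
  ultimately show ?thesis by (simp only: inverse_eq_divide)
qed

definition moment :: "nat \<Rightarrow> nat \<Rightarrow> complex" where
  "moment k n = cond_expect p n (\<lambda>t. toll_sum f t ^ k) / complex_of_real (real n powr (real k / 2))"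

definition nrm :: "nat \<Rightarrow> nat \<Rightarrow> complex" where
  "nrm k n = complex_of_real (gw_size_prob p n * real n powr (real k / 2))"

lemma moment_eq: "moment k n = fact k * (G $ k $ n / nrm k n)"
proof -
  have "(\<Sum>t\<in>trees_of_size n. complex_of_real (gw_weight p t) * toll_sum f t ^ k) = fact k * (G $ k $ n)"
    by (simp add: G_def tree_moments_def sum_distrib_left)
  then show ?thesis by (simp add: moment_def cond_expect_def nrm_def)
qed

lemma nrm_lower: "\<exists>c>0. \<exists>N. \<forall>k. \<forall>n\<ge>N. c * real n powr (real k / 2 - 3/2) \<le> cmod (nrm k n)"
proof -
  obtain c N where c: "c > 0" "N > 0" "\<And>n. n \<ge> N \<Longrightarrow> c * real n powr (-3/2) \<le> gw_size_prob p n"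
    using gw_size_prob_lower by auto
  have "c * real n powr (real k / 2 - 3/2) \<le> cmod (nrm k n)" if "n \<ge> N" for n k
  proof -
    have "c * real n powr (real k / 2 - 3/2) = c * real n powr (-3/2) * real n powr (real k / 2)"
      unfolding mult.assoc by (subst powr_add[symmetric]) (simp add: algebra_simps)
    also have "\<dots> \<le> gw_size_prob p n * real n powr (real k / 2)"
      using c that by (intro mult_right_mono) auto
    also have "\<dots> = cmod (nrm k n)"
      unfolding nrm_def norm_of_real using gw_size_prob_nonneg by simp
    finally show ?thesis .
  qed
  with c show ?thesis by blast
qed

lemma negligible_moment:
  assumes "E \<in> decay \<theta>" "\<theta> < real k / 2 - 3/2"
  shows "(\<lambda>n. E $ n / nrm k n) \<longlonglongrightarrow> 0"
proof -
  obtain c N where c: "c > 0" "\<And>k n. n \<ge> N \<Longrightarrow> c * real n powr (real k / 2 - 3/2) \<le> cmod (nrm k n)"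
    using nrm_lower by blast
  show ?thesis by (rule decay_ratio_tendsto[OF assms c])
qed

lemma main_moment:
  assumes "m \<ge> 1"
  shows "(\<lambda>n. inv_pow (real (2 * m - 1) / 2) $ n / nrm (2 * m) n) \<longlonglongrightarrow> 1 / (of_real (pochhammer (1/2) (m - 1)) * of_real c0)"
proof -
  let ?r = "\<lambda>n. pochhammer (1/2 + real (m - 1)) n / fact n / (half_binom n * real n ^ (m - 1))"
  have b: "real (2 * m - 1) / 2 = 1/2 + real (m - 1)" using assms by (simp add: of_nat_diff field_simps)
  have "(\<lambda>n. complex_of_real (?r n) * complex_of_real (half_binom n / (real n * gw_size_prob p n)))
     \<longlonglongrightarrow> of_real (1 / pochhammer (1/2) (m - 1)) * (1 / of_real c0)"
    by (intro tendsto_mult tendsto_of_real inv_pow_ratio_tendsto gw_size_prob_ratio)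
  moreover have "\<forall>\<^sub>F n in sequentially. complex_of_real (?r n) * complex_of_real (half_binom n / (real n * gw_size_prob p n))
       = inv_pow (real (2 * m - 1) / 2) $ n / nrm (2 * m) n"
    using eventually_gt_at_top[of 0]
  proof eventually_elim
    case (elim n)
    have hb: "half_binom n \<noteq> 0" using half_binom_pos[of n] by linarith
    have pw: "real n powr (real (2 * m) / 2) = real n ^ (m - 1) * real n"
    proof -
      have "real n powr (real (2 * m) / 2) = real n ^ m" using elim by (simp add: powr_realpow)
      also have "\<dots> = real n ^ (m - 1) * real n" using assms by (cases m) auto
      finally show ?thesis .
    qed
    have a: "(x / (h * z)) * (h / (w * q)) = x / (q * (z * w))" if "h \<noteq> 0" for x h z w q :: real
      using that by (simp add: field_simps)
    have "?r n * (half_binom n / (real n * gw_size_prob p n))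
       = pochhammer (1/2 + real (m - 1)) n / fact n / (gw_size_prob p n * (real n ^ (m - 1) * real n))"
      by (rule a[OF hb])
    then show ?case unfolding b inv_pow_nth nrm_def pw of_real_mult[symmetric] of_real_divide[symmetric] by (simp only:)
  qed
  ultimately show ?thesis by (rule_tac Lim_transform_eventually) auto
qed

text \<open>These are the moments of a centred Gaussian with variance \<open>- 2 * \<rho>\<close>, a
  possibly complex number. One \<open>\<rho>\<close> serves all \<open>k\<close>.\<close>

theorem moment_tendsto:
  "\<exists>\<rho>. \<forall>k. moment k \<longlonglongrightarrow> (if even k then fact k / fact (k div 2) * (- \<rho>) ^ (k div 2) else 0)"
proof -
  obtain \<rho> where \<rho>: "\<And>k. k \<ge> 2 \<Longrightarrow> lead \<epsilon> (k - 1) (dcoef \<rho> k) (G $ k)" using G_lead by blast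
  have "moment k \<longlonglongrightarrow> (if even k then fact k / fact (k div 2) * (- \<rho>) ^ (k div 2) else 0)" for k
  proof -
    consider "k = 0" | "k = 1" | "k \<ge> 2" by linarith
    then show ?thesis
    proof cases
      case 1
      obtain c N where c: "c > 0" "N > 0" "\<And>n. n \<ge> N \<Longrightarrow> c * real n powr (-3/2) \<le> gw_size_prob p n"
        using gw_size_prob_lower by auto
      \<comment> \<open>\<open>cond_expect\<close> divides by the probability of size
        \<open>n\<close>, so the moment of order 0 is 1 only where that is positive.\<close>
      have "\<forall>\<^sub>F n in sequentially. 1 = moment 0 n"
        using eventually_ge_at_top[of N]
      proof eventually_elim
        case (elim n)
        then have n0: "n > 0" using c by simp
        then have "c * real n powr (-3/2) > 0" using c by simp
        then have "gw_size_prob p n > 0" using c(3)[OF elim] by linarith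
        then show ?case using n0 by (simp add: moment_eq G_0 y_def nrm_def)
      qed
      then have "moment 0 \<longlonglongrightarrow> 1" by (rule Lim_transform_eventually[OF tendsto_const])
      then show ?thesis using 1 by simp
    next
      case 2
      have "(\<lambda>n. G $ 1 $ n / nrm 1 n) \<longlonglongrightarrow> 0"
        by (rule negligible_moment[OF G_1_decay]) (use e in simp)
      then show ?thesis using 2 unfolding moment_eq by simp
    next
      case 3
      let ?E = "G $ k - fps_const (dcoef \<rho> k) * inv_pow (real (k - 1) / 2)"
      have "?E \<in> decay (real (k - 1) / 2 - 1 - \<epsilon>)" using \<rho>[OF 3] unfolding lead_def .
      moreover have "real (k - 1) / 2 - 1 - \<epsilon> < real k / 2 - 3/2" using 3 e by (simp add: of_nat_diff diff_divide_distrib)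
      ultimately have E: "(\<lambda>n. ?E $ n / nrm k n) \<longlonglongrightarrow> 0" by (rule negligible_moment)
      have split: "moment k n = fact k * (?E $ n / nrm k n + dcoef \<rho> k * (inv_pow (real (k - 1) / 2) $ n / nrm k n))" for n
        by (simp add: moment_eq add_divide_distrib[symmetric] diff_divide_distrib)
      show ?thesis
      proof (cases "even k")
        case False
        have "(\<lambda>n. fact k * (?E $ n / nrm k n)) \<longlonglongrightarrow> fact k * 0" by (intro tendsto_mult tendsto_const E)
        then show ?thesis using False by (simp add: moment_eq[abs_def] dcoef_def)
      next
        case True
        then obtain m where m: "k = 2 * m" by (rule evenE)
        then have m1: "m \<ge> 1" using 3 by simp
        have "(\<lambda>n. fact k * (?E $ n / nrm k n + dcoef \<rho> k * (inv_pow (real (k - 1) / 2) $ n / nrm k n)))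
          \<longlonglongrightarrow> fact k * (0 + dcoef \<rho> k * (1 / (of_real (pochhammer (1/2) (m - 1)) * of_real c0)))"
          unfolding m by (intro tendsto_mult tendsto_add tendsto_const E[unfolded m] main_moment m1)
        then have L: "moment k \<longlonglongrightarrow> fact k * (dcoef \<rho> k * (1 / (of_real (pochhammer (1/2) (m - 1)) * of_real c0)))"
          by (simp add: split[abs_def])
        have ph: "complex_of_real (pochhammer (1/2) (m - 1)) = pochhammer (1/2) (m - 1)"
          by (simp add: pochhammer_of_real[symmetric])
        have pnz: "pochhammer (1/2 :: complex) (m - 1) \<noteq> 0"
          unfolding ph[symmetric] using pochhammer_pos[of "1/2 :: real" "m - 1"] by (simp del: ph)
        \<comment> \<open>Splitting off the first factor of the rising factorial at
          \<open>-1/2\<close> exposes the one at \<open>1/2\<close>, which cancels the denominator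
          from \<open>main_moment\<close>.\<close>
        have h: "((1/2 :: complex) gchoose m) = (- 1) ^ m * (- 1/2 * pochhammer (1/2) (m - 1)) / fact m"
        proof -
          obtain l where l: "m = Suc l" using m1 by (cases m) auto
          have "(1/2 :: complex) gchoose m = (- 1) ^ m * pochhammer (- (1/2)) m / fact m" by (rule gbinomial_pochhammer)
          also have "pochhammer (- (1/2) :: complex) m = - (1/2) * pochhammer (- (1/2) + 1) (m - 1)"
            unfolding l pochhammer_rec by simp
          finally show ?thesis by simp
        qed
        have "dcoef \<rho> k * (1 / (of_real (pochhammer (1/2) (m - 1)) * of_real c0)) = (- \<rho>) ^ m / fact m"
        proof -
          have a: "- 2 * c * r * (s * (- 1/2 * q) / w) * (1 / (q * c)) = s * r / w" if "c \<noteq> 0" "q \<noteq> 0" for c r s q w :: complex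
            using that by simp
          have "(- \<rho>) ^ m = (- 1) ^ m * \<rho> ^ m" by (rule power_minus)
          moreover have "dcoef \<rho> k = - 2 * of_real c0 * \<rho> ^ m * ((1/2) gchoose m)" by (simp add: dcoef_def m)
          moreover have "complex_of_real c0 \<noteq> 0" using c0(1) by simp
          ultimately show ?thesis unfolding ph h using a pnz by (simp only:)
        qed
        then show ?thesis using L by (simp add: m)
      qed
    qed
  qed
  then show ?thesis by blast
qed

end

section \<open>Joint moments\<close>

text \<open>Combining the values at \<open>2 * s\<close> and \<open>s\<close> eliminates the top
  coefficient and multiplies the others by nonzero constants, so the degree drops by one.\<close>

lemma poly_coeff_tendsto_0:
  fixes a :: "nat \<Rightarrow> nat \<Rightarrow> complex"
  assumes "\<And>s. (\<lambda>n. \<Sum>r\<le>k. a r n * s ^ r) \<longlonglongrightarrow> 0" "r \<le> k"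
  shows "a r \<longlonglongrightarrow> 0"
  using assms
proof (induction k arbitrary: a r)
  case 0
  then show ?case using "0.prems"(1)[of 0] by simp
next
  case (Suc k)
  have low: "a r \<longlonglongrightarrow> 0" if r: "r \<le> k" for r
  proof -
    let ?b = "\<lambda>r n. (2 ^ r - 2 ^ Suc k) * a r n"
    have "(\<lambda>n. \<Sum>r\<le>k. ?b r n * s ^ r) \<longlonglongrightarrow> 0" for s
    proof -
      have "(\<lambda>n. (\<Sum>r\<le>Suc k. a r n * (2 * s) ^ r) - 2 ^ Suc k * (\<Sum>r\<le>Suc k. a r n * s ^ r)) \<longlonglongrightarrow> 0 - 2 ^ Suc k * 0"
        by (intro tendsto_diff tendsto_mult tendsto_const Suc.prems(1))
      moreover have "(\<Sum>r\<le>Suc k. a r n * (2 * s) ^ r) - 2 ^ Suc k * (\<Sum>r\<le>Suc k. a r n * s ^ r) = (\<Sum>r\<le>k. ?b r n * s ^ r)" for n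
      proof -
        have "(\<Sum>r\<le>Suc k. a r n * (2 * s) ^ r) - 2 ^ Suc k * (\<Sum>r\<le>Suc k. a r n * s ^ r)
          = (\<Sum>r\<le>Suc k. a r n * (2 * s) ^ r - 2 ^ Suc k * (a r n * s ^ r))"
          by (simp only: sum_distrib_left sum_subtractf)
        also have "\<dots> = (\<Sum>r\<le>Suc k. ?b r n * s ^ r)"
          by (rule sum.cong[OF refl]) (simp only: power_mult_distrib left_diff_distrib right_diff_distrib mult_ac)
        also have "\<dots> = (\<Sum>r\<le>k. ?b r n * s ^ r)" by simp
        finally show ?thesis .
      qed
      ultimately show ?thesis by simp
    qed
    then have "(\<lambda>n. ?b r n) \<longlonglongrightarrow> 0" using r by (rule Suc.IH)
    then have "(\<lambda>n. inverse (2 ^ r - 2 ^ Suc k) * ?b r n) \<longlonglongrightarrow> inverse (2 ^ r - 2 ^ Suc k) * 0"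
      by (intro tendsto_mult tendsto_const)
    moreover have "(2 ^ r - 2 ^ Suc k :: complex) \<noteq> 0"
    proof
      assume "(2 ^ r - 2 ^ Suc k :: complex) = 0"
      then have "(of_nat (2 ^ r) :: complex) = of_nat (2 ^ Suc k)" by simp
      then have "(2::nat) ^ r = 2 ^ Suc k" by (simp only: of_nat_eq_iff)
      then show False using r by (simp only: power_inject_exp)
    qed
    ultimately show ?thesis by (simp add: mult.assoc[symmetric])
  qed
  show ?case
  proof (cases "r \<le> k")
    case False
    then have r: "r = Suc k" using Suc.prems(2) by simp
    have "(\<lambda>n. (\<Sum>i\<le>Suc k. a i n * 1 ^ i) - (\<Sum>i\<le>k. a i n)) \<longlonglongrightarrow> 0 - (\<Sum>i\<le>k. 0)"
      by (intro tendsto_diff Suc.prems(1) tendsto_sum low) auto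
    then show ?thesis by (simp add: r)
  qed (rule low)
qed

lemma poly_coeff_tendsto:
  fixes a :: "nat \<Rightarrow> nat \<Rightarrow> complex"
  assumes "\<And>s. (\<lambda>n. \<Sum>r\<le>k. a r n * s ^ r) \<longlonglongrightarrow> (\<Sum>r\<le>k. b r * s ^ r)" "r \<le> k"
  shows "a r \<longlonglongrightarrow> b r"
proof -
  have "(\<lambda>n. \<Sum>r\<le>k. (a r n - b r) * s ^ r) \<longlonglongrightarrow> 0" for s
  proof -
    have "(\<lambda>n. (\<Sum>r\<le>k. a r n * s ^ r) - (\<Sum>r\<le>k. b r * s ^ r)) \<longlonglongrightarrow> 0"
      using tendsto_diff[OF assms(1)[of s] tendsto_const[of "\<Sum>r\<le>k. b r * s ^ r"]] by simp
    then show ?thesis by (simp add: left_diff_distrib sum_subtractf)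
  qed
  from poly_coeff_tendsto_0[of "\<lambda>r n. a r n - b r" k, OF this assms(2)] show ?thesis
    by (rule LIM_zero_cancel)
qed

text \<open>At \<open>a = 0\<close> truncated subtraction gives \<open>dfact 0 = 1\<close>, in
  agreement with the convention for \<open>(-1)!!\<close>.\<close>

lemma dfact_odd: "(of_nat (dfact (2 * a - 1)) :: complex) = fact (2 * a) / (2 ^ a * fact a)"
proof (induction a)
  case (Suc a)
  have "dfact (2 * Suc a - 1) = (2 * a + 1) * dfact (2 * a - 1)"
  proof (cases a)
    case (Suc b)
    then have "2 * Suc a - 1 = Suc (Suc (2 * a - 1))" "Suc (Suc (2 * a - 1)) = 2 * a + 1" by auto
    then have "dfact (2 * Suc a - 1) = dfact (Suc (Suc (2 * a - 1)))" by (simp only:)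
    also have "\<dots> = Suc (Suc (2 * a - 1)) * dfact (2 * a - 1)" by (rule dfact.simps(3))
    finally show ?thesis using Suc by simp
  qed simp
  then have "(of_nat (dfact (2 * Suc a - 1)) :: complex) = of_nat (2 * a + 1) * (fact (2 * a) / (2 ^ a * fact a))"
    by (simp only: of_nat_mult Suc.IH)
  also have "\<dots> = fact (2 * Suc a) / (2 ^ Suc a * fact (Suc a))"
  proof -
    have f: "(fact (2 * Suc a) :: complex) = of_nat (2 * a + 1) * (2 * of_nat (Suc a)) * fact (2 * a)"
    proof -
      have "2 * Suc a = Suc (Suc (2 * a))" by simp
      moreover have "(fact (Suc (Suc (2 * a))) :: complex) = of_nat (Suc (Suc (2 * a))) * (of_nat (Suc (2 * a)) * fact (2 * a))"
        by (simp only: fact_Suc)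
      moreover have "(of_nat (Suc (Suc (2 * a))) :: complex) = 2 * of_nat (Suc a)" by simp
      moreover have "Suc (2 * a) = 2 * a + 1" by simp
      ultimately show ?thesis by (simp only: mult_ac)
    qed
    have nz: "(of_nat (Suc a) :: complex) \<noteq> 0" "(2 ^ a :: complex) \<noteq> 0" "(fact a :: complex) \<noteq> 0"
      by (simp_all only: of_nat_eq_0_iff) simp_all
    have "x * (w / (p * q)) = x * (2 * z) * w / (2 * p * (z * q))" if "z \<noteq> 0" for x w p q z :: complex
      using that by (cases "p = 0 \<or> q = 0") (auto simp: field_simps)
    from this[OF nz(1)] show ?thesis unfolding f power_Suc fact_Suc .
  qed
  finally show ?case .
qed simp

text \<open>Wick's formula for the moment of order \<open>(l, r)\<close> of a centred Gaussian pair
  with variances \<open>A\<close>, \<open>C\<close> and covariance \<open>B\<close>;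
  \<open>j\<close> counts the mixed pairs.\<close>

definition gauss_coeff :: "complex \<Rightarrow> complex \<Rightarrow> complex \<Rightarrow> nat \<Rightarrow> nat \<Rightarrow> complex" where
  "gauss_coeff A B C l r = (\<Sum>j\<in>{j. j \<le> min l r \<and> j mod 2 = l mod 2}.
            of_nat (l choose j) * of_nat (r choose j) * of_nat (fact j)
            * of_nat (dfact (l - j - 1)) * of_nat (dfact (r - j - 1))
            * B ^ j * A ^ ((l - j) div 2) * C ^ ((r - j) div 2))"

text \<open>\<open>a\<close> and \<open>c\<close> count the pure pairs of each kind. Expressed in
  factorials, both sides are the same multinomial coefficient times powers.\<close>

lemma gauss_coeff_term:
  fixes A B C :: complex
  assumes l: "l = j + 2 * a" and r: "r = j + 2 * c" and m: "m = j + a + c"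
  shows "of_nat (2 * m choose r) * (of_nat (l choose j) * of_nat (r choose j) * of_nat (fact j)
            * of_nat (dfact (l - j - 1)) * of_nat (dfact (r - j - 1)) * B ^ j * A ^ ((l - j) div 2) * C ^ ((r - j) div 2))
     = fact (2 * m) / (fact m * 2 ^ m) * (of_nat (m choose j) * of_nat (m - j choose c) * (2 * B) ^ j * A ^ a * C ^ c)"
proof -
  have d: "(of_nat (dfact (l - j - 1)) :: complex) = fact (2 * a) / (2 ^ a * fact a)"
    "(of_nat (dfact (r - j - 1)) :: complex) = fact (2 * c) / (2 ^ c * fact c)"
    using dfact_odd[of a] dfact_odd[of c] by (simp_all add: l r)
  have b1: "(of_nat (2 * m choose r) :: complex) = fact (2 * m) / (fact r * fact l)"
    by (subst binomial_fact) (auto simp: l r m)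
  have b2: "(of_nat (l choose j) :: complex) = fact l / (fact j * fact (2 * a))"
    by (subst binomial_fact) (auto simp: l)
  have b3: "(of_nat (r choose j) :: complex) = fact r / (fact j * fact (2 * c))"
    by (subst binomial_fact) (auto simp: r)
  have b4: "(of_nat (m choose j) :: complex) = fact m / (fact j * fact (a + c))"
    by (subst binomial_fact) (auto simp: m)
  have b5: "(of_nat (m - j choose c) :: complex) = fact (a + c) / (fact c * fact a)"
    by (subst binomial_fact) (auto simp: m)
  have e: "(l - j) div 2 = a" "(r - j) div 2 = c" by (simp_all add: l r)
  have p: "(2::complex) ^ m = 2 ^ j * 2 ^ a * 2 ^ c" by (simp add: m power_add)
  define fm fr fl fj fa fc fa2 fc2 fac f2m where "fm = (fact m :: complex)" "fr = (fact r :: complex)" "fl = (fact l :: complex)"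
    "fj = (fact j :: complex)" "fa = (fact a :: complex)" "fc = (fact c :: complex)" "fa2 = (fact (2 * a) :: complex)"
    "fc2 = (fact (2 * c) :: complex)" "fac = (fact (a + c) :: complex)" "f2m = (fact (2 * m) :: complex)"
  note defs = this
  have nz: "fm \<noteq> 0" "fr \<noteq> 0" "fl \<noteq> 0" "fj \<noteq> 0" "fa \<noteq> 0" "fc \<noteq> 0" "fa2 \<noteq> 0" "fc2 \<noteq> 0" "fac \<noteq> 0" "f2m \<noteq> 0"
    by (simp_all add: defs)
  have "(f2m / (fr * fl)) * ((fl / (fj * fa2)) * (fr / (fj * fc2)) * fj * (fa2 / (2 ^ a * fa)) * (fc2 / (2 ^ c * fc)) * B ^ j * A ^ a * C ^ c)
    = f2m / (fm * (2 ^ j * 2 ^ a * 2 ^ c)) * ((fm / (fj * fac)) * (fac / (fc * fa)) * (2 ^ j * B ^ j) * A ^ a * C ^ c)"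
    using nz by (simp add: field_simps)
  then show ?thesis
    unfolding d b1 b2 b3 b4 b5 e p power_mult_distrib of_nat_fact defs .
qed

text \<open>The moment of order \<open>2 * m\<close> of a sum \<open>Z1 + s * Z2\<close>, whose
  variance is \<open>A + 2 * s * B + s^2 * C\<close>, is expanded in powers of
  \<open>s\<close>.\<close>

lemma gauss_coeff_expansion:
  fixes A B C s :: complex
  shows "fact (2 * m) / fact m * ((A + 2 * s * B + s\<^sup>2 * C) / 2) ^ m
    = (\<Sum>r\<le>2 * m. (of_nat (2 * m choose r) * gauss_coeff A B C (2 * m - r) r) * s ^ r)"
proof -
  let ?K = "fact (2 * m) / (fact m * 2 ^ m) :: complex"
  let ?J = "\<lambda>r. {j. j \<le> min (2 * m - r) r \<and> j mod 2 = (2 * m - r) mod 2}"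
  let ?t = "\<lambda>j c. ?K * (of_nat (m choose j) * of_nat (m - j choose c) * (2 * B) ^ j * A ^ (m - j - c) * C ^ c) * s ^ (j + 2 * c)"
  have "((A + s\<^sup>2 * C) + 2 * s * B) ^ m = (2 * s * B + (s\<^sup>2 * C + A)) ^ m" by (simp add: algebra_simps)
  also have "\<dots> = (\<Sum>j\<le>m. of_nat (m choose j) * (2 * s * B) ^ j * (s\<^sup>2 * C + A) ^ (m - j))"
    by (rule binomial_ring)
  also have "\<dots> = (\<Sum>j\<le>m. \<Sum>c\<le>m - j. of_nat (m choose j) * (2 * s * B) ^ j * (of_nat (m - j choose c) * (s\<^sup>2 * C) ^ c * A ^ (m - j - c)))"
    unfolding binomial_ring[of "s\<^sup>2 * C" A] sum_distrib_left ..
  finally have exp: "((A + s\<^sup>2 * C) + 2 * s * B) ^ m = (\<Sum>j\<le>m. \<Sum>c\<le>m - j. of_nat (m choose j) * (2 * s * B) ^ j * (of_nat (m - j choose c) * (s\<^sup>2 * C) ^ c * A ^ (m - j - c)))" .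
  have sq: "(s\<^sup>2) ^ c = (s ^ c)\<^sup>2" for c by (simp add: power_mult[symmetric] mult.commute)
  have "fact (2 * m) / fact m * ((A + 2 * s * B + s\<^sup>2 * C) / 2) ^ m = ?K * ((A + s\<^sup>2 * C) + 2 * s * B) ^ m"
    by (simp add: power_divide algebra_simps)
  also have "\<dots> = (\<Sum>j\<le>m. \<Sum>c\<le>m - j. ?t j c)"
    unfolding exp sum_distrib_left
    by (intro sum.cong refl) (simp add: power_mult_distrib power_add power_mult sq mult_ac)
  also have "\<dots> = (\<Sum>(j, c)\<in>(SIGMA j:{..m}. {..m - j}). ?t j c)"
    by (rule sum.Sigma) auto
  \<comment> \<open>The pair \<open>(j, c)\<close> contributes to the power
    \<open>r = j + 2 * c\<close>; the parity condition in \<open>?J r\<close> makes the division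
    \<open>(r - j) div 2\<close> exact.\<close>
  also have "\<dots> = (\<Sum>(r, j)\<in>(SIGMA r:{..2 * m}. ?J r). ?t j ((r - j) div 2))"
  proof (rule sum.reindex_bij_witness[of _ "\<lambda>(r, j). (j, (r - j) div 2)" "\<lambda>(j, c). (j + 2 * c, j)"])
    fix x assume "x \<in> (SIGMA j:{..m}. {..m - j})"
    then obtain j c where x: "x = (j, c)" "j \<le> m" "c \<le> m - j" by auto
    then show "(case case x of (j, c) \<Rightarrow> (j + 2 * c, j) of (r, j) \<Rightarrow> (j, (r - j) div 2)) = x" by simp
    have "(2 * m - (j + 2 * c)) mod 2 = j mod 2"
    proof -
      define a where "a = m - j - c"
      have a: "m = j + c + a" using x by (simp add: a_def)
      have "2 * m - (j + 2 * c) = j + 2 * a" by (simp add: a)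
      then show ?thesis by simp
    qed
    then show "(case x of (j, c) \<Rightarrow> (j + 2 * c, j)) \<in> (SIGMA r:{..2 * m}. ?J r)" using x by auto
    show "(case case x of (j, c) \<Rightarrow> (j + 2 * c, j) of (r, j) \<Rightarrow> ?t j ((r - j) div 2)) = (case x of (j, c) \<Rightarrow> ?t j c)"
      using x by simp
  next
    fix x assume "x \<in> (SIGMA r:{..2 * m}. ?J r)"
    then obtain r j where x: "x = (r, j)" "r \<le> 2 * m" "j \<le> 2 * m - r" "j \<le> r" "j mod 2 = (2 * m - r) mod 2" by auto
    then have "even j = even (2 * m - r)" by (simp add: even_iff_mod_2_eq_zero)
    then have "even (r - j)" using x by simp
    then obtain c where "r - j = 2 * c" by (rule evenE)
    then have c: "r = j + 2 * c" using x by linarith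
    then show "(case case x of (r, j) \<Rightarrow> (j, (r - j) div 2) of (j, c) \<Rightarrow> (j + 2 * c, j)) = x"
      "(case x of (r, j) \<Rightarrow> (j, (r - j) div 2)) \<in> (SIGMA j:{..m}. {..m - j})" using x by auto
  qed
  also have "\<dots> = (\<Sum>r\<le>2 * m. \<Sum>j\<in>?J r. ?t j ((r - j) div 2))"
    by (rule sum.Sigma[symmetric]) (auto intro: finite_subset[of _ "{..2 * m}"])
  also have "\<dots> = (\<Sum>r\<le>2 * m. (of_nat (2 * m choose r) * gauss_coeff A B C (2 * m - r) r) * s ^ r)"
  proof (rule sum.cong[OF refl])
    fix r assume r: "r \<in> {..2 * m}"
    show "(\<Sum>j\<in>?J r. ?t j ((r - j) div 2)) = (of_nat (2 * m choose r) * gauss_coeff A B C (2 * m - r) r) * s ^ r"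
      unfolding gauss_coeff_def sum_distrib_left sum_distrib_right
    proof (rule sum.cong[OF refl])
      fix j assume "j \<in> ?J r"
      then have x: "r \<le> 2 * m" "j \<le> 2 * m - r" "j \<le> r" "j mod 2 = (2 * m - r) mod 2" using r by auto
      have "even j = even (2 * m - r)" using x(4) by (simp add: even_iff_mod_2_eq_zero)
      then have "even (r - j)" "even (2 * m - r - j)" using x by simp_all
      then obtain c a where "r - j = 2 * c" "2 * m - r - j = 2 * a" by (elim evenE)
      then have c: "r = j + 2 * c" "2 * m - r = j + 2 * a" using x by linarith+
      then have m: "m = j + a + c" using x by linarith
      have cc: "(r - j) div 2 = c" "m - j - c = a" "j + 2 * c = r" using c m by auto
      show "?t j ((r - j) div 2) = of_nat (2 * m choose r) * (of_nat (2 * m - r choose j) * of_nat (r choose j) * of_nat (fact j)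
            * of_nat (dfact (2 * m - r - j - 1)) * of_nat (dfact (r - j - 1))
            * B ^ j * A ^ ((2 * m - r - j) div 2) * C ^ ((r - j) div 2)) * s ^ r"
        unfolding gauss_coeff_term[OF c(2,1) m] unfolding cc ..
    qed
  qed
  finally show ?thesis .
qed

section \<open>Linear combinations of two power tolls\<close>

lemma toll_sum_linear:
  "toll_sum (\<lambda>n. a n + s * b n) t = toll_sum a t + s * toll_sum b t"
proof (induction t)
  case (Node ts)
  have "sum_list (map (toll_sum (\<lambda>n. a n + s * b n)) ts) = sum_list (map (\<lambda>t. toll_sum a t + s * toll_sum b t) ts)"
    using Node by (intro arg_cong[where f = sum_list] map_cong) auto
  also have "\<dots> = sum_list (map (toll_sum a) ts) + s * sum_list (map (toll_sum b) ts)"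
    by (simp add: sum_list_addf sum_list_const_mult)
  finally show ?case by (simp add: algebra_simps)
qed

lemma of_nat_sum_list_tsize: "(of_nat (sum_list (map tsize ts)) :: complex) = sum_list (map (\<lambda>t. of_nat (tsize t)) ts)"
  by (induction ts) auto

text \<open>The subtracted multiple of the size is distributed over the vertices, one
  \<open>gw_mu\<close> each, and becomes part of the toll.\<close>

lemma F_alpha_eq_toll_sum:
  "F_alpha p \<alpha> t = toll_sum (\<lambda>n. (of_nat n :: complex) powr \<alpha> - gw_mu p \<alpha>) t"
proof -
  have "toll_sum (\<lambda>n. (of_nat n :: complex) powr \<alpha> - gw_mu p \<alpha>) t = fringe_pow_sum \<alpha> t - of_nat (tsize t) * gw_mu p \<alpha>"
  proof (induction t)
    case (Node ts)
    have "sum_list (map (toll_sum (\<lambda>n. (of_nat n :: complex) powr \<alpha> - gw_mu p \<alpha>)) ts)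
        = sum_list (map (\<lambda>t. fringe_pow_sum \<alpha> t - of_nat (tsize t) * gw_mu p \<alpha>) ts)"
      using Node by (intro arg_cong[where f = sum_list] map_cong) auto
    also have "\<dots> = sum_list (map (fringe_pow_sum \<alpha>) ts) - of_nat (sum_list (map tsize ts)) * gw_mu p \<alpha>"
      by (simp add: sum_list_subtractf sum_list_mult_const of_nat_sum_list_tsize)
    finally show ?case by (simp add: algebra_simps)
  qed
  then show ?thesis by (simp add: F_alpha_def)
qed

lemma cond_expect_add: "cond_expect p n (\<lambda>t. F t + G t) = cond_expect p n F + cond_expect p n G"
  by (simp add: cond_expect_def distrib_left sum.distrib add_divide_distrib)

lemma cond_expect_sum:
  "finite I \<Longrightarrow> cond_expect p n (\<lambda>t. \<Sum>i\<in>I. F i t) = (\<Sum>i\<in>I. cond_expect p n (F i))"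
proof (induction I rule: finite_induct)
  case empty
  then show ?case by (simp add: cond_expect_def)
next
  case (insert i I)
  then show ?case by (simp add: cond_expect_add)
qed

lemma cond_expect_mult_const: "cond_expect p n (\<lambda>t. c * F t) = c * cond_expect p n F"
  by (simp add: cond_expect_def sum_distrib_left mult.left_commute)

text \<open>Only the real part of the exponent enters the modulus, so oscillation does no harm; at
  \<open>n = 0\<close> the power is 0.\<close>

lemma nat_powr_bound:
  assumes "\<epsilon> > 0" "Re \<alpha> \<le> - \<epsilon>"
  shows "\<exists>C. \<forall>n. cmod ((of_nat n :: complex) powr \<alpha>) \<le> C * real (Suc n) powr (- \<epsilon>)"
proof (intro exI allI)
  fix n
  show "cmod ((of_nat n :: complex) powr \<alpha>) \<le> 2 powr \<bar>- \<epsilon>\<bar> * real (Suc n) powr (- \<epsilon>)"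
  proof (cases "n = 0")
    case False
    have "cmod ((of_nat n :: complex) powr \<alpha>) = real n powr Re \<alpha>"
      using norm_powr_real_powr[of "of_nat n" \<alpha>] by simp
    also have "\<dots> \<le> real n powr (- \<epsilon>)" using False assms by (intro powr_mono) auto
    also have "\<dots> \<le> 2 powr \<bar>- \<epsilon>\<bar> * real (Suc n) powr (- \<epsilon>)"
      using powr_half_compare[of "Suc n" n "- \<epsilon>"] False by simp
    finally show ?thesis .
  qed simp
qed

locale two_tolls = offspring +
  fixes \<alpha>1 \<alpha>2 :: complex and \<epsilon> :: real
  assumes e: "0 < \<epsilon>" "\<epsilon> \<le> \<delta> / 4" and a: "Re \<alpha>1 \<le> - \<epsilon>" "Re \<alpha>2 \<le> - \<epsilon>"
begin

abbreviation "pw \<alpha> \<equiv> \<lambda>n. (of_nat n :: complex) powr \<alpha>"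

definition mix :: "complex \<Rightarrow> nat \<Rightarrow> complex" where
  "mix u n = pw \<alpha>1 n + u * pw \<alpha>2 n"

definition scaled :: "nat \<Rightarrow> nat \<Rightarrow> nat \<Rightarrow> complex" where
  "scaled l r n = cond_expect p n (\<lambda>t. F_alpha p \<alpha>1 t ^ l * F_alpha p \<alpha>2 t ^ r) / complex_of_real (real n powr (real (l + r) / 2))"

lemma toll: "offspring_toll p \<delta> \<epsilon> (mix u)"
proof -
  obtain C D where C: "\<And>n. cmod (pw \<alpha>1 n) \<le> C * real (Suc n) powr (- \<epsilon>)"
    and D: "\<And>n. cmod (pw \<alpha>2 n) \<le> D * real (Suc n) powr (- \<epsilon>)"
    using nat_powr_bound[OF e(1) a(1)] nat_powr_bound[OF e(1) a(2)] by blast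
  have "cmod (mix u n) \<le> (C + cmod u * D) * real (Suc n) powr (- \<epsilon>)" for n
  proof -
    have "cmod (mix u n) \<le> cmod (pw \<alpha>1 n) + cmod u * cmod (pw \<alpha>2 n)"
      unfolding mix_def norm_mult[symmetric] by (rule norm_triangle_ineq)
    also have "\<dots> \<le> C * real (Suc n) powr (- \<epsilon>) + cmod u * (D * real (Suc n) powr (- \<epsilon>))"
      by (intro add_mono mult_left_mono C D) auto
    finally show ?thesis by (simp only: distrib_right mult.assoc)
  qed
  then show ?thesis by unfold_locales (use e in auto)
qed

lemma mu_mix: "mass (hadamard (mix u) y) = gw_mu p \<alpha>1 + u * gw_mu p \<alpha>2"
proof -
  have S: "summable (\<lambda>n. complex_of_real (gw_size_prob p n) * pw \<alpha> n)" if al: "Re \<alpha> \<le> - \<epsilon>" for \<alpha>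
  proof -
    obtain C where C: "\<And>n. cmod (pw \<alpha> n) \<le> C * real (Suc n) powr (- \<epsilon>)"
      using nat_powr_bound[OF e(1) al] by blast
    have "hadamard (pw \<alpha>) y \<in> decay (-3/2 + - \<epsilon>)"
      using decay_hadamard[OF y_decay C] by (simp add: hadamard_def)
    then have "summable (\<lambda>n. hadamard (pw \<alpha>) y $ n)" by (rule decay_summable) (use e in simp)
    then show ?thesis by (simp add: hadamard_nth y_def mult.commute)
  qed
  have "mass (hadamard (mix u) y) = (\<Sum>n. complex_of_real (gw_size_prob p n) * pw \<alpha>1 n + u * (complex_of_real (gw_size_prob p n) * pw \<alpha>2 n))"
    unfolding mass_def by (rule suminf_cong) (simp add: hadamard_nth y_def mix_def algebra_simps)
  also have "\<dots> = (\<Sum>n. complex_of_real (gw_size_prob p n) * pw \<alpha>1 n) + (\<Sum>n. u * (complex_of_real (gw_size_prob p n) * pw \<alpha>2 n))"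
    by (rule suminf_add[OF S[OF a(1)] summable_mult[OF S[OF a(2)]], symmetric])
  also have "(\<Sum>n. u * (complex_of_real (gw_size_prob p n) * pw \<alpha>2 n)) = u * (\<Sum>n. complex_of_real (gw_size_prob p n) * pw \<alpha>2 n)"
    by (rule suminf_mult[OF S[OF a(2)]])
  finally show ?thesis by (simp add: gw_mu_def)
qed

lemma mixed_moment_tendsto:
  "\<exists>\<rho>. \<forall>k. (\<lambda>n. \<Sum>r\<le>k. (of_nat (k choose r) * scaled (k - r) r n) * u ^ r)
     \<longlonglongrightarrow> (if even k then fact k / fact (k div 2) * (- \<rho>) ^ (k div 2) else 0)"
proof -
  interpret t: offspring_toll p \<delta> \<epsilon> "mix u" by (rule toll)
  have tf: "toll_sum t.f t = F_alpha p \<alpha>1 t + u * F_alpha p \<alpha>2 t" for t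
  proof -
    have "t.f = (\<lambda>n. (pw \<alpha>1 n - gw_mu p \<alpha>1) + u * (pw \<alpha>2 n - gw_mu p \<alpha>2))"
      by (rule ext) (simp add: t.f_def t.\<mu>_def mu_mix mix_def algebra_simps)
    then show ?thesis by (simp only: toll_sum_linear F_alpha_eq_toll_sum)
  qed
  have m: "t.moment k n = (\<Sum>r\<le>k. (of_nat (k choose r) * scaled (k - r) r n) * u ^ r)" for k n
  proof -
    have "(F_alpha p \<alpha>1 t + u * F_alpha p \<alpha>2 t) ^ k
        = (\<Sum>r\<le>k. (of_nat (k choose r) * u ^ r) * (F_alpha p \<alpha>1 t ^ (k - r) * F_alpha p \<alpha>2 t ^ r))" for t
      unfolding add.commute[of "F_alpha p \<alpha>1 t"] binomial_ring
      by (intro sum.cong refl) (simp add: power_mult_distrib mult_ac)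
    then have "cond_expect p n (\<lambda>t. toll_sum t.f t ^ k)
        = (\<Sum>r\<le>k. (of_nat (k choose r) * u ^ r) * cond_expect p n (\<lambda>t. F_alpha p \<alpha>1 t ^ (k - r) * F_alpha p \<alpha>2 t ^ r))"
      unfolding tf by (simp only: cond_expect_sum[OF finite_atMost] cond_expect_mult_const)
    then show ?thesis unfolding t.moment_def
      by (simp add: sum_divide_distrib scaled_def mult_ac)
  qed
  have "t.moment k = (\<lambda>n. \<Sum>r\<le>k. (of_nat (k choose r) * scaled (k - r) r n) * u ^ r)" for k
    by (rule ext) (rule m)
  then show ?thesis using t.moment_tendsto by (simp only:)
qed

definition \<kappa>20 :: complex where "\<kappa>20 = lim (scaled 2 0)"
definition \<kappa>11 :: complex where "\<kappa>11 = lim (scaled 1 1)"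
definition \<kappa>02 :: complex where "\<kappa>02 = lim (scaled 0 2)"

text \<open>The limits exist separately because the three coefficients of a quadratic polynomial can
  be recovered from its values at 0, 1 and -1.\<close>

lemma second_moments:
  "scaled 2 0 \<longlonglongrightarrow> \<kappa>20" "scaled 1 1 \<longlonglongrightarrow> \<kappa>11" "scaled 0 2 \<longlonglongrightarrow> \<kappa>02"
proof -
  let ?P = "\<lambda>u n. scaled 2 0 n + 2 * scaled 1 1 n * u + scaled 0 2 n * u\<^sup>2"
  have ex: "convergent (?P u)" for u
  proof -
    obtain \<rho> where "\<And>k. (\<lambda>n. \<Sum>r\<le>k. (of_nat (k choose r) * scaled (k - r) r n) * u ^ r)
     \<longlonglongrightarrow> (if even k then fact k / fact (k div 2) * (- \<rho>) ^ (k div 2) else 0)"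
      using mixed_moment_tendsto[of u] by blast
    from this[of 2] have "convergent (\<lambda>n. \<Sum>r\<le>2. (of_nat (2 choose r) * scaled (2 - r) r n) * u ^ r)"
      by (auto simp: convergent_def)
    then show ?thesis by (simp add: numeral_2_eq_2)
  qed
  have c0: "convergent (scaled 2 0)" using ex[of 0] by simp
  have c1: "convergent (\<lambda>n. (?P 1 n - ?P (- 1) n) * (1/4))"
    by (intro convergent_mult convergent_diff ex convergent_const)
  have c2: "convergent (\<lambda>n. (?P 1 n + ?P (- 1) n) * (1/2) - scaled 2 0 n)"
    by (intro convergent_mult convergent_diff convergent_add ex c0 convergent_const)
  have "(\<lambda>n. (?P 1 n - ?P (- 1) n) * (1/4)) = scaled 1 1" by (rule ext) (simp add: algebra_simps)
  then have c1': "convergent (scaled 1 1)" using c1 by (simp only:)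
  have "(\<lambda>n. (?P 1 n + ?P (- 1) n) * (1/2) - scaled 2 0 n) = scaled 0 2" by (rule ext) (simp add: algebra_simps)
  then have c2': "convergent (scaled 0 2)" using c2 by (simp only:)
  show "scaled 2 0 \<longlonglongrightarrow> \<kappa>20" "scaled 1 1 \<longlonglongrightarrow> \<kappa>11" "scaled 0 2 \<longlonglongrightarrow> \<kappa>02"
    using c0 c1' c2' by (simp_all add: \<kappa>20_def \<kappa>11_def \<kappa>02_def convergent_LIMSEQ_iff)
qed

text \<open>The parameter \<open>\<rho>\<close> of the mixed toll depends on \<open>u\<close> and is
  eliminated by the case \<open>k = 2\<close>, where the limit is
  \<open>- 2 * \<rho>\<close>.\<close>

lemma mixed_moment_limit:
  "(\<lambda>n. \<Sum>r\<le>k. (of_nat (k choose r) * scaled (k - r) r n) * u ^ r)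
     \<longlonglongrightarrow> (if even k then fact k / fact (k div 2) * ((\<kappa>20 + 2 * u * \<kappa>11 + u\<^sup>2 * \<kappa>02) / 2) ^ (k div 2) else 0)"
proof -
  obtain \<rho> where \<rho>: "\<And>k. (\<lambda>n. \<Sum>r\<le>k. (of_nat (k choose r) * scaled (k - r) r n) * u ^ r)
     \<longlonglongrightarrow> (if even k then fact k / fact (k div 2) * (- \<rho>) ^ (k div 2) else 0)"
    using mixed_moment_tendsto[of u] by blast
  have "(\<lambda>n. \<Sum>r\<le>2. (of_nat (2 choose r) * scaled (2 - r) r n) * u ^ r) \<longlonglongrightarrow> 2 * (- \<rho>)"
    using \<rho>[of 2] by simp
  moreover have "(\<lambda>n. \<Sum>r\<le>2. (of_nat (2 choose r) * scaled (2 - r) r n) * u ^ r)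
      = (\<lambda>n. scaled 2 0 n + 2 * u * scaled 1 1 n + u\<^sup>2 * scaled 0 2 n)"
    by (rule ext) (simp add: numeral_2_eq_2 mult_ac)
  ultimately have L1: "(\<lambda>n. scaled 2 0 n + 2 * u * scaled 1 1 n + u\<^sup>2 * scaled 0 2 n) \<longlonglongrightarrow> 2 * (- \<rho>)"
    by (simp only:)
  have L2: "(\<lambda>n. scaled 2 0 n + 2 * u * scaled 1 1 n + u\<^sup>2 * scaled 0 2 n) \<longlonglongrightarrow> \<kappa>20 + 2 * u * \<kappa>11 + u\<^sup>2 * \<kappa>02"
    by (intro tendsto_intros second_moments)
  have "- \<rho> = (2 * (- \<rho>)) / 2" by simp
  also have "\<dots> = (\<kappa>20 + 2 * u * \<kappa>11 + u\<^sup>2 * \<kappa>02) / 2"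
    by (simp only: LIMSEQ_unique[OF L1 L2])
  finally have "- \<rho> = (\<kappa>20 + 2 * u * \<kappa>11 + u\<^sup>2 * \<kappa>02) / 2" .
  then show ?thesis using \<rho>[of k] by (simp only:)
qed

lemma joint_moments:
  "scaled l r \<longlonglongrightarrow> (if even (l + r) then gauss_coeff \<kappa>20 \<kappa>11 \<kappa>02 l r else 0)"
proof -
  let ?k = "l + r"
  let ?b = "\<lambda>r. if even ?k then of_nat (?k choose r) * gauss_coeff \<kappa>20 \<kappa>11 \<kappa>02 (?k - r) r else 0"
  have "(\<lambda>n. \<Sum>r\<le>?k. (of_nat (?k choose r) * scaled (?k - r) r n) * u ^ r) \<longlonglongrightarrow> (\<Sum>r\<le>?k. ?b r * u ^ r)" for u
  proof (cases "even ?k")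
    case True
    then obtain m where m: "?k = 2 * m" by (rule evenE)
    have "(if even ?k then fact ?k / fact (?k div 2) * ((\<kappa>20 + 2 * u * \<kappa>11 + u\<^sup>2 * \<kappa>02) / 2) ^ (?k div 2) else 0)
        = (\<Sum>r\<le>?k. ?b r * u ^ r)"
      unfolding m using gauss_coeff_expansion[of m \<kappa>20 u \<kappa>11 \<kappa>02] by simp
    then show ?thesis using mixed_moment_limit[of ?k u] by (simp only:)
  next
    case False
    have "(\<Sum>r\<le>?k. ?b r * u ^ r) = 0" using False by (intro sum.neutral) auto
    then show ?thesis using mixed_moment_limit[of ?k u] False by (simp only: if_False)
  qed
  from poly_coeff_tendsto[of "\<lambda>r n. of_nat (?k choose r) * scaled (?k - r) r n" ?k ?b r, OF this]
  have "(\<lambda>n. of_nat (?k choose r) * scaled l r n) \<longlonglongrightarrow> ?b r" by simp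
  from tendsto_mult[OF tendsto_const[of "inverse (of_nat (?k choose r))"] this]
  have L: "(\<lambda>n. inverse (of_nat (?k choose r)) * (of_nat (?k choose r) * scaled l r n)) \<longlonglongrightarrow> inverse (of_nat (?k choose r)) * ?b r" .
  have nz: "(of_nat (?k choose r) :: complex) \<noteq> 0" by simp
  have inv: "inverse (of_nat (?k choose r)) * (of_nat (?k choose r) * x) = x" for x :: complex
    unfolding mult.assoc[symmetric] left_inverse[OF nz] by (rule mult_1_left)
  have "inverse (of_nat (?k choose r)) * ?b r = (if even (l + r) then gauss_coeff \<kappa>20 \<kappa>11 \<kappa>02 l r else 0)"
  proof (cases "even ?k")
    case True
    have "?k - r = l" by simp
    then show ?thesis using True by (simp only: if_True inv)
  next
    case False
    then show ?thesis by (simp only: if_False mult_zero_right)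
  qed
  then show ?thesis using L by (simp only: inv)
qed

end

theorem theorem5p2:
  fixes p :: "nat pmf" and \<delta> :: real and \<alpha>1 \<alpha>2 :: complex
  assumes mean: "measure_pmf.expectation p real = 1"
    and var_pos: "measure_pmf.variance p real > 0"
    and span: "Gcd {k. pmf p k > 0} = 1"
    and delta: "\<delta> > 0"
    and mom: "integrable (measure_pmf p) (\<lambda>k. real k powr (2 + \<delta>))"
    and a1: "Re \<alpha>1 < 0" and a2: "Re \<alpha>2 < 0"
  shows "\<exists>\<kappa>20 \<kappa>11 \<kappa>02 :: complex. \<forall>l r :: nat.
     (even (l + r) \<longrightarrow>
        (\<lambda>n. cond_expect p n (\<lambda>t. F_alpha p \<alpha>1 t ^ l * F_alpha p \<alpha>2 t ^ r)
              / complex_of_real (real n powr (real (l + r) / 2)))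
        \<longlonglongrightarrow>
        (\<Sum>j\<in>{j. j \<le> min l r \<and> j mod 2 = l mod 2}.
            of_nat (l choose j) * of_nat (r choose j) * of_nat (fact j)
            * of_nat (dfact (l - j - 1)) * of_nat (dfact (r - j - 1))
            * \<kappa>11 ^ j * \<kappa>20 ^ ((l - j) div 2) * \<kappa>02 ^ ((r - j) div 2)))
   \<and> (odd (l + r) \<longrightarrow>
        (\<lambda>n. cond_expect p n (\<lambda>t. F_alpha p \<alpha>1 t ^ l * F_alpha p \<alpha>2 t ^ r)
              / complex_of_real (real n powr (real (l + r) / 2)))
        \<longlonglongrightarrow> 0)"
proof -
  \<comment> \<open>Lowering \<open>\<delta>\<close> to at most 1 keeps the moment condition and
    meets the locale's range; \<open>\<epsilon>\<close> then accommodates the decay of both tolls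
    and the rate of the local limit theorem.\<close>
  define d where "d = min \<delta> 1"
  define \<epsilon> where "\<epsilon> = min (d / 4) (min (- Re \<alpha>1) (- Re \<alpha>2))"
  have d: "0 < d" "d \<le> 1" "d \<le> \<delta>" using delta by (auto simp: d_def)
  have "integrable (measure_pmf p) (\<lambda>k. real k powr (2 + d))"
  proof (rule Bochner_Integration.integrable_bound)
    show "integrable (measure_pmf p) (\<lambda>k. real k powr (2 + \<delta>))" by (rule mom)
    have "real k powr (2 + d) \<le> real k powr (2 + \<delta>)" for k
      using d by (cases "k = 0") (auto intro: powr_mono)
    then show "AE k in measure_pmf p. norm (real k powr (2 + d)) \<le> norm (real k powr (2 + \<delta>))"
      by (intro AE_I2) simp
  qed simp
  then have "two_tolls p d \<alpha>1 \<alpha>2 \<epsilon>"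
    using mean var_pos span d a1 a2 by unfold_locales (auto simp: \<epsilon>_def)
  then interpret two_tolls p d \<alpha>1 \<alpha>2 \<epsilon> .
  show ?thesis
  proof (rule exI[of _ \<kappa>20], rule exI[of _ \<kappa>11], rule exI[of _ \<kappa>02], intro allI conjI impI)
    fix l r :: nat
    note J = joint_moments[of l r, unfolded scaled_def[abs_def] gauss_coeff_def]
    show "(\<lambda>n. cond_expect p n (\<lambda>t. F_alpha p \<alpha>1 t ^ l * F_alpha p \<alpha>2 t ^ r)
              / complex_of_real (real n powr (real (l + r) / 2)))
        \<longlonglongrightarrow>
        (\<Sum>j\<in>{j. j \<le> min l r \<and> j mod 2 = l mod 2}.
            of_nat (l choose j) * of_nat (r choose j) * of_nat (fact j)
            * of_nat (dfact (l - j - 1)) * of_nat (dfact (r - j - 1))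
            * \<kappa>11 ^ j * \<kappa>20 ^ ((l - j) div 2) * \<kappa>02 ^ ((r - j) div 2))" if "even (l + r)"
      using J that by (simp only: if_True)
    show "(\<lambda>n. cond_expect p n (\<lambda>t. F_alpha p \<alpha>1 t ^ l * F_alpha p \<alpha>2 t ^ r)
              / complex_of_real (real n powr (real (l + r) / 2)))
        \<longlonglongrightarrow> 0" if "odd (l + r)"
      using J that by (simp only: if_False)
  qed
qed

end
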